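(* Let $\varepsilon\in\{+,-\}$ and $\boldsymbol\lambda\in\mathcal P_{n,r}$. Then $P^{\varepsilon}_{\boldsymbol\lambda}(x;\mathbf t)$ is the unique element $F\in\Xi^n_{\mathbb Q}(\mathbf t)$ such that (i) $F=\sum_{\boldsymbol\mu\succeq\boldsymbol\lambda}c_{\boldsymbol\lambda,\boldsymbol\mu}(\mathbf t)q^{\varepsilon}_{\boldsymbol\mu}(x;\mathbf t)$ with $c_{\boldsymbol\lambda,\boldsymbol\mu}(\mathbf t)\in\mathbb Q(\mathbf t)$ and $c_{\boldsymbol\lambda,\boldsymbol\lambda}(\mathbf t)\ne0$, and (ii) $F=\sum_{\boldsymbol\mu\preceq\boldsymbol\lambda}u_{\boldsymbol\lambda,\boldsymbol\mu}(\mathbf t)s_{\boldsymbol\mu}(x)$ with $u_{\boldsymbol\lambda,\boldsymbol\mu}(\mathbf t)\in\mathbb Q(\mathbf t)$ and $u_{\boldsymbol\lambda,\boldsymbol\lambda}(\mathbf t)=1$. Likewise $Q^{\varepsilon}_{\boldsymbol\lambda}(x;\mathbf t)$ is the unique element satisfying (i) and (ii) with the normalizations replaced by $c_{\boldsymbol\lambda,\boldsymbol\lambda}(\mathbf t)=1$ and $u_{\boldsymbol\lambda,\boldsymbol\lambda}(\mathbf t)\ne0$.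
   Context: Fix an integer $r\ge 2$. Let $x=(x^{(1)},\dots,x^{(r)})$, each $x^{(k)}=(x^{(k)}_1,x^{(k)}_2,\dots)$ an infinite family of variables; upper indices mod $r$ in $\{1,\dots,r\}$. $\Xi^n$ is the $\mathbb Z$-module of homogeneous degree-$n$ functions symmetric in each $x^{(k)}$ separately. $\mathbf t=(t_1,\dots,t_r)$ indeterminates, lower indices mod $r$ in $\{1,\dots,r\}$ ($t_0$ means $t_r$); $\Xi^n_{\mathbb Q}(\mathbf t)=\mathbb Q(\mathbf t)\otimes\Xi^n$. $\mathcal A\subset\mathbb Q(\mathbf t)$ is the subring of $f/g$ with $g(0,\dots,0)\ne0$, $\Xi^n_{\mathcal A}=\mathcal A\otimes\Xi^n$. $\mathcal P_{n,r}$: $r$-tuples $\boldsymbol\lambda=(\lambda^{(1)},\dots,\lambda^{(r)})$ of partitions with $\sum_k|\lambda^{(k)}|=n$; $s_{\boldsymbol\lambda}=\prod_ks_{\lambda^{(k)}}(x^{(k)})$, $m_{\boldsymbol\lambda}=\prod_km_{\lambda^{(k)}}(x^{(k)})$. Define $q^{(k)}_{s,\pm}(x;t)$ by $\sum_{s\ge0}q^{(k)}_{s,\pm}(x;t)u^s=\prod_{i\ge1}\frac{1-tux^{(k\mp1)}_i}{1-ux^{(k)}_i}$, and $q^{+}_{\boldsymbol\lambda}=\prod_{k}\prod_{i}q^{(k)}_{\lambda^{(k)}_i,+}(x;t_{k-1})$, $q^{-}_{\boldsymbol\lambda}=\prod_k\prod_iq^{(k)}_{\lambda^{(k)}_i,-}(x;t_k)$.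 $\langle\ ,\ \rangle$ is the $\mathbb Q(\mathbf t)$-bilinear form on $\Xi^n_{\mathbb Q}(\mathbf t)$ with $\langle q^+_{\boldsymbol\lambda},m_{\boldsymbol\mu}\rangle=\delta_{\boldsymbol\lambda,\boldsymbol\mu}$. Dominance order: with $m\ge$ all lengths, $c(\boldsymbol\lambda)=(\lambda^{(1)}_1,\dots,\lambda^{(r)}_1,\lambda^{(1)}_2,\dots,\lambda^{(r)}_2,\dots,\lambda^{(1)}_m,\dots,\lambda^{(r)}_m)$ and $\boldsymbol\lambda\le\boldsymbol\mu$ iff all partial sums of $c(\boldsymbol\lambda)$ are $\le$ those of $c(\boldsymbol\mu)$. Fix a total order $\preceq$ on $\mathcal P_{n,r}$ refining $\le$. The Hall–Littlewood functions $P^{\pm}_{\boldsymbol\lambda}(x;\mathbf t)$ are the unique family in $\Xi^n_{\mathcal A}$ with: $P^\pm_{\boldsymbol\lambda}=s_{\boldsymbol\lambda}+\sum_{\boldsymbol\mu\prec\boldsymbol\lambda}u^\pm_{\boldsymbol\lambda\boldsymbol\mu}s_{\boldsymbol\mu}$ ($u^\pm_{\boldsymbol\lambda\boldsymbol\mu}\in\mathcal A$), $\langle P^+_{\boldsymbol\lambda},P^-_{\boldsymbol\mu}\rangle=0$ for $\boldsymbol\lambda\ne\boldsymbol\mu$, and $P^\pm_{\boldsymbol\lambda}(x;0,\dots,0)=s_{\boldsymbol\lambda}$. Put $b_{\boldsymbol\lambda}(\mathbf t)=\langle P^+_{\boldsymbol\lambda},P^-_{\boldsymbol\lambda}\rangle^{-1}$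 (which is nonzero) and $Q^\pm_{\boldsymbol\lambda}=b_{\boldsymbol\lambda}(\mathbf t)P^\pm_{\boldsymbol\lambda}$. *)

theory Defs
  imports Complex_Main "HOL-Library.Poly_Mapping" "HOL-Library.Multiset"
    "HOL-Computational_Algebra.Fraction_Field"
begin

text \<open>Multivariate polynomials over Q in variables t_0, t_1, t_2, ... (we only use t_1..t_r),
  and their field of fractions.\<close>
type_synonym tpoly = "(nat \<Rightarrow>\<^sub>0 nat) \<Rightarrow>\<^sub>0 rat"
type_synonym ratfun = "tpoly fract"

definition tvar :: "nat \<Rightarrow> ratfun" where
  "tvar k = Fraction_Field.Fract (Poly_Mapping.single (Poly_Mapping.single k 1) 1) 1"

text \<open>lower index mod r in {1..r}: t_0 means t_r\<close>
definition tmod :: "nat \<Rightarrow> int \<Rightarrow> nat" where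
  "tmod r k = nat ((k - 1) mod int r) + 1"

definition tt :: "nat \<Rightarrow> int \<Rightarrow> ratfun" where
  "tt r k = tvar (tmod r k)"

text \<open>The subring A: f/g with g(0,...,0) \<noteq> 0 (value at 0 = constant coefficient).\<close>
definition Asub :: "ratfun set" where
  "Asub = {x. \<exists>f g. x = Fraction_Field.Fract f g \<and> Poly_Mapping.lookup g 0 \<noteq> 0}"

definition eval0 :: "ratfun \<Rightarrow> rat" where
  "eval0 x = (THE v. \<exists>f g. x = Fraction_Field.Fract f g \<and> Poly_Mapping.lookup g 0 \<noteq> 0 \<and> v = Poly_Mapping.lookup f 0 / Poly_Mapping.lookup g 0)"

text \<open>Variable x^(k)_i is the pair (k,i), with k \<in> {1..r} and i \<in> nat (indexing from 0
  instead of 1 is an irrelevant relabelling). A monomial is an exponent function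
  (of finite support); a formal series is its coefficient function.\<close>
type_synonym mono = "nat \<times> nat \<Rightarrow> nat"
type_synonym 'a series = "mono \<Rightarrow> 'a"

definition msupp :: "mono \<Rightarrow> (nat \<times> nat) set" where
  "msupp m = {v. m v \<noteq> 0}"

definition mdeg :: "mono \<Rightarrow> nat" where
  "mdeg m = (\<Sum>v\<in>msupp m. m v)"

definition sadd :: "'a::comm_ring_1 series \<Rightarrow> 'a series \<Rightarrow> 'a series" where
  "sadd f g = (\<lambda>m. f m + g m)"

definition ssmult :: "'a::comm_ring_1 \<Rightarrow> 'a series \<Rightarrow> 'a series" where
  "ssmult c f = (\<lambda>m. c * f m)"

definition sone :: "'a::comm_ring_1 series" where
  "sone = (\<lambda>m. if m = (\<lambda>_. 0) then 1 else 0)"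

text \<open>Cauchy product of formal series (finite sum for finitely supported monomials).\<close>
definition smult :: "'a::comm_ring_1 series \<Rightarrow> 'a series \<Rightarrow> 'a series" where
  "smult f g = (\<lambda>m. \<Sum>a\<in>{a. \<forall>v. a v \<le> m v}. f a * g (\<lambda>v. m v - a v))"

definition sprod_list :: "'a::comm_ring_1 series list \<Rightarrow> 'a series" where
  "sprod_list fs = foldr smult fs sone"

definition lincomb :: "'b set \<Rightarrow> ('b \<Rightarrow> 'a::comm_ring_1) \<Rightarrow> ('b \<Rightarrow> 'a series) \<Rightarrow> 'a series" where
  "lincomb S c B = (\<lambda>m. \<Sum>\<mu>\<in>S. c \<mu> * B \<mu> m)"

definition umod :: "nat \<Rightarrow> int \<Rightarrow> nat" where
  "umod r k = nat ((k - 1) mod int r) + 1"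

definition Xi :: "nat \<Rightarrow> nat \<Rightarrow> 'a::comm_ring_1 set \<Rightarrow> 'a series set" where
  "Xi r n C = {F. (\<forall>m. F m \<in> C)
     \<and> (\<forall>m. F m \<noteq> 0 \<longrightarrow> finite (msupp m) \<and> mdeg m = n \<and> (\<forall>(k,i)\<in>msupp m. k \<in> {1..r}))
     \<and> (\<forall>k \<sigma> m. bij \<sigma> \<longrightarrow>
           F (\<lambda>(j,i). if j = k then m (j, \<sigma> i) else m (j, i)) = F m)}"

definition is_partition :: "nat list \<Rightarrow> bool" where
  "is_partition l \<longleftrightarrow> sorted (rev l) \<and> 0 \<notin> set l"

type_synonym multipart = "nat \<Rightarrow> nat list"

definition Pnr :: "nat \<Rightarrow> nat \<Rightarrow> multipart set" where
  "Pnr n r = {L. (\<forall>k\<in>{1..r}. is_partition (L k)) \<and> (\<forall>k. k \<notin> {1..r} \<longrightarrow> L k = [])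
               \<and> (\<Sum>k=1..r. sum_list (L k)) = n}"

definition part :: "nat list \<Rightarrow> nat \<Rightarrow> nat" where
  "part l i = (if i < length l then l ! i else 0)"

text \<open>the sequence c(lambda) = (lambda^(1)_1, ..., lambda^(r)_1, lambda^(1)_2, ...)\<close>
definition cseq :: "nat \<Rightarrow> multipart \<Rightarrow> nat \<Rightarrow> nat" where
  "cseq r L j = part (L (j mod r + 1)) (j div r)"

definition dominates :: "nat \<Rightarrow> multipart \<Rightarrow> multipart \<Rightarrow> bool" where
  "dominates r L M \<longleftrightarrow> (\<forall>N. (\<Sum>j<N. cseq r L j) \<le> (\<Sum>j<N. cseq r M j))"

definition cells :: "nat list \<Rightarrow> (nat \<times> nat) set" where
  "cells l = {(i,j). i < length l \<and> j < l ! i}"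

definition ssyt :: "nat list \<Rightarrow> (nat \<times> nat \<Rightarrow> nat) \<Rightarrow> bool" where
  "ssyt l T \<longleftrightarrow> (\<forall>c. c \<notin> cells l \<longrightarrow> T c = 0)
     \<and> (\<forall>i j. (i, Suc j) \<in> cells l \<longrightarrow> T (i,j) \<le> T (i, Suc j))
     \<and> (\<forall>i j. (Suc i, j) \<in> cells l \<longrightarrow> T (i,j) < T (Suc i, j))"

definition schur1 :: "nat \<Rightarrow> nat list \<Rightarrow> 'a::comm_ring_1 series" where
  "schur1 k l = (\<lambda>m. if finite (msupp m) \<and> (\<forall>(j,i)\<in>msupp m. j = k)
      then of_nat (card {T. ssyt l T \<and> (\<forall>v. m (k,v) = card {c\<in>cells l. T c = v})}) else 0)"

definition schur :: "nat \<Rightarrow> multipart \<Rightarrow> 'a::comm_ring_1 series" where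
  "schur r L = sprod_list (map (\<lambda>k. schur1 k (L k)) [1..<Suc r])"

definition fam_exps :: "mono \<Rightarrow> nat \<Rightarrow> nat multiset" where
  "fam_exps m k = image_mset (\<lambda>i. m (k,i)) (mset_set {i. m (k,i) \<noteq> 0})"

definition monsym :: "nat \<Rightarrow> multipart \<Rightarrow> 'a::comm_ring_1 series" where
  "monsym r L = (\<lambda>m. if finite (msupp m) \<and> (\<forall>(k,i)\<in>msupp m. k \<in> {1..r})
      \<and> (\<forall>k\<in>{1..r}. fam_exps m k = mset (L k)) then 1 else 0)"

definition hfam :: "nat \<Rightarrow> nat \<Rightarrow> 'a::comm_ring_1 series" where
  "hfam k a = (\<lambda>m. if finite (msupp m) \<and> (\<forall>(j,i)\<in>msupp m. j = k) \<and> mdeg m = a then 1 else 0)"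

definition efam :: "nat \<Rightarrow> nat \<Rightarrow> 'a::comm_ring_1 series" where
  "efam k b = (\<lambda>m. if finite (msupp m) \<and> (\<forall>(j,i)\<in>msupp m. j = k) \<and> (\<forall>v. m v \<le> 1)
                     \<and> mdeg m = b then 1 else 0)"

text \<open>Coefficient of u^s in prod_i (1 - t u x^(j)_i)/(1 - u x^(k)_i), j = k-+1:
  sum_{b<=s} (-t)^b h_{s-b}(x^(k)) e_b(x^(j)).\<close>
definition qfun :: "nat \<Rightarrow> nat \<Rightarrow> ratfun \<Rightarrow> nat \<Rightarrow> ratfun series" where
  "qfun k j t s = (\<lambda>m. \<Sum>b\<le>s. (- t) ^ b * smult (hfam k (s - b)) (efam j b) m)"

text \<open>eps = True means +, eps = False means -.\<close>
definition qsingle :: "nat \<Rightarrow> bool \<Rightarrow> nat \<Rightarrow> nat \<Rightarrow> ratfun series" where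
  "qsingle r eps k s = (if eps then qfun k (umod r (int k - 1)) (tt r (int k - 1)) s
                               else qfun k (umod r (int k + 1)) (tt r (int k)) s)"

definition qmulti :: "nat \<Rightarrow> bool \<Rightarrow> multipart \<Rightarrow> ratfun series" where
  "qmulti r eps L = sprod_list (concat (map (\<lambda>k. map (qsingle r eps k) (L k)) [1..<Suc r]))"

definition coords :: "nat \<Rightarrow> nat \<Rightarrow> (multipart \<Rightarrow> ratfun series) \<Rightarrow> ratfun series \<Rightarrow> multipart \<Rightarrow> ratfun" where
  "coords r n B F = (THE a. (\<forall>L. L \<notin> Pnr n r \<longrightarrow> a L = 0) \<and> F = lincomb (Pnr n r) a B)"

text \<open>the form with <q^+_L, m_M> = delta_{L,M}\<close>
definition form :: "nat \<Rightarrow> nat \<Rightarrow> ratfun series \<Rightarrow> ratfun series \<Rightarrow> ratfun" where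
  "form r n F G = (\<Sum>L\<in>Pnr n r. coords r n (qmulti r True) F L * coords r n (monsym r) G L)"

text \<open>R is the fixed total order \<preceq> on P_{n,r} (as a set of pairs (L,M) meaning L \<preceq> M).\<close>
definition HL_conds :: "nat \<Rightarrow> nat \<Rightarrow> multipart rel \<Rightarrow> (multipart \<Rightarrow> ratfun series) \<Rightarrow> bool" where
  "HL_conds r n R P \<longleftrightarrow>
     (\<forall>L\<in>Pnr n r. P L \<in> Xi r n Asub
        \<and> (\<exists>u. (\<forall>M. u M \<in> Asub) \<and> u L = 1 \<and>
               P L = lincomb {M\<in>Pnr n r. (M,L) \<in> R} u (schur r))
        \<and> (\<forall>m. eval0 (P L m) = of_int (schur r L m)))"

definition HL_pair :: "nat \<Rightarrow> nat \<Rightarrow> multipart rel \<Rightarrow> (multipart \<Rightarrow> ratfun series) \<times> (multipart \<Rightarrow> ratfun series)" where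
  "HL_pair r n R = (THE PP. (\<forall>L. L \<notin> Pnr n r \<longrightarrow> fst PP L = (\<lambda>_. 0) \<and> snd PP L = (\<lambda>_. 0))
      \<and> HL_conds r n R (fst PP) \<and> HL_conds r n R (snd PP)
      \<and> (\<forall>L\<in>Pnr n r. \<forall>M\<in>Pnr n r. L \<noteq> M \<longrightarrow> form r n (fst PP L) (snd PP M) = 0))"

definition HLP :: "nat \<Rightarrow> nat \<Rightarrow> multipart rel \<Rightarrow> bool \<Rightarrow> multipart \<Rightarrow> ratfun series" where
  "HLP r n R eps L = (if eps then fst (HL_pair r n R) L else snd (HL_pair r n R) L)"

definition bfun :: "nat \<Rightarrow> nat \<Rightarrow> multipart rel \<Rightarrow> multipart \<Rightarrow> ratfun" where
  "bfun r n R L = inverse (form r n (HLP r n R True L) (HLP r n R False L))"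

definition HLQ :: "nat \<Rightarrow> nat \<Rightarrow> multipart rel \<Rightarrow> bool \<Rightarrow> multipart \<Rightarrow> ratfun series" where
  "HLQ r n R eps L = ssmult (bfun r n R L) (HLP r n R eps L)"

end

theory Submission
  imports Defs "HOL-Combinatorics.Permutations" "HOL-Library.FuncSet"
begin

text \<open>
  Let \<open>A\<close> be the matrix of \<open>q\<^sup>+\<close> in the basis \<open>m\<close>. The Cauchy kernel is symmetric in exchanging
  \<open>x, +\<close> with \<open>y, -\<close>, so the matrix of \<open>q\<^sup>-\<close> is the transpose of \<open>A\<close>. At \<open>\<^bold>t = 0\<close> the matrix \<open>A\<close>
  becomes \<open>K\<^sup>T K\<close> with \<open>K\<close> the Kostka matrix (RSK), which is unitriangular. Since \<open>\<A>\<close> is a local ring,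
  Gaussian elimination gives \<open>A = Y\<^sup>T D X\<close> with \<open>X, Y\<close> unitriangular over \<open>\<A>\<close>, reducing to \<open>K\<close> at the
  origin, and \<open>D\<close> diagonal. Then \<open>P\<^sup>+ = X m\<close> and \<open>P\<^sup>- = Y m\<close> are the Hall--Littlewood functions, the
  form is \<open>D\<inverse>\<close> on them, and \<open>q\<^sup>+ = Y\<^sup>T D P\<^sup>+\<close>, \<open>q\<^sup>- = X\<^sup>T D P\<^sup>-\<close>. Thus \<open>P\<^sup>\<plusminus>\<close> is lower triangular over the
  Schur functions and upper triangular over the \<open>q\<^sup>\<plusminus>\<close>, and two opposite triangularities leave only
  multiples of a single \<open>P\<^sup>\<plusminus>\<close>.
\<close>

subsection \<open>Triangular linear algebra\<close>

text \<open>\<open>HLP\<close> and the coordinates inside \<open>form\<close> are definite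
  descriptions, so nothing is known about them until existence and uniqueness of the
  Hall--Littlewood pair are established. The factorization has to deliver both; the characterization
  is then read off from the constructed pair. The pivots of the elimination are never computed. They
  are only shown to be nonzero, by evaluating them at the origin, where each of them becomes 1. This
  is how an identity between integers, RSK, decides a statement over rational functions. RSK itself
  comes from a local bijection between interlacing sequences, which commutes adding and removing a
  horizontal strip. The resulting identity serves twice. It gives the matrix at the origin; and
  since coefficients of products of complete functions are visibly symmetric and the Kostka matrix
  is invertible, it yields the symmetry of the Schur functions, whose definition by tableaux does
  not show it. The total order is replaced by a rank with values in the naturals, so that both
  directions of triangularity become inequalities between numbers.\<close>

lemma triangular_system:
  fixes rk :: "'b \<Rightarrow> nat" and T :: "'b \<Rightarrow> 'b \<Rightarrow> 'a::idom"
  assumes fin: "finite S"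
    and tri: "\<And>L M. L \<in> S \<Longrightarrow> M \<in> S \<Longrightarrow> T L M \<noteq> 0 \<Longrightarrow> L = M \<or> rk M < rk L"
    and diag: "\<And>L. L \<in> S \<Longrightarrow> T L L \<noteq> 0"
    and eq: "\<And>M. M \<in> S \<Longrightarrow> (\<Sum>L\<in>S. a L * T L M) = 0"
    and L: "L \<in> S"
  shows "a L = 0"
proof (rule ccontr)
  assume "a L \<noteq> 0"
  define Z where "Z = {L\<in>S. a L \<noteq> 0}"
  have Z: "finite Z" "Z \<noteq> {}"
    using fin L \<open>a L \<noteq> 0\<close> by (auto simp: Z_def)
  \<comment> \<open>A support element of largest rank: by \<open>tri\<close>, no other support
    element contributes to the equation for \<open>N\<close>, which therefore reads
    \<open>a N * T N N = 0\<close>.\<close>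
  obtain N where N: "N \<in> Z" "rk N = Max (rk ` Z)"
    using Max_in[of "rk ` Z"] Z by (metis (no_types, lifting) finite_imageI image_iff image_is_empty)
  have le: "rk M \<le> rk N" if "M \<in> Z" for M
    unfolding N(2) using that Z by simp
  have "N \<in> S" "a N \<noteq> 0"
    using N by (auto simp: Z_def)
  have "(\<Sum>L\<in>S. a L * T L N) = (\<Sum>L\<in>S. if L = N then a N * T N N else 0)"
  proof (rule sum.cong[OF refl])
    fix M assume "M \<in> S"
    show "a M * T M N = (if M = N then a N * T N N else 0)"
      using tri[OF \<open>M \<in> S\<close> \<open>N \<in> S\<close>] le[of M] \<open>M \<in> S\<close>
      by (cases "a M = 0") (auto simp: Z_def)
  qed
  also have "\<dots> = a N * T N N"
    using fin \<open>N \<in> S\<close> by simp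
  finally show False
    using eq[OF \<open>N \<in> S\<close>] diag[OF \<open>N \<in> S\<close>] \<open>a N \<noteq> 0\<close> by simp
qed

section \<open>Linear combinations of series, independence and change of basis\<close>

definition independent_on :: "'b set \<Rightarrow> ('b \<Rightarrow> 'a::comm_ring_1 series) \<Rightarrow> bool" where
  "independent_on S B \<longleftrightarrow> (\<forall>a. lincomb S a B = (\<lambda>_. 0) \<longrightarrow> (\<forall>L\<in>S. a L = 0))"

lemma lincomb_cong:
  "S = S' \<Longrightarrow> (\<And>M. M \<in> S' \<Longrightarrow> a M = b M) \<Longrightarrow> (\<And>M. M \<in> S' \<Longrightarrow> B M = C M)
    \<Longrightarrow> lincomb S a B = lincomb S' b C"
  by (simp add: lincomb_def)

lemma lincomb_diff:
  "lincomb S (\<lambda>M. a M - b M) B m = lincomb S a B m - lincomb S b B m"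
  by (simp add: lincomb_def algebra_simps sum_subtractf)

lemma lincomb_mono_neutral:
  assumes "finite S" "D \<subseteq> S"
  shows "lincomb D a B = lincomb S (\<lambda>M. if M \<in> D then a M else 0) B"
proof
  fix m
  have "(\<Sum>M\<in>S. (if M \<in> D then a M else 0) * B M m) = (\<Sum>M\<in>D. (if M \<in> D then a M else 0) * B M m)"
    by (rule sum.mono_neutral_right[OF assms]) auto
  then show "lincomb D a B m = lincomb S (\<lambda>M. if M \<in> D then a M else 0) B m"
    by (simp add: lincomb_def)
qed

text \<open>Change of basis acts on coefficient rows from the right: if the rows of \<open>T\<close>
  expand \<open>B\<close> in \<open>C\<close>, the row \<open>a\<close> turns into the row
  \<open>a T\<close>. Transition matrices below follow this convention.\<close>

lemma lincomb_lincomb: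
  assumes "\<And>M. M \<in> S \<Longrightarrow> B M = lincomb S' (T M) C"
  shows "lincomb S a B = lincomb S' (\<lambda>N. \<Sum>M\<in>S. a M * T M N) C"
proof
  fix m
  have "lincomb S a B m = (\<Sum>M\<in>S. \<Sum>N\<in>S'. a M * T M N * C N m)"
    using assms by (simp add: lincomb_def sum_distrib_left mult.assoc)
  also have "\<dots> = (\<Sum>N\<in>S'. \<Sum>M\<in>S. a M * T M N * C N m)"
    by (rule sum.swap)
  finally show "lincomb S a B m = lincomb S' (\<lambda>N. \<Sum>M\<in>S. a M * T M N) C m"
    by (simp add: lincomb_def sum_distrib_right)
qed

lemma independent_onD:
  assumes "independent_on S B" "lincomb S a B = lincomb S b B" "L \<in> S"
  shows "a L = b L"
proof -
  have "lincomb S (\<lambda>M. a M - b M) B = (\<lambda>_. 0)"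
    using assms(2) by (auto simp: lincomb_diff)
  then show ?thesis
    using assms(1,3) by (fastforce simp: independent_on_def)
qed

lemma independent_on_triangular:
  fixes B C :: "'b \<Rightarrow> 'a::idom series" and rk :: "'b \<Rightarrow> nat"
  assumes fin: "finite S"
    and C: "independent_on S C"
    and B: "\<And>L. L \<in> S \<Longrightarrow> B L = lincomb S (T L) C"
    and tri: "\<And>L M. L \<in> S \<Longrightarrow> M \<in> S \<Longrightarrow> T L M \<noteq> 0 \<Longrightarrow> L = M \<or> rk M < rk L"
    and diag: "\<And>L. L \<in> S \<Longrightarrow> T L L \<noteq> 0"
  shows "independent_on S B"
  unfolding independent_on_def
proof (intro allI impI ballI)
  fix a L assume a: "lincomb S a B = (\<lambda>_. 0)" and L: "L \<in> S"
  have "lincomb S (\<lambda>N. \<Sum>M\<in>S. a M * T M N) C = (\<lambda>_. 0)"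
    using lincomb_lincomb[of S B S T C a] B a by simp
  then have "(\<Sum>L\<in>S. a L * T L M) = 0" if "M \<in> S" for M
    using C that unfolding independent_on_def by blast
  then show "a L = 0"
    using triangular_system[of S T rk a L] fin tri diag L by blast
qed

text \<open>A subring as a set rather than a type, since \<open>Asub\<close> is a subset of the
  field \<open>ratfun\<close>. The instance \<open>UNIV\<close> serves where only coefficients in
  the field matter.\<close>

definition subring_set :: "'a::comm_ring_1 set \<Rightarrow> bool" where
  "subring_set A \<longleftrightarrow> 1 \<in> A \<and> (\<forall>x\<in>A. \<forall>y\<in>A. x - y \<in> A \<and> x * y \<in> A)"

lemma subring_set_UNIV: "subring_set UNIV"
  by (simp add: subring_set_def)

context
  fixes A :: "'a::comm_ring_1 set"
  assumes A: "subring_set A"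
begin

lemma subring_set_one: "1 \<in> A"
  and subring_set_diff: "x \<in> A \<Longrightarrow> y \<in> A \<Longrightarrow> x - y \<in> A"
  and subring_set_mult: "x \<in> A \<Longrightarrow> y \<in> A \<Longrightarrow> x * y \<in> A"
  using A by (auto simp: subring_set_def)

lemma subring_set_zero: "0 \<in> A"
  using subring_set_diff[OF subring_set_one subring_set_one] by simp

lemma subring_set_uminus: "x \<in> A \<Longrightarrow> - x \<in> A"
  using subring_set_diff[OF subring_set_zero] by simp

lemma subring_set_add: "x \<in> A \<Longrightarrow> y \<in> A \<Longrightarrow> x + y \<in> A"
  using subring_set_diff[OF _ subring_set_uminus] by simp

lemma subring_set_sum: "(\<And>i. i \<in> I \<Longrightarrow> f i \<in> A) \<Longrightarrow> sum f I \<in> A"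
  by (induction I rule: infinite_finite_induct) (auto simp: subring_set_zero subring_set_add)

lemma subring_set_power: "x \<in> A \<Longrightarrow> x ^ k \<in> A"
  by (induction k) (auto simp: subring_set_one subring_set_mult)

lemma subring_set_of_nat: "of_nat k \<in> A"
  by (induction k) (auto simp: subring_set_zero subring_set_one subring_set_add)

end

text \<open>Elimination from the top, by induction on the rank bound \<open>j\<close>. As
  \<open>rk\<close> is injective, raising the bound adds at most one element, whose diagonal
  coefficient is inverted in \<open>A\<close>. The last clause keeps track of the coefficient of
  that top element, on which the normalizations of \<open>P\<close> and \<open>Q\<close>
  depend.\<close>

lemma triangular_span_below:
  fixes rk :: "'b \<Rightarrow> nat" and B C :: "'b \<Rightarrow> 'a::field series"
  assumes fin: "finite S" and inj: "inj_on rk S" and A: "subring_set A"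
    and B: "\<And>L. L \<in> S \<Longrightarrow> B L = lincomb {M\<in>S. rk M \<le> rk L} (T L) C"
    and TA: "\<And>L M. L \<in> S \<Longrightarrow> T L M \<in> A"
    and diag: "\<And>L. L \<in> S \<Longrightarrow> T L L \<noteq> 0 \<and> inverse (T L L) \<in> A"
    and uA: "\<And>M. u M \<in> A"
  shows "\<exists>u'. (\<forall>M. u' M \<in> A)
           \<and> lincomb {M\<in>S. rk M < j} u C = lincomb {M\<in>S. rk M < j} u' B
           \<and> (\<forall>L\<in>S. Suc (rk L) = j \<longrightarrow> u' L * T L L = u L)"
  using uA
proof (induction j arbitrary: u)
  case 0
  then show ?case
    by (intro exI[of _ u]) (auto simp: lincomb_def)
next
  case (Suc j)
  show ?case
  proof (cases "\<exists>L\<in>S. rk L = j")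
    case False
    then have eq: "{M\<in>S. rk M < Suc j} = {M\<in>S. rk M < j}"
      using less_Suc_eq by auto
    obtain u' where "\<forall>M. u' M \<in> A" "lincomb {M\<in>S. rk M < j} u C = lincomb {M\<in>S. rk M < j} u' B"
      using Suc by blast
    then show ?thesis
      using False eq by auto
  next
    case True
    then obtain L where L: "L \<in> S" "rk L = j" by blast
    define D where "D = {M\<in>S. rk M < j}"
    have eq: "{M\<in>S. rk M < Suc j} = insert L D" "{M\<in>S. rk M \<le> rk L} = insert L D"
      using L inj by (auto simp: D_def less_Suc_eq le_less inj_on_def)
    have D: "finite D" "L \<notin> D"
      using fin L by (auto simp: D_def)
    \<comment> \<open>The value that matches the coefficient of \<open>C L\<close>: after
      subtracting \<open>c * B L\<close> only strictly lower \<open>C M\<close> remain, and the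
      induction hypothesis applies to them.\<close>
    define c where "c = u L * inverse (T L L)"
    have c: "c \<in> A" "c * T L L = u L"
      using diag[OF L(1)] Suc.prems by (auto simp: c_def intro: subring_set_mult[OF A])
    have "\<And>M. u M - c * T L M \<in> A"
      using c Suc.prems TA L by (blast intro: subring_set_diff[OF A] subring_set_mult[OF A])
    from Suc.IH[of "\<lambda>M. u M - c * T L M", OF this] obtain u'
      where u': "\<forall>M. u' M \<in> A" "lincomb D (\<lambda>M. u M - c * T L M) C = lincomb D u' B"
      unfolding D_def by blast
    have "lincomb (insert L D) u C = lincomb (insert L D) (u'(L := c)) B"
    proof
      fix m
      have "lincomb (insert L D) (u'(L := c)) B m = c * B L m + lincomb D u' B m"
        using D by (auto simp: lincomb_def intro!: sum.cong)
      also have "lincomb D u' B m = lincomb D u C m - c * lincomb D (T L) C m"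
        unfolding u'(2)[symmetric]
        by (simp add: lincomb_def algebra_simps sum_subtractf sum_distrib_left)
      also have "B L m = T L L * C L m + lincomb D (T L) C m"
        using D B[OF L(1)] by (simp add: eq lincomb_def)
      finally show "lincomb (insert L D) u C m = lincomb (insert L D) (u'(L := c)) B m"
        using D c(2) by (simp add: lincomb_def algebra_simps flip: c(2))
    qed
    moreover have "\<forall>K\<in>S. Suc (rk K) = Suc j \<longrightarrow> K = L"
      using L inj by (auto simp: inj_on_def)
    ultimately show ?thesis
      using u'(1) c unfolding eq
      by (intro exI[of _ "u'(L := c)"] conjI) (simp_all add: fun_upd_def, blast)
  qed
qed

lemma triangular_span:
  fixes rk :: "'b \<Rightarrow> nat" and B C :: "'b \<Rightarrow> 'a::field series"
  assumes "finite S" "inj_on rk S" "subring_set A"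
    and "\<And>L. L \<in> S \<Longrightarrow> B L = lincomb {M\<in>S. rk M \<le> rk L} (T L) C"
    and "\<And>L M. L \<in> S \<Longrightarrow> T L M \<in> A"
    and "\<And>L. L \<in> S \<Longrightarrow> T L L \<noteq> 0 \<and> inverse (T L L) \<in> A"
    and "\<And>M. u M \<in> A" and "L \<in> S"
  obtains u' where "\<And>M. u' M \<in> A"
    "lincomb {M\<in>S. rk M \<le> rk L} u C = lincomb {M\<in>S. rk M \<le> rk L} u' B"
    "u' L * T L L = u L"
  using triangular_span_below[of S rk A B T C u "Suc (rk L)"] assms
  unfolding less_Suc_eq_le by blast

text \<open>A local subring \<open>A\<close> of a field with its residue map \<open>e\<close>:
  elements with nonzero residue are units of \<open>A\<close>. The map is constrained on
  \<open>A\<close> only, because \<open>eval0\<close> is a definite description without meaning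
  elsewhere.\<close>

definition local_hom :: "'a::field set \<Rightarrow> ('a \<Rightarrow> 'c::field) \<Rightarrow> bool" where
  "local_hom A e \<longleftrightarrow> subring_set A \<and> e 1 = 1 \<and>
     (\<forall>x\<in>A. \<forall>y\<in>A. e (x - y) = e x - e y \<and> e (x * y) = e x * e y) \<and>
     (\<forall>x\<in>A. e x \<noteq> 0 \<longrightarrow> inverse x \<in> A)"

context
  fixes A :: "'a::field set" and e :: "'a \<Rightarrow> 'c::field"
  assumes A: "local_hom A e"
begin

lemma local_hom_subring: "subring_set A"
  and local_hom_one: "e 1 = 1"
  and local_hom_diff: "x \<in> A \<Longrightarrow> y \<in> A \<Longrightarrow> e (x - y) = e x - e y"
  and local_hom_mult: "x \<in> A \<Longrightarrow> y \<in> A \<Longrightarrow> e (x * y) = e x * e y"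
  and local_hom_inverse_closed: "x \<in> A \<Longrightarrow> e x \<noteq> 0 \<Longrightarrow> inverse x \<in> A"
  using A by (auto simp: local_hom_def)

lemma local_hom_zero: "e 0 = 0"
  using local_hom_diff[of 1 1] subring_set_one[OF local_hom_subring] by simp

lemma local_hom_uminus: "x \<in> A \<Longrightarrow> e (- x) = - e x"
  using local_hom_diff[of 0 x] subring_set_zero[OF local_hom_subring] local_hom_zero by simp

lemma local_hom_add: "x \<in> A \<Longrightarrow> y \<in> A \<Longrightarrow> e (x + y) = e x + e y"
  using local_hom_diff[of x "- y"] subring_set_uminus[OF local_hom_subring, of y] local_hom_uminus
  by simp

lemma local_hom_sum: "(\<And>i. i \<in> I \<Longrightarrow> f i \<in> A) \<Longrightarrow> e (sum f I) = (\<Sum>i\<in>I. e (f i))"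
  by (induction I rule: infinite_finite_induct)
    (auto simp: local_hom_zero local_hom_add subring_set_sum[OF local_hom_subring])

lemma local_hom_power: "x \<in> A \<Longrightarrow> e (x ^ k) = e x ^ k"
  by (induction k) (auto simp: local_hom_one local_hom_mult subring_set_power[OF local_hom_subring])

lemma local_hom_inverse:
  assumes "x \<in> A" "e x \<noteq> 0"
  shows "e (inverse x) = inverse (e x)"
proof -
  have "x \<noteq> 0"
    using assms local_hom_zero by auto
  then have "e x * e (inverse x) = 1"
    using local_hom_mult[OF assms(1) local_hom_inverse_closed[OF assms]] local_hom_one by simp
  then show ?thesis
    by (metis inverse_unique)
qed

text \<open>Gaussian elimination from the top element downwards: every pivot reduces to \<open>1\<close>, so it is
  a unit of the local ring.\<close>

lemma triangular_factorization:
  fixes rk :: "'b \<Rightarrow> nat" and G :: "'b \<Rightarrow> 'b \<Rightarrow> 'a" and K :: "'b \<Rightarrow> 'b \<Rightarrow> 'c"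
  assumes "finite S" and "inj_on rk S"
    and "\<And>L M. L \<in> S \<Longrightarrow> M \<in> S \<Longrightarrow> G L M \<in> A"
    and "\<And>L M. L \<in> S \<Longrightarrow> M \<in> S \<Longrightarrow> e (G L M) = (\<Sum>N\<in>S. K N L * K N M)"
    and "\<And>L M. L \<in> S \<Longrightarrow> M \<in> S \<Longrightarrow> K L M \<noteq> 0 \<Longrightarrow> rk M \<le> rk L"
    and "\<And>L. L \<in> S \<Longrightarrow> K L L = 1"
  shows "\<exists>X Y D. (\<forall>L\<in>S. \<forall>M\<in>S. X L M \<in> A \<and> Y L M \<in> A \<and> e (X L M) = K L M \<and> e (Y L M) = K L M
            \<and> (X L M \<noteq> 0 \<longrightarrow> rk M \<le> rk L) \<and> (Y L M \<noteq> 0 \<longrightarrow> rk M \<le> rk L)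
            \<and> G L M = (\<Sum>N\<in>S. Y N L * D N * X N M))
          \<and> (\<forall>L\<in>S. X L L = 1 \<and> Y L L = 1 \<and> D L \<noteq> 0)"
  using assms
\<comment> \<open>This induction adds elements in order of rank, so the new \<open>x\<close> has the
  largest rank and supplies the first pivot.\<close>
proof (induction S arbitrary: G rule: finite_ranking_induct[where f = rk])
  case empty
  then show ?case by auto
next
  case (insert x S)
  show ?case
  proof (cases "x \<in> S")
    case True
    then have "insert x S = S" by blast
    then show ?thesis
      using insert.IH[of G] insert.prems by auto
  next
    case x: False
    note GA = insert.prems(2) and Ge = insert.prems(3) and Ktri = insert.prems(4)
      and Kdiag = insert.prems(5)
    have lt: "rk y < rk x" if "y \<in> S" for y
      using insert.hyps(2)[OF that] insert.prems(1) x that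
      by (metis inj_onD insertI1 insertI2 le_neq_implies_less)
    have Kx: "K y x = 0" if "y \<in> S" for y
      using Ktri[of y x] lt[OF that] that by auto
    \<comment> \<open>Only \<open>N = x\<close> survives in the sum of the hypothesis, since
      \<open>K N x = 0\<close> for the lower \<open>N\<close>. Row and column \<open>x\<close> of
      \<open>G\<close> thus both reduce to row \<open>x\<close> of \<open>K\<close>, and the pivot
      reduces to \<open>K x x = 1\<close>.\<close>
    have eGx: "e (G x M) = K x M" "e (G M x) = K x M" if "M \<in> insert x S" for M
      using Ge[of x M] Ge[of M x] that x insert.hyps(1) Kdiag[of x] Kx by simp_all
    have eD: "e (G x x) = 1"
      using eGx(1)[of x] Kdiag by simp
    have GxA: "G x x \<in> A" "G x x \<noteq> 0"
      using GA eD local_hom_zero by auto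
    have iA: "inverse (G x x) \<in> A" "e (inverse (G x x)) = 1"
      using local_hom_inverse_closed[OF GxA(1)] local_hom_inverse[OF GxA(1)] eD by auto
    define x1 where "x1 M = inverse (G x x) * G x M" for M
    define y1 where "y1 M = inverse (G x x) * G M x" for M
    \<comment> \<open>The Schur complement of the pivot. Its residue is the sum for \<open>K\<close>
      with the term \<open>N = x\<close> removed, which is the hypothesis for the smaller
      set.\<close>
    define G' where "G' L M = G L M - y1 L * G x M" for L M
    have 1: "x1 M \<in> A" "y1 M \<in> A" "e (x1 M) = K x M" "e (y1 M) = K x M" if "M \<in> insert x S" for M
      using that iA GA eGx[OF that]
      by (auto simp: x1_def y1_def local_hom_mult intro!: subring_set_mult[OF local_hom_subring])
    have G'A: "G' L M \<in> A" if "L \<in> S" "M \<in> S" for L M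
      using that GA 1 by (auto simp: G'_def intro!: subring_set_diff[OF local_hom_subring]
          subring_set_mult[OF local_hom_subring])
    have G'e: "e (G' L M) = (\<Sum>N\<in>S. K N L * K N M)" if "L \<in> S" "M \<in> S" for L M
    proof -
      have "e (G' L M) = e (G L M) - K x L * K x M"
        using that 1 GA eGx by (simp add: G'_def local_hom_diff local_hom_mult
            subring_set_mult[OF local_hom_subring])
      then show ?thesis
        using Ge[of L M] that x insert.hyps(1) by simp
    qed
    have KtriS: "rk M \<le> rk L" if "L \<in> S" "M \<in> S" "K L M \<noteq> 0" for L M
      using Ktri[of L M] that by simp
    have KdiagS: "K L L = 1" if "L \<in> S" for L
      using Kdiag[of L] that by simp
    have "inj_on rk S"
      using insert.prems(1) by (simp add: inj_on_insert)
    then have "\<exists>X Y D. (\<forall>L\<in>S. \<forall>M\<in>S. X L M \<in> A \<and> Y L M \<in> A \<and> e (X L M) = K L M \<and> e (Y L M) = K L M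
            \<and> (X L M \<noteq> 0 \<longrightarrow> rk M \<le> rk L) \<and> (Y L M \<noteq> 0 \<longrightarrow> rk M \<le> rk L)
            \<and> G' L M = (\<Sum>N\<in>S. Y N L * D N * X N M))
          \<and> (\<forall>L\<in>S. X L L = 1 \<and> Y L L = 1 \<and> D L \<noteq> 0)"
      by (rule insert.IH[of G']) (fact G'A G'e KtriS KdiagS)+
    then obtain X Y D where
      XY0: "\<forall>L\<in>S. \<forall>M\<in>S. X L M \<in> A \<and> Y L M \<in> A \<and> e (X L M) = K L M \<and> e (Y L M) = K L M
            \<and> (X L M \<noteq> 0 \<longrightarrow> rk M \<le> rk L) \<and> (Y L M \<noteq> 0 \<longrightarrow> rk M \<le> rk L)
            \<and> G' L M = (\<Sum>N\<in>S. Y N L * D N * X N M)"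
      and XYdiag0: "\<forall>L\<in>S. X L L = 1 \<and> Y L L = 1 \<and> D L \<noteq> 0"
      by (elim exE conjE) (rule that)
    note XY = XY0[rule_format] and XYdiag = XYdiag0[rule_format]
    define X' where "X' L M = (if L = x then x1 M else if M = x then 0 else X L M)" for L M
    define Y' where "Y' L M = (if L = x then y1 M else if M = x then 0 else Y L M)" for L M
    define D' where "D' = D(x := G x x)"
    have sum: "(\<Sum>N\<in>insert x S. Y' N L * D' N * X' N M)
        = y1 L * G x M + (if L = x \<or> M = x then 0 else \<Sum>N\<in>S. Y N L * D N * X N M)" for L M
    proof -
      have "(\<Sum>N\<in>S. Y' N L * D' N * X' N M)
          = (\<Sum>N\<in>S. if L = x \<or> M = x then 0 else Y N L * D N * X N M)"
        using x by (intro sum.cong) (auto simp: X'_def Y'_def D'_def)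
      moreover have "Y' x L * D' x * X' x M = y1 L * G x M"
        using GxA by (simp add: X'_def Y'_def D'_def x1_def)
      ultimately show ?thesis
        using x insert.hyps(1) by simp
    qed
    have G: "G L M = (\<Sum>N\<in>insert x S. Y' N L * D' N * X' N M)"
      if "L \<in> insert x S" "M \<in> insert x S" for L M
    proof (cases "L = x \<or> M = x")
      case True
      then show ?thesis
        unfolding sum using GxA(2) by (auto simp: y1_def)
    next
      case False
      then show ?thesis
        unfolding sum using XY[of L M] that by (auto simp: G'_def algebra_simps)
    qed
    have diag1: "x1 x = 1" "y1 x = 1"
      using GxA by (simp_all add: x1_def y1_def)
    show ?thesis
    proof (rule exI[of _ X'], rule exI[of _ Y'], rule exI[of _ D'], intro conjI ballI)
      fix L M assume LM: "L \<in> insert x S" "M \<in> insert x S"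
      show "G L M = (\<Sum>N\<in>insert x S. Y' N L * D' N * X' N M)"
        by (rule G[OF LM])
      show "X' L M \<in> A" "Y' L M \<in> A"
        using LM 1 XY subring_set_zero[OF local_hom_subring] by (auto simp: X'_def Y'_def)
      show "e (X' L M) = K L M" "e (Y' L M) = K L M"
        using LM 1 XY Kx local_hom_zero by (auto simp: X'_def Y'_def)
      show "X' L M \<noteq> 0 \<longrightarrow> rk M \<le> rk L" "Y' L M \<noteq> 0 \<longrightarrow> rk M \<le> rk L"
        using LM XY insert.hyps(2) by (auto simp: X'_def Y'_def)
    next
      fix L assume L: "L \<in> insert x S"
      show "X' L L = 1" "Y' L L = 1" "D' L \<noteq> 0"
        using L x XYdiag diag1 GxA by (auto simp: X'_def Y'_def D'_def)
    qed
  qed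
qed

end

subsection \<open>Evaluation at the origin\<close>

text \<open>The exponent 0 splits as a sum of exponents in one way only, so the constant coefficient
  is multiplicative.\<close>

lemma lookup_mult_zero:
  fixes f g :: tpoly
  shows "Poly_Mapping.lookup (f * g) 0 = Poly_Mapping.lookup f 0 * Poly_Mapping.lookup g 0"
proof -
  have z: "0 = l + q \<longleftrightarrow> l = 0 \<and> q = 0" for l q :: "nat \<Rightarrow>\<^sub>0 nat"
    by (auto simp: poly_mapping_eq_iff lookup_add fun_eq_iff)
  have "(\<Sum>q. Poly_Mapping.lookup g q when 0 = l + q) = (Poly_Mapping.lookup g 0 when l = 0)" for l
  proof (cases "l = 0")
    case True
    have "(\<Sum>q. Poly_Mapping.lookup g q when q = 0) = Poly_Mapping.lookup g 0"
      by (rule Sum_any_when_equal)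
    then show ?thesis
      using True by (simp add: z)
  qed (simp add: z)
  then have "Poly_Mapping.lookup (f * g) 0
      = (\<Sum>l. Poly_Mapping.lookup f l * (Poly_Mapping.lookup g 0 when l = 0))"
    by (simp add: lookup_mult)
  also have "\<dots> = (\<Sum>l. Poly_Mapping.lookup f l * Poly_Mapping.lookup g 0 when l = 0)"
    by (simp add: mult_when)
  also have "\<dots> = Poly_Mapping.lookup f 0 * Poly_Mapping.lookup g 0"
    by (rule Sum_any_when_equal)
  finally show ?thesis .
qed

text \<open>Independence of the chosen fraction: cross-multiply two representations and compare
  constant coefficients.\<close>

lemma eval0_Fract:
  assumes "Poly_Mapping.lookup g 0 \<noteq> 0"
  shows "eval0 (Fraction_Field.Fract f g) = Poly_Mapping.lookup f 0 / Poly_Mapping.lookup g 0"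
  unfolding eval0_def
proof (rule the_equality)
  show "\<exists>f' g'. Fraction_Field.Fract f g = Fraction_Field.Fract f' g' \<and> Poly_Mapping.lookup g' 0 \<noteq> 0
    \<and> Poly_Mapping.lookup f 0 / Poly_Mapping.lookup g 0 = Poly_Mapping.lookup f' 0 / Poly_Mapping.lookup g' 0"
    using assms by blast
next
  fix v
  assume "\<exists>f' g'. Fraction_Field.Fract f g = Fraction_Field.Fract f' g' \<and> Poly_Mapping.lookup g' 0 \<noteq> 0
    \<and> v = Poly_Mapping.lookup f' 0 / Poly_Mapping.lookup g' 0"
  then obtain f' g' where *: "Fraction_Field.Fract f g = Fraction_Field.Fract f' g'"
    "Poly_Mapping.lookup g' 0 \<noteq> 0" "v = Poly_Mapping.lookup f' 0 / Poly_Mapping.lookup g' 0"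
    by blast
  have "g \<noteq> 0" "g' \<noteq> 0"
    using assms *(2) by auto
  then have "f * g' = f' * g"
    using *(1) by (simp add: eq_fract)
  then have "Poly_Mapping.lookup (f * g') 0 = Poly_Mapping.lookup (f' * g) 0"
    by simp
  then show "v = Poly_Mapping.lookup f 0 / Poly_Mapping.lookup g 0"
    unfolding *(3) using assms *(2) by (simp add: lookup_mult_zero frac_eq_eq)
qed

lemma AsubE:
  assumes "x \<in> Asub"
  obtains f g where "x = Fraction_Field.Fract f g" "Poly_Mapping.lookup g 0 \<noteq> 0" "g \<noteq> 0"
proof -
  from assms obtain f g where fg: "x = Fraction_Field.Fract f g" "Poly_Mapping.lookup g 0 \<noteq> 0"
    unfolding Asub_def by blast
  then have "g \<noteq> 0" by auto
  with fg show thesis by (rule that)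
qed

lemma Fract_in_Asub: "Poly_Mapping.lookup g 0 \<noteq> 0 \<Longrightarrow> Fraction_Field.Fract f g \<in> Asub"
  by (auto simp: Asub_def)

lemma local_hom_eval0: "local_hom Asub eval0"
  unfolding local_hom_def subring_set_def
proof (intro conjI ballI impI)
  have "(1::ratfun) = Fraction_Field.Fract 1 1"
    by (rule One_fract_def)
  then show "(1::ratfun) \<in> Asub" "eval0 1 = 1"
    using Fract_in_Asub[of 1 1] eval0_Fract[of 1 1] by simp_all
next
  fix x y assume "x \<in> Asub" "y \<in> Asub"
  then obtain f g f' g' where
    x: "x = Fraction_Field.Fract f g" "Poly_Mapping.lookup g 0 \<noteq> 0" "g \<noteq> 0" and
    y: "y = Fraction_Field.Fract f' g'" "Poly_Mapping.lookup g' 0 \<noteq> 0" "g' \<noteq> 0"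
    by (elim AsubE)
  have 1: "x - y = Fraction_Field.Fract (f * g' - f' * g) (g * g')"
    using x y by simp
  have 2: "x * y = Fraction_Field.Fract (f * f') (g * g')"
    using x y by simp
  have 3: "Poly_Mapping.lookup (g * g') 0 \<noteq> 0"
    using x y by (simp add: lookup_mult_zero)
  show "x - y \<in> Asub" "x * y \<in> Asub"
    unfolding 1 2 using 3 by (rule Fract_in_Asub)+
  show "eval0 (x - y) = eval0 x - eval0 y"
    unfolding 1 eval0_Fract[OF 3] unfolding x(1) y(1) eval0_Fract[OF x(2)] eval0_Fract[OF y(2)]
    using x y by (simp add: lookup_mult_zero lookup_minus field_simps)
  show "eval0 (x * y) = eval0 x * eval0 y"
    unfolding 2 eval0_Fract[OF 3] unfolding x(1) y(1) eval0_Fract[OF x(2)] eval0_Fract[OF y(2)]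
    by (simp add: lookup_mult_zero)
next
  fix x assume x: "x \<in> Asub" "eval0 x \<noteq> 0"
  then obtain f g where fg: "x = Fraction_Field.Fract f g" "Poly_Mapping.lookup g 0 \<noteq> 0"
    by (elim AsubE)
  then have "Poly_Mapping.lookup f 0 \<noteq> 0"
    using x(2) by (auto simp: eval0_Fract)
  then show "inverse x \<in> Asub"
    using fg(1) Fract_in_Asub[of f g] by simp
qed

lemma tvar_in_Asub: "tvar k \<in> Asub" and eval0_tvar: "eval0 (tvar k) = 0"
proof -
  have "Poly_Mapping.single k (1::nat) \<noteq> 0"
    by (auto simp: poly_mapping_eq_iff fun_eq_iff lookup_single when_def)
  then have "Poly_Mapping.lookup (Poly_Mapping.single (Poly_Mapping.single k (1::nat)) (1::rat)) 0 = 0"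
    by (simp add: lookup_single_not_eq)
  then show "tvar k \<in> Asub" "eval0 (tvar k) = 0"
    using Fract_in_Asub[of 1] eval0_Fract[of 1] by (simp_all add: tvar_def)
qed

subsection \<open>Horizontal strips and the Robinson--Schensted--Knuth identity\<close>

text \<open>Partitions are handled as weakly decreasing functions of finite support, so that parts
  beyond the length are 0 and interlacing needs no case distinction. The function
  \<open>part\<close> translates from lists.\<close>

definition fin_supp :: "(nat \<Rightarrow> nat) \<Rightarrow> bool" where
  "fin_supp f \<longleftrightarrow> (\<exists>B. \<forall>i\<ge>B. f i = 0)"

definition psize :: "(nat \<Rightarrow> nat) \<Rightarrow> nat" where
  "psize f = sum f {i. f i \<noteq> 0}"

text \<open>Interlacing form of the condition that the skew diagram \<open>\<rho>/\<mu>\<close> has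
  at most one cell in each column. It already forces both functions to be weakly decreasing.\<close>

definition hstrip :: "(nat \<Rightarrow> nat) \<Rightarrow> (nat \<Rightarrow> nat) \<Rightarrow> bool" where
  "hstrip \<mu> \<rho> \<longleftrightarrow> (\<forall>i. \<mu> i \<le> \<rho> i \<and> \<rho> (Suc i) \<le> \<mu> i)"

definition strips_below :: "nat \<Rightarrow> (nat \<Rightarrow> nat) \<Rightarrow> (nat \<Rightarrow> nat) set" where
  "strips_below a \<rho> = {\<mu>. hstrip \<mu> \<rho> \<and> psize \<rho> = psize \<mu> + a}"

definition strips_above :: "nat \<Rightarrow> (nat \<Rightarrow> nat) \<Rightarrow> (nat \<Rightarrow> nat) set" where
  "strips_above a \<mu> = {\<rho>. hstrip \<mu> \<rho> \<and> psize \<rho> = psize \<mu> + a}"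

definition partitions_of :: "nat \<Rightarrow> (nat \<Rightarrow> nat) set" where
  "partitions_of n = {\<rho>. antimono \<rho> \<and> fin_supp \<rho> \<and> psize \<rho> = n}"

lemma fin_supp_finite: "fin_supp f \<longleftrightarrow> finite {i. f i \<noteq> 0}"
  unfolding fin_supp_def finite_nat_set_iff_bounded mem_Collect_eq Ball_def
  by (metis leD leI)

lemma psize_eq: "(\<And>i. i \<ge> B \<Longrightarrow> f i = 0) \<Longrightarrow> psize f = sum f {..<B}"
  unfolding psize_def by (rule sum.mono_neutral_left) (auto simp: lessThan_def, metis leI less_numeral_extra(3))

lemma fin_supp_le: "fin_supp g \<Longrightarrow> (\<And>i. f i \<le> g i) \<Longrightarrow> fin_supp f"
  unfolding fin_supp_def by (metis le_zero_eq)

lemma psize_mono: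
  assumes "fin_supp g" "\<And>i. f i \<le> g i"
  shows "psize f \<le> psize g"
proof -
  obtain B where "\<And>i. i \<ge> B \<Longrightarrow> g i = 0" using assms(1) by (auto simp: fin_supp_def)
  moreover from this have "\<And>i. i \<ge> B \<Longrightarrow> f i = 0" by (metis assms(2) le_zero_eq)
  ultimately show ?thesis
    using assms(2) by (simp add: psize_eq[of B] sum_mono)
qed

lemma psize_eqD:
  assumes "fin_supp g" "\<And>i. f i \<le> g i" "psize f = psize g"
  shows "f = g"
proof (rule ccontr)
  assume "f \<noteq> g"
  then obtain j where j: "f j < g j"
    using assms(2) by (metis ext le_neq_implies_less)
  obtain B where B: "\<And>i. i \<ge> B \<Longrightarrow> g i = 0" using assms(1) by (auto simp: fin_supp_def)
  moreover from this have "\<And>i. i \<ge> B \<Longrightarrow> f i = 0" by (metis assms(2) le_zero_eq)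
  moreover have "sum f {..<B} < sum g {..<B}"
  proof (rule sum_strict_mono_ex1)
    have "j < B"
      using j B[of j] by (cases "B \<le> j") auto
    then show "\<exists>a\<in>{..<B}. f a < g a"
      using j by blast
  qed (use assms(2) in auto)
  ultimately show False
    using assms(3) by (simp add: psize_eq[of B])
qed

lemma psize_zero_iff: "fin_supp f \<Longrightarrow> psize f = 0 \<longleftrightarrow> f = (\<lambda>_. 0)"
  unfolding psize_def fin_supp_finite by (auto simp: fun_eq_iff)

lemma fin_supp_zero: "fin_supp (\<lambda>_. 0)"
  by (auto simp: fin_supp_def)

lemma psize_zero: "psize (\<lambda>_. 0) = 0"
  by (simp add: psize_def)

lemma hstrip_le: "hstrip \<mu> \<rho> \<Longrightarrow> \<mu> i \<le> \<rho> i"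
  and hstrip_ge: "hstrip \<mu> \<rho> \<Longrightarrow> \<rho> (Suc i) \<le> \<mu> i"
  by (auto simp: hstrip_def)

lemma hstrip_antimono:
  assumes "hstrip \<mu> \<rho>"
  shows "antimono \<mu>" "antimono \<rho>"
proof -
  have 1: "\<mu> (Suc i) \<le> \<rho> (Suc i)" "\<rho> (Suc i) \<le> \<mu> i" "\<mu> i \<le> \<rho> i" for i
    using assms by (auto simp: hstrip_def)
  show "antimono \<mu>"
    unfolding antimono_iff_le_Suc using 1 order_trans by blast
  show "antimono \<rho>"
    unfolding antimono_iff_le_Suc using 1 order_trans by blast
qed

lemma hstrip_fin_supp: "hstrip \<mu> \<rho> \<Longrightarrow> fin_supp \<mu> \<longleftrightarrow> fin_supp \<rho>"
proof
  assume h: "hstrip \<mu> \<rho>" and "fin_supp \<mu>"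
  then obtain B where B: "\<And>i. i \<ge> B \<Longrightarrow> \<mu> i = 0" by (auto simp: fin_supp_def)
  have "\<rho> i = 0" if "i \<ge> Suc B" for i
    using hstrip_ge[OF h, of "i - 1"] B[of "i - 1"] that by (cases i) auto
  then show "fin_supp \<rho>" by (auto simp: fin_supp_def)
next
  assume "hstrip \<mu> \<rho>" and "fin_supp \<rho>"
  then show "fin_supp \<mu>"
    using fin_supp_le hstrip_le by blast
qed

lemma partitions_of_bound:
  assumes "\<rho> \<in> partitions_of n"
  shows "\<rho> i \<le> n" "i \<ge> n \<Longrightarrow> \<rho> i = 0"
proof -
  have am: "antimono \<rho>" and n: "psize \<rho> = n" and "fin_supp \<rho>"
    using assms by (auto simp: partitions_of_def)
  then obtain B where B: "\<And>i. i \<ge> B \<Longrightarrow> \<rho> i = 0" by (auto simp: fin_supp_def)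
  define C where "C = Suc (max B i)"
  have C: "sum \<rho> {..<C} = n"
    using psize_eq[of C \<rho>] B n by (simp add: C_def)
  show "\<rho> i \<le> n"
    using member_le_sum[of i "{..<C}" \<rho>] C by (simp add: C_def)
  show "\<rho> i = 0" if "i \<ge> n"
  proof (rule ccontr)
    assume "\<rho> i \<noteq> 0"
    then have "1 \<le> \<rho> j" if "j \<le> i" for j
      using antimonoD[OF am that] by simp
    then have "(\<Sum>j<Suc i. 1) \<le> (\<Sum>j<Suc i. \<rho> j)"
      by (intro sum_mono) auto
    also have "\<dots> \<le> (\<Sum>j<C. \<rho> j)"
      by (intro sum_mono2) (auto simp: C_def)
    finally show False
      using C that by simp
  qed
qed

lemma finite_bounded_funs: "finite {f :: nat \<Rightarrow> nat. (\<forall>i. f i \<le> (n::nat)) \<and> (\<forall>i\<ge>B. f i = 0)}"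
proof -
  have "finite {f. \<forall>i. (i \<in> {..<B} \<longrightarrow> f i \<in> {..n}) \<and> (i \<notin> {..<B} \<longrightarrow> f i = 0)}"
    by (rule finite_set_of_finite_funs) simp_all
  then show ?thesis
    by (rule finite_subset[rotated]) auto
qed

lemma finite_partitions_of: "finite (partitions_of n)"
  by (rule finite_subset[OF _ finite_bounded_funs[of n n]]) (auto simp: partitions_of_bound)

lemma strips_below_partition:
  assumes "fin_supp \<rho>" "\<mu> \<in> strips_below a \<rho>"
  shows "\<mu> \<in> partitions_of (psize \<rho> - a)"
  using assms hstrip_antimono(1)[of \<mu> \<rho>] hstrip_fin_supp[of \<mu> \<rho>]
  by (simp add: partitions_of_def strips_below_def)

lemma strips_above_partition:
  assumes "fin_supp \<mu>" "\<rho> \<in> strips_above a \<mu>"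
  shows "\<rho> \<in> partitions_of (psize \<mu> + a)"
  using assms hstrip_antimono(2)[of \<mu> \<rho>] hstrip_fin_supp[of \<mu> \<rho>]
  by (simp add: partitions_of_def strips_above_def)

lemma finite_strips_below: "fin_supp \<rho> \<Longrightarrow> finite (strips_below a \<rho>)"
  by (rule finite_subset[OF subsetI finite_partitions_of]) (rule strips_below_partition)

lemma finite_strips_above: "fin_supp \<mu> \<Longrightarrow> finite (strips_above a \<mu>)"
  by (rule finite_subset[OF subsetI finite_partitions_of]) (rule strips_above_partition)

text \<open>Sum the local relation over \<open>i\<close>. Maximum and minimum of two numbers add up
  to their sum, so everything pairs off except the entries of index 0 that the shift in
  \<open>Suc i\<close> leaves out.\<close>

lemma psize_exchange:
  assumes fs: "fin_supp \<mu>" "fin_supp \<nu>" "fin_supp \<kappa>" "fin_supp \<rho>"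
    and eq: "\<And>i. \<kappa> i + \<rho> (Suc i) = max (\<mu> (Suc i)) (\<nu> (Suc i)) + min (\<mu> i) (\<nu> i)"
  shows "psize \<kappa> + psize \<rho> + max (\<mu> 0) (\<nu> 0) = psize \<mu> + psize \<nu> + \<rho> 0"
proof -
  obtain B1 where B1: "\<And>i. i \<ge> B1 \<Longrightarrow> \<mu> i = 0" using fs(1) by (auto simp: fin_supp_def)
  obtain B2 where B2: "\<And>i. i \<ge> B2 \<Longrightarrow> \<nu> i = 0" using fs(2) by (auto simp: fin_supp_def)
  obtain B3 where B3: "\<And>i. i \<ge> B3 \<Longrightarrow> \<kappa> i = 0" using fs(3) by (auto simp: fin_supp_def)
  obtain B4 where B4: "\<And>i. i \<ge> B4 \<Longrightarrow> \<rho> i = 0" using fs(4) by (auto simp: fin_supp_def)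
  note B = B1 B2 B3 B4
  define C where "C = max (max B1 B2) (max B3 B4)"
  have C: "\<mu> i = 0" "\<nu> i = 0" "\<kappa> i = 0" "\<rho> i = 0" if "i \<ge> C" for i
    using B[of i] that by (simp_all add: C_def)
  have size: "psize f = sum f {..<Suc C}" "psize f = sum f {..<C}" if "\<And>i. i \<ge> C \<Longrightarrow> f i = 0" for f
    using psize_eq[of C f] psize_eq[of "Suc C" f] that by simp_all
  have "psize \<kappa> + psize \<rho> + max (\<mu> 0) (\<nu> 0)
      = (\<Sum>i<C. \<kappa> i + \<rho> (Suc i)) + \<rho> 0 + max (\<mu> 0) (\<nu> 0)"
    using size(2)[of \<kappa>] size(1)[of \<rho>] C
    by (simp only: sum.lessThan_Suc_shift sum.distrib ac_simps)
  also have "\<dots> = (\<Sum>i<Suc C. max (\<mu> i) (\<nu> i)) + (\<Sum>i<C. min (\<mu> i) (\<nu> i)) + \<rho> 0"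
    by (simp only: eq sum.lessThan_Suc_shift sum.distrib ac_simps)
  also have "(\<Sum>i<Suc C. max (\<mu> i) (\<nu> i)) = (\<Sum>i<C. max (\<mu> i) (\<nu> i))"
    using C by simp
  also have "(\<Sum>i<C. max (\<mu> i) (\<nu> i)) + (\<Sum>i<C. min (\<mu> i) (\<nu> i)) = (\<Sum>i<C. \<mu> i + \<nu> i)"
    unfolding sum.distrib[symmetric] by (intro sum.cong) auto
  finally show ?thesis
    using size(2)[of \<mu>] size(2)[of \<nu>] C by (simp add: sum.distrib)
qed

text \<open>For fixed \<open>\<mu>\<close> and \<open>\<nu>\<close> a partition \<open>\<rho>\<close> above both is given by \<open>\<rho> 0 \<ge> max (\<mu> 0) (\<nu> 0)\<close> and,
  for each \<open>i\<close>, a value \<open>\<rho> (i+1)\<close> in the interval from \<open>max (\<mu> (i+1)) (\<nu> (i+1))\<close> to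
  \<open>min (\<mu> i) (\<nu> i)\<close>; a partition \<open>\<kappa>\<close> below both is given by values \<open>\<kappa> i\<close> in the same intervals.
  Reflecting each interval matches them, the excess of \<open>\<rho> 0\<close> being the loss \<open>c\<close>.\<close>

lemma strips_commute:
  fixes f :: "(nat \<Rightarrow> nat) \<Rightarrow> nat"
  assumes fs: "fin_supp \<mu>"
  shows "(\<Sum>\<rho>\<in>strips_above a \<mu>. \<Sum>\<nu>\<in>strips_below b \<rho>. f \<nu>)
    = (\<Sum>c\<le>min a b. \<Sum>\<kappa>\<in>strips_below (b - c) \<mu>. \<Sum>\<nu>\<in>strips_above (a - c) \<kappa>. f \<nu>)"
proof -
  define F where "F = (\<lambda>(\<rho>, \<nu>). (\<rho> 0 - max (\<mu> 0) (\<nu> 0),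
     (\<lambda>i. max (\<mu> (Suc i)) (\<nu> (Suc i)) + min (\<mu> i) (\<nu> i) - \<rho> (Suc i)), \<nu> :: nat \<Rightarrow> nat))"
  define G where "G = (\<lambda>(c, \<kappa>, \<nu>). ((\<lambda>i. case i of 0 \<Rightarrow> max (\<mu> 0) (\<nu> 0) + c
     | Suc i \<Rightarrow> max (\<mu> (Suc i)) (\<nu> (Suc i)) + min (\<mu> i) (\<nu> i) - \<kappa> i), \<nu> :: nat \<Rightarrow> nat))"
  have F: "F (\<rho>, \<nu>) \<in> (SIGMA c:{..min a b}. SIGMA \<kappa>:strips_below (b - c) \<mu>. strips_above (a - c) \<kappa>)
      \<and> G (F (\<rho>, \<nu>)) = (\<rho>, \<nu>)"
    if \<rho>: "\<rho> \<in> strips_above a \<mu>" and \<nu>: "\<nu> \<in> strips_below b \<rho>" for \<rho> \<nu>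
  proof -
    have h: "hstrip \<mu> \<rho>" "hstrip \<nu> \<rho>" "psize \<rho> = psize \<mu> + a" "psize \<rho> = psize \<nu> + b"
      using \<rho> \<nu> by (auto simp: strips_above_def strips_below_def)
    define \<kappa> where "\<kappa> = (\<lambda>i. max (\<mu> (Suc i)) (\<nu> (Suc i)) + min (\<mu> i) (\<nu> i) - \<rho> (Suc i))"
    define c where "c = \<rho> 0 - max (\<mu> 0) (\<nu> 0)"
    have le: "max (\<mu> i) (\<nu> i) \<le> \<rho> i" "\<rho> (Suc i) \<le> min (\<mu> i) (\<nu> i)" for i
      using h by (auto simp: hstrip_def)
    have eq: "\<kappa> i + \<rho> (Suc i) = max (\<mu> (Suc i)) (\<nu> (Suc i)) + min (\<mu> i) (\<nu> i)" for i
      unfolding \<kappa>_def using le(2)[of i] by linarith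
    have \<kappa>: "max (\<mu> (Suc i)) (\<nu> (Suc i)) \<le> \<kappa> i" "\<kappa> i \<le> min (\<mu> i) (\<nu> i)" for i
      using le(1)[of "Suc i"] le(2)[of i] eq[of i] by linarith+
    have hk: "hstrip \<kappa> \<mu>" "hstrip \<kappa> \<nu>"
      using \<kappa> by (auto simp: hstrip_def)
    have fsl: "fin_supp \<rho>" "fin_supp \<nu>" "fin_supp \<kappa>"
      using h hk fs hstrip_fin_supp by blast+
    have c: "\<rho> 0 = max (\<mu> 0) (\<nu> 0) + c"
      using le(1)[of 0] by (simp add: c_def)
    have size: "psize \<kappa> + psize \<rho> = psize \<mu> + psize \<nu> + c"
      using psize_exchange[OF fs fsl(2,3,1) eq] c by simp
    \<comment> \<open>These inequalities give \<open>c \<le> min a b\<close>, so that the truncated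
      differences \<open>a - c\<close> and \<open>b - c\<close> are genuine.\<close>
    have "psize \<kappa> \<le> psize \<nu>" "psize \<kappa> \<le> psize \<mu>"
      using psize_mono hk fs fsl hstrip_le by blast+
    then have "c \<le> min a b" "psize \<mu> = psize \<kappa> + (b - c)" "psize \<nu> = psize \<kappa> + (a - c)"
      using size h(3,4) by linarith+
    moreover have "F (\<rho>, \<nu>) = (c, \<kappa>, \<nu>)"
      by (simp add: F_def c_def \<kappa>_def)
    moreover have "G (c, \<kappa>, \<nu>) = (\<rho>, \<nu>)"
      using c eq by (auto simp: G_def fun_eq_iff split: nat.split) (metis add_diff_cancel_left')
    ultimately show ?thesis
      using hk by (auto simp: strips_above_def strips_below_def)
  qed
  have G: "G (c, \<kappa>, \<nu>) \<in> (SIGMA \<rho>:strips_above a \<mu>. strips_below b \<rho>)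
      \<and> F (G (c, \<kappa>, \<nu>)) = (c, \<kappa>, \<nu>)"
    if c: "c \<le> min a b" and \<kappa>: "\<kappa> \<in> strips_below (b - c) \<mu>" and \<nu>: "\<nu> \<in> strips_above (a - c) \<kappa>" for c \<kappa> \<nu>
  proof -
    have h: "hstrip \<kappa> \<mu>" "hstrip \<kappa> \<nu>" "psize \<mu> = psize \<kappa> + (b - c)" "psize \<nu> = psize \<kappa> + (a - c)"
      using \<kappa> \<nu> by (auto simp: strips_above_def strips_below_def)
    define \<rho> where "\<rho> = (\<lambda>i. case i of 0 \<Rightarrow> max (\<mu> 0) (\<nu> 0) + c
     | Suc i \<Rightarrow> max (\<mu> (Suc i)) (\<nu> (Suc i)) + min (\<mu> i) (\<nu> i) - \<kappa> i)"
    have le: "max (\<mu> (Suc i)) (\<nu> (Suc i)) \<le> \<kappa> i" "\<kappa> i \<le> min (\<mu> i) (\<nu> i)" for i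
      using h by (auto simp: hstrip_def)
    have eq: "\<kappa> i + \<rho> (Suc i) = max (\<mu> (Suc i)) (\<nu> (Suc i)) + min (\<mu> i) (\<nu> i)" for i
      unfolding \<rho>_def nat.case using le(2)[of i] by linarith
    have c': "\<rho> 0 = max (\<mu> 0) (\<nu> 0) + c"
      by (simp add: \<rho>_def)
    have "max (\<mu> (Suc i)) (\<nu> (Suc i)) \<le> \<rho> (Suc i)" "\<rho> (Suc i) \<le> min (\<mu> i) (\<nu> i)" for i
      using le[of i] eq[of i] by linarith+
    then have "hstrip \<mu> \<rho>" "hstrip \<nu> \<rho>"
      using c' unfolding hstrip_def by (metis max.bounded_iff min.bounded_iff le_add1 not0_implies_Suc)+
    moreover from this have fsl: "fin_supp \<rho>" "fin_supp \<nu>" "fin_supp \<kappa>"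
      using h fs hstrip_fin_supp by blast+
    have size: "psize \<kappa> + psize \<rho> = psize \<mu> + psize \<nu> + c"
      using psize_exchange[OF fs fsl(2,3,1) eq] c' by simp
    then have "psize \<rho> = psize \<mu> + a" "psize \<rho> = psize \<nu> + b"
      using h(3,4) c by linarith+
    moreover have "F (\<rho>, \<nu>) = (c, \<kappa>, \<nu>)"
      using c' eq by (auto simp: F_def fun_eq_iff) (metis add_diff_cancel_right')
    moreover have "G (c, \<kappa>, \<nu>) = (\<rho>, \<nu>)"
      by (simp add: G_def \<rho>_def)
    ultimately show ?thesis
      by (auto simp: strips_above_def strips_below_def)
  qed
  have fin1: "\<forall>\<rho>\<in>strips_above a \<mu>. finite (strips_below b \<rho>)"
    using fs hstrip_fin_supp finite_strips_below unfolding strips_above_def by blast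
  have fin2: "\<forall>\<kappa>\<in>strips_below (b - c) \<mu>. finite (strips_above (a - c) \<kappa>)" for c
    using fs hstrip_fin_supp finite_strips_above unfolding strips_below_def by blast
  have fin3: "\<forall>c\<in>{..min a b}. finite (SIGMA \<kappa>:strips_below (b - c) \<mu>. strips_above (a - c) \<kappa>)"
    using fin2 finite_strips_below[OF fs] by blast
  have "(\<Sum>\<rho>\<in>strips_above a \<mu>. \<Sum>\<nu>\<in>strips_below b \<rho>. f \<nu>)
      = (\<Sum>(\<rho>,\<nu>)\<in>(SIGMA \<rho>:strips_above a \<mu>. strips_below b \<rho>). f \<nu>)"
    using fin1 finite_strips_above[OF fs] by (simp add: sum.Sigma)
  also have "\<dots> = (\<Sum>(c,\<kappa>,\<nu>)\<in>(SIGMA c:{..min a b}. SIGMA \<kappa>:strips_below (b - c) \<mu>.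
      strips_above (a - c) \<kappa>). f \<nu>)"
  proof (rule sum.reindex_bij_witness[where i = G and j = F])
    fix p assume "p \<in> (SIGMA \<rho>:strips_above a \<mu>. strips_below b \<rho>)"
    then obtain \<rho> \<nu> where p: "p = (\<rho>, \<nu>)" "\<rho> \<in> strips_above a \<mu>" "\<nu> \<in> strips_below b \<rho>"
      by blast
    show "G (F p) = p" "F p \<in> (SIGMA c:{..min a b}. SIGMA \<kappa>:strips_below (b - c) \<mu>. strips_above (a - c) \<kappa>)"
      using F[OF p(2,3)] unfolding p(1) by blast+
    show "(case F p of (c, \<kappa>, \<nu>) \<Rightarrow> f \<nu>) = (case p of (\<rho>, \<nu>) \<Rightarrow> f \<nu>)"
      by (simp add: p(1) F_def)
  next
    fix q assume "q \<in> (SIGMA c:{..min a b}. SIGMA \<kappa>:strips_below (b - c) \<mu>. strips_above (a - c) \<kappa>)"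
    then obtain c \<kappa> \<nu> where q: "q = (c, \<kappa>, \<nu>)" "c \<le> min a b" "\<kappa> \<in> strips_below (b - c) \<mu>"
        "\<nu> \<in> strips_above (a - c) \<kappa>"
      by blast
    show "F (G q) = q" "G q \<in> (SIGMA \<rho>:strips_above a \<mu>. strips_below b \<rho>)"
      using G[OF q(2-4)] unfolding q(1) by blast+
  qed
  also have "\<dots> = (\<Sum>c\<le>min a b. \<Sum>(\<kappa>,\<nu>)\<in>(SIGMA \<kappa>:strips_below (b - c) \<mu>. strips_above (a - c) \<kappa>). f \<nu>)"
    by (subst sum.Sigma) (use fin3 in auto)
  also have "\<dots> = (\<Sum>c\<le>min a b. \<Sum>\<kappa>\<in>strips_below (b - c) \<mu>. \<Sum>\<nu>\<in>strips_above (a - c) \<kappa>. f \<nu>)"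
    using fin2 finite_strips_below[OF fs] by (simp add: sum.Sigma)
  finally show ?thesis .
qed

text \<open>Kostka numbers as numbers of chains of horizontal strips.\<close>

primrec kos :: "nat \<Rightarrow> (nat \<Rightarrow> nat) \<Rightarrow> (nat \<Rightarrow> nat) \<Rightarrow> nat" where
  "kos 0 \<alpha> \<rho> = (if \<rho> = (\<lambda>_. 0) then 1 else 0)"
| "kos (Suc N) \<alpha> \<rho> = (\<Sum>\<mu>\<in>strips_below (\<alpha> N) \<rho>. kos N \<alpha> \<mu>)"

lemma kos_cong: "(\<And>i. i < N \<Longrightarrow> \<alpha> i = \<beta> i) \<Longrightarrow> kos N \<alpha> \<rho> = kos N \<beta> \<rho>"
  by (induction N arbitrary: \<rho>) auto

text \<open>Along a chain of strips the shape after \<open>j\<close> steps has at most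
  \<open>j\<close> rows and contains all cells added so far; later shapes contain it. Hence the
  first \<open>j\<close> rows of \<open>\<rho>\<close> hold at least the first \<open>j\<close>
  strips: the content is dominated by the shape.\<close>

lemma kos_nonzeroD:
  assumes "kos N \<alpha> \<rho> \<noteq> 0"
  shows "psize \<rho> = sum \<alpha> {..<N} \<and> (\<forall>i\<ge>N. \<rho> i = 0) \<and> (\<forall>j\<le>N. sum \<alpha> {..<j} \<le> sum \<rho> {..<j})"
  using assms
proof (induction N arbitrary: \<rho>)
  case 0
  then show ?case
    by (simp add: psize_zero split: if_splits)
next
  case (Suc N)
  then obtain \<mu> where \<mu>: "\<mu> \<in> strips_below (\<alpha> N) \<rho>" "kos N \<alpha> \<mu> \<noteq> 0"
    by (metis kos.simps(2) sum.neutral)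
  then have h: "hstrip \<mu> \<rho>" "psize \<rho> = psize \<mu> + \<alpha> N"
    by (auto simp: strips_below_def)
  have IH: "psize \<mu> = sum \<alpha> {..<N}" "\<And>i. i \<ge> N \<Longrightarrow> \<mu> i = 0"
      "\<And>j. j \<le> N \<Longrightarrow> sum \<alpha> {..<j} \<le> sum \<mu> {..<j}"
    using Suc.IH[OF \<mu>(2)] by auto
  have size: "psize \<rho> = sum \<alpha> {..<Suc N}"
    using h(2) IH(1) by simp
  have zero: "\<rho> i = 0" if "i \<ge> Suc N" for i
    using hstrip_ge[OF h(1), of "i - 1"] IH(2)[of "i - 1"] that by (cases i) auto
  have "sum \<alpha> {..<j} \<le> sum \<rho> {..<j}" if "j \<le> Suc N" for j
  proof (cases "j = Suc N")
    case True
    then show ?thesis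
      using psize_eq[of "Suc N" \<rho>] zero size by simp
  next
    case False
    then have "sum \<alpha> {..<j} \<le> sum \<mu> {..<j}"
      using IH(3) that by simp
    also have "\<dots> \<le> sum \<rho> {..<j}"
      using hstrip_le[OF h(1)] by (intro sum_mono)
    finally show ?thesis .
  qed
  then show ?case
    using size zero by blast
qed

text \<open>There is a single chain, which removes the last row at each step. Any admissible
  \<open>\<nu>\<close> vanishes from index \<open>N\<close> on, so it lies below
  \<open>\<rho>\<close> with row \<open>N\<close> deleted, and equality of sizes forces
  equality.\<close>

lemma kos_self:
  assumes "antimono \<rho>" "\<And>i. i \<ge> N \<Longrightarrow> \<rho> i = 0"
  shows "kos N \<rho> \<rho> = 1"
  using assms
proof (induction N arbitrary: \<rho>)
  case 0
  then have "\<rho> = (\<lambda>_. 0)" by auto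
  then show ?case by simp
next
  case (Suc N)
  define \<mu> where "\<mu> = \<rho>(N := 0)"
  have \<mu>0: "\<And>i. i \<ge> N \<Longrightarrow> \<mu> i = 0"
    using Suc.prems(2) by (auto simp: \<mu>_def)
  have mono: "\<rho> (Suc i) \<le> \<rho> i" for i
    using Suc.prems(1) by (simp add: antimono_iff_le_Suc)
  have am: "antimono \<mu>"
    unfolding antimono_iff_le_Suc using mono Suc.prems(2) by (auto simp: \<mu>_def)
  have fs: "fin_supp \<rho>"
    using Suc.prems(2) by (auto simp: fin_supp_def)
  have size: "psize \<rho> = psize \<mu> + \<rho> N"
    using psize_eq[of "Suc N" \<rho>] psize_eq[of N \<mu>] Suc.prems(2) \<mu>0 by (simp add: \<mu>_def)
  have in_below: "\<mu> \<in> strips_below (\<rho> N) \<rho>"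
    unfolding strips_below_def hstrip_def using mono size Suc.prems(2) by (auto simp: \<mu>_def)
  have "kos N \<rho> \<nu> = 0" if "\<nu> \<in> strips_below (\<rho> N) \<rho> - {\<mu>}" for \<nu>
  proof (rule ccontr)
    assume "kos N \<rho> \<nu> \<noteq> 0"
    then have \<nu>0: "\<forall>i\<ge>N. \<nu> i = 0"
      using kos_nonzeroD by blast
    have \<nu>: "hstrip \<nu> \<rho>" "psize \<rho> = psize \<nu> + \<rho> N"
      using that by (auto simp: strips_below_def)
    have "\<nu> i \<le> \<mu> i" for i
      using hstrip_le[OF \<nu>(1), of i] \<nu>0 by (auto simp: \<mu>_def)
    moreover have "fin_supp \<mu>"
      using \<mu>0 by (auto simp: fin_supp_def)
    ultimately have "\<nu> = \<mu>"
      using \<nu>(2) size psize_eqD[of \<mu> \<nu>] by simp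
    then show False
      using that by simp
  qed
  then have "kos (Suc N) \<rho> \<rho> = kos N \<rho> \<mu>"
    using finite_strips_below[OF fs] in_below by (simp add: sum.remove)
  also have "\<dots> = kos N \<mu> \<mu>"
    by (rule kos_cong) (simp add: \<mu>_def)
  also have "\<dots> = 1"
    using am \<mu>0 by (rule Suc.IH)
  finally show ?case .
qed

lemma kos_zero: "kos N \<beta> (\<lambda>_. 0) = (if \<forall>i<N. \<beta> i = 0 then 1 else 0)"
proof (cases "\<forall>i<N. \<beta> i = 0")
  case True
  then have "kos N \<beta> (\<lambda>_. 0) = kos N (\<lambda>_. 0) (\<lambda>_. 0)"
    by (intro kos_cong) auto
  then show ?thesis
    using True kos_self[of "\<lambda>_. 0" N] by (simp add: antimono_def)
next
  case False
  then have "psize (\<lambda>_. 0) \<noteq> sum \<beta> {..<N}"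
    by (auto simp: psize_zero)
  then have "kos N \<beta> (\<lambda>_. 0) = 0"
    using kos_nonzeroD[of N \<beta> "\<lambda>_. 0"] by blast
  then show ?thesis
    using False by simp
qed

text \<open>The exponents left after dividing the monomial \<open>\<beta>\<close> by a monomial of
  degree \<open>a\<close> in the first \<open>N\<close> variables: the index set for a coefficient
  after multiplication by the complete function of degree \<open>a\<close>.\<close>

definition removals :: "nat \<Rightarrow> nat \<Rightarrow> (nat \<Rightarrow> nat) \<Rightarrow> (nat \<Rightarrow> nat) set" where
  "removals N a \<beta> = {\<gamma>. (\<forall>i. \<gamma> i \<le> \<beta> i) \<and> (\<forall>i\<ge>N. \<gamma> i = \<beta> i) \<and> sum \<beta> {..<N} = sum \<gamma> {..<N} + a}"

lemma finite_removals: "finite (removals N a \<beta>)"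
proof -
  let ?g = "\<lambda>f i. if i < N then f i else \<beta> i"
  have "removals N a \<beta> \<subseteq> ?g ` {f. (\<forall>i. f i \<le> sum \<beta> {..<N}) \<and> (\<forall>i\<ge>N. f i = 0)}"
  proof
    fix \<gamma> assume \<gamma>: "\<gamma> \<in> removals N a \<beta>"
    define f where "f i = (if i < N then \<gamma> i else 0)" for i
    have "\<gamma> i \<le> sum \<beta> {..<N}" if "i < N" for i
      using member_le_sum[of i "{..<N}" \<gamma>] \<gamma> that by (simp add: removals_def)
    then have "f \<in> {f. (\<forall>i. f i \<le> sum \<beta> {..<N}) \<and> (\<forall>i\<ge>N. f i = 0)}"
      by (auto simp: f_def)
    moreover have "\<gamma> = ?g f"
      using \<gamma> by (auto simp: removals_def f_def)
    ultimately show "\<gamma> \<in> ?g ` {f. (\<forall>i. f i \<le> sum \<beta> {..<N}) \<and> (\<forall>i\<ge>N. f i = 0)}"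
      by simp
  qed
  then show ?thesis
    using finite_bounded_funs finite_surj by blast
qed

text \<open>Sorts the removals by the amount \<open>c\<close> taken from entry \<open>N\<close>. The
  inner sum leaves that entry alone, hence the explicit update.\<close>

lemma sum_removals_Suc:
  fixes g :: "(nat \<Rightarrow> nat) \<Rightarrow> nat"
  shows "(\<Sum>\<gamma>\<in>removals (Suc N) a \<beta>. g \<gamma>)
    = (\<Sum>c\<le>min a (\<beta> N). \<Sum>\<gamma>\<in>removals N (a - c) \<beta>. g (\<gamma>(N := \<beta> N - c)))"
proof -
  have "(\<Sum>c\<le>min a (\<beta> N). \<Sum>\<gamma>\<in>removals N (a - c) \<beta>. g (\<gamma>(N := \<beta> N - c)))
      = (\<Sum>(c,\<gamma>)\<in>(SIGMA c:{..min a (\<beta> N)}. removals N (a - c) \<beta>). g (\<gamma>(N := \<beta> N - c)))"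
    by (rule sum.Sigma) (simp_all add: finite_removals)
  also have "\<dots> = (\<Sum>\<gamma>\<in>removals (Suc N) a \<beta>. g \<gamma>)"
  proof (rule sum.reindex_bij_witness[where i = "\<lambda>\<gamma>. (\<beta> N - \<gamma> N, \<gamma>(N := \<beta> N))"
        and j = "\<lambda>(c,\<gamma>). \<gamma>(N := \<beta> N - c)"])
    fix p assume "p \<in> (SIGMA c:{..min a (\<beta> N)}. removals N (a - c) \<beta>)"
    then obtain c \<gamma> where p: "p = (c, \<gamma>)" "c \<le> a" "c \<le> \<beta> N" and \<gamma>: "\<And>i. \<gamma> i \<le> \<beta> i"
        "\<And>i. i \<ge> N \<Longrightarrow> \<gamma> i = \<beta> i" "sum \<beta> {..<N} = sum \<gamma> {..<N} + (a - c)"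
      by (auto simp: removals_def)
    have "sum (\<gamma>(N := \<beta> N - c)) {..<N} = sum \<gamma> {..<N}"
      by (intro sum.cong) auto
    then show "(case p of (c,\<gamma>) \<Rightarrow> \<gamma>(N := \<beta> N - c)) \<in> removals (Suc N) a \<beta>"
      using p \<gamma> by (auto simp: removals_def)
    show "(\<beta> N - (case p of (c,\<gamma>) \<Rightarrow> \<gamma>(N := \<beta> N - c)) N,
        (case p of (c,\<gamma>) \<Rightarrow> \<gamma>(N := \<beta> N - c))(N := \<beta> N)) = p"
      using p \<gamma>(2)[of N] by (auto simp: fun_eq_iff)
    show "g (case p of (c,\<gamma>) \<Rightarrow> \<gamma>(N := \<beta> N - c)) = (case p of (c,\<gamma>) \<Rightarrow> g (\<gamma>(N := \<beta> N - c)))"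
      by (simp add: p)
  next
    fix \<gamma> assume "\<gamma> \<in> removals (Suc N) a \<beta>"
    then have \<gamma>: "\<And>i. \<gamma> i \<le> \<beta> i" "\<And>i. i \<ge> Suc N \<Longrightarrow> \<gamma> i = \<beta> i"
        "sum \<beta> {..<N} + \<beta> N = sum \<gamma> {..<N} + \<gamma> N + a"
      by (auto simp: removals_def)
    have le: "sum \<gamma> {..<N} \<le> sum \<beta> {..<N}"
      using \<gamma>(1) by (intro sum_mono)
    have eq: "sum (\<gamma>(N := \<beta> N)) {..<N} = sum \<gamma> {..<N}"
      by (intro sum.cong) auto
    show "(case (\<beta> N - \<gamma> N, \<gamma>(N := \<beta> N)) of (c,\<gamma>) \<Rightarrow> \<gamma>(N := \<beta> N - c)) = \<gamma>"
      using \<gamma>(1)[of N] by auto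
    show "(\<beta> N - \<gamma> N, \<gamma>(N := \<beta> N)) \<in> (SIGMA c:{..min a (\<beta> N)}. removals N (a - c) \<beta>)"
      using \<gamma> le eq \<gamma>(1)[of N] by (auto simp: removals_def)
  qed
  finally show ?thesis by simp
qed

text \<open>The Pieri rule, read off at the monomial \<open>\<beta>\<close>. The added strip is
  moved past the \<open>N\<close> removals hidden in \<open>kos\<close> by
  \<open>strips_commute\<close>; the \<open>c\<close> cells lost on passing the removal of size
  \<open>\<beta> N\<close> are what is taken away from \<open>\<beta> N\<close>.\<close>

lemma sum_strips_above_kos:
  assumes "fin_supp \<mu>"
  shows "(\<Sum>\<rho>\<in>strips_above a \<mu>. kos N \<beta> \<rho>) = (\<Sum>\<gamma>\<in>removals N a \<beta>. kos N \<gamma> \<mu>)"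
  using assms
proof (induction N arbitrary: a \<mu>)
  case 0
  have "(\<Sum>\<rho>\<in>strips_above a \<mu>. kos 0 \<beta> \<rho>) = (if (\<lambda>_. 0) \<in> strips_above a \<mu> then 1 else 0)"
    using finite_strips_above[OF 0] by simp
  also have "(\<lambda>_. 0) \<in> strips_above a \<mu> \<longleftrightarrow> \<mu> = (\<lambda>_. 0) \<and> a = 0"
    by (auto simp: strips_above_def hstrip_def psize_zero)
  also have "(if \<mu> = (\<lambda>_. 0) \<and> a = 0 then 1 else 0) = (\<Sum>\<gamma>\<in>(if a = 0 then {\<beta>} else {}). kos 0 \<gamma> \<mu>)"
    by auto
  also have "(if a = 0 then {\<beta>} else {}) = removals 0 a \<beta>"
    by (auto simp: removals_def)
  finally show ?case .
next
  case (Suc N)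
  have fsb: "fin_supp \<kappa>" if "\<kappa> \<in> strips_below b \<mu>" for b \<kappa>
    using that Suc.prems hstrip_fin_supp unfolding strips_below_def by blast
  have "(\<Sum>\<rho>\<in>strips_above a \<mu>. kos (Suc N) \<beta> \<rho>)
      = (\<Sum>c\<le>min a (\<beta> N). \<Sum>\<kappa>\<in>strips_below (\<beta> N - c) \<mu>. \<Sum>\<nu>\<in>strips_above (a - c) \<kappa>. kos N \<beta> \<nu>)"
    unfolding kos.simps by (rule strips_commute[OF Suc.prems])
  also have "\<dots> = (\<Sum>c\<le>min a (\<beta> N). \<Sum>\<kappa>\<in>strips_below (\<beta> N - c) \<mu>. \<Sum>\<gamma>\<in>removals N (a - c) \<beta>. kos N \<gamma> \<kappa>)"
    by (intro sum.cong refl Suc.IH) (rule fsb)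
  also have "\<dots> = (\<Sum>c\<le>min a (\<beta> N). \<Sum>\<gamma>\<in>removals N (a - c) \<beta>. kos (Suc N) (\<gamma>(N := \<beta> N - c)) \<mu>)"
  proof (rule sum.cong[OF refl])
    fix c
    have "(\<Sum>\<kappa>\<in>strips_below (\<beta> N - c) \<mu>. kos N \<gamma> \<kappa>) = kos (Suc N) (\<gamma>(N := \<beta> N - c)) \<mu>" for \<gamma>
      by (auto intro!: sum.cong kos_cong)
    then show "(\<Sum>\<kappa>\<in>strips_below (\<beta> N - c) \<mu>. \<Sum>\<gamma>\<in>removals N (a - c) \<beta>. kos N \<gamma> \<kappa>)
       = (\<Sum>\<gamma>\<in>removals N (a - c) \<beta>. kos (Suc N) (\<gamma>(N := \<beta> N - c)) \<mu>)"
      by (subst sum.swap) simp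
  qed
  also have "\<dots> = (\<Sum>\<gamma>\<in>removals (Suc N) a \<beta>. kos (Suc N) \<gamma> \<mu>)"
    by (rule sum_removals_Suc[symmetric])
  finally show ?case .
qed

text \<open>The coefficient of the monomial with exponents \<open>\<beta>\<close> in a product of complete symmetric functions.\<close>

primrec hcoeff :: "nat list \<Rightarrow> (nat \<Rightarrow> nat) \<Rightarrow> nat" where
  "hcoeff [] \<beta> = (if \<beta> = (\<lambda>_. 0) then 1 else 0)"
| "hcoeff (a # as) \<beta> = (\<Sum>\<gamma>\<in>{\<gamma>. (\<forall>i. \<gamma> i \<le> \<beta> i) \<and> psize \<beta> = psize \<gamma> + a}. hcoeff as \<gamma>)"

text \<open>The counting form of RSK, obtained by iterating the Pieri rule. The list is reversed
  because \<open>hcoeff\<close> peels off its first factor while \<open>kos\<close> removes the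
  strip with the last index.\<close>

theorem hcoeff_eq_sum_kos:
  assumes "\<And>i. i \<ge> N \<Longrightarrow> \<beta> i = 0"
  shows "hcoeff as \<beta> = (\<Sum>\<rho>\<in>partitions_of (sum_list as). kos (length as) (nth (rev as)) \<rho> * kos N \<beta> \<rho>)"
  using assms
proof (induction as arbitrary: \<beta>)
  case Nil
  have "partitions_of 0 = {\<lambda>_. 0}"
    by (auto simp: partitions_of_def psize_zero_iff antimono_def fin_supp_zero)
  moreover have "(\<forall>i<N. \<beta> i = 0) \<longleftrightarrow> \<beta> = (\<lambda>_. 0)"
    using Nil.prems by (meson ext leI)
  ultimately show ?case
    by (simp add: kos_zero)
next
  case (Cons a as)
  let ?n = "sum_list as"
  let ?k = "kos (length as) (nth (rev as))"
  have k: "kos (length (a # as)) (nth (rev (a # as))) \<rho> = (\<Sum>\<mu>\<in>strips_below a \<rho>. ?k \<mu>)" for \<rho>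
    by (auto intro!: sum.cong kos_cong simp: nth_append)
  have fsb: "finite (strips_below a \<rho>)" if "\<rho> \<in> partitions_of (a + ?n)" for \<rho>
    using that finite_strips_below by (auto simp: partitions_of_def)
  have fsa: "finite (strips_above a \<mu>)" if "\<mu> \<in> partitions_of ?n" for \<mu>
    using that finite_strips_above by (auto simp: partitions_of_def)
  have "(\<Sum>\<rho>\<in>partitions_of (sum_list (a # as)). kos (length (a # as)) (nth (rev (a # as))) \<rho> * kos N \<beta> \<rho>)
      = (\<Sum>\<rho>\<in>partitions_of (a + ?n). \<Sum>\<mu>\<in>strips_below a \<rho>. ?k \<mu> * kos N \<beta> \<rho>)"
    unfolding k by (simp add: sum_distrib_right)
  also have "\<dots> = (\<Sum>(\<rho>,\<mu>)\<in>(SIGMA \<rho>:partitions_of (a + ?n). strips_below a \<rho>). ?k \<mu> * kos N \<beta> \<rho>)"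
    using fsb by (simp add: sum.Sigma finite_partitions_of)
  also have "\<dots> = (\<Sum>(\<mu>,\<rho>)\<in>(SIGMA \<mu>:partitions_of ?n. strips_above a \<mu>). ?k \<mu> * kos N \<beta> \<rho>)"
  proof (rule sum.reindex_bij_witness[where i = prod.swap and j = prod.swap])
    fix p assume "p \<in> (SIGMA \<rho>:partitions_of (a + ?n). strips_below a \<rho>)"
    then obtain \<rho> \<mu> where p: "p = (\<rho>, \<mu>)" "\<rho> \<in> partitions_of (a + ?n)" "\<mu> \<in> strips_below a \<rho>"
      by blast
    have "\<mu> \<in> partitions_of ?n"
      using strips_below_partition[of \<rho> \<mu> a] p by (simp add: partitions_of_def)
    then show "prod.swap p \<in> (SIGMA \<mu>:partitions_of ?n. strips_above a \<mu>)"
      using p by (simp add: strips_below_def strips_above_def)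
  next
    fix p assume "p \<in> (SIGMA \<mu>:partitions_of ?n. strips_above a \<mu>)"
    then obtain \<rho> \<mu> where p: "p = (\<mu>, \<rho>)" "\<mu> \<in> partitions_of ?n" "\<rho> \<in> strips_above a \<mu>"
      by blast
    have "\<rho> \<in> partitions_of (a + ?n)"
      using strips_above_partition[of \<mu> \<rho> a] p by (simp add: partitions_of_def)
    then show "prod.swap p \<in> (SIGMA \<rho>:partitions_of (a + ?n). strips_below a \<rho>)"
      using p by (simp add: strips_below_def strips_above_def)
  qed auto
  also have "\<dots> = (\<Sum>\<mu>\<in>partitions_of ?n. ?k \<mu> * (\<Sum>\<rho>\<in>strips_above a \<mu>. kos N \<beta> \<rho>))"
    using fsa by (simp add: sum.Sigma finite_partitions_of sum_distrib_left)
  also have "\<dots> = (\<Sum>\<mu>\<in>partitions_of ?n. \<Sum>\<gamma>\<in>removals N a \<beta>. ?k \<mu> * kos N \<gamma> \<mu>)"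
    by (intro sum.cong) (auto simp: sum_strips_above_kos partitions_of_def sum_distrib_left)
  also have "\<dots> = (\<Sum>\<gamma>\<in>removals N a \<beta>. \<Sum>\<mu>\<in>partitions_of ?n. ?k \<mu> * kos N \<gamma> \<mu>)"
    by (rule sum.swap)
  also have "\<dots> = (\<Sum>\<gamma>\<in>removals N a \<beta>. hcoeff as \<gamma>)"
    using Cons.prems by (intro sum.cong) (auto simp: Cons.IH removals_def)
  also have "removals N a \<beta> = {\<gamma>. (\<forall>i. \<gamma> i \<le> \<beta> i) \<and> psize \<beta> = psize \<gamma> + a}"
  proof (intro set_eqI iffI)
    fix \<gamma> assume "\<gamma> \<in> removals N a \<beta>"
    then show "\<gamma> \<in> {\<gamma>. (\<forall>i. \<gamma> i \<le> \<beta> i) \<and> psize \<beta> = psize \<gamma> + a}"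
      using Cons.prems psize_eq[of N \<beta>] psize_eq[of N \<gamma>] by (simp add: removals_def)
  next
    fix \<gamma> assume \<gamma>: "\<gamma> \<in> {\<gamma>. (\<forall>i. \<gamma> i \<le> \<beta> i) \<and> psize \<beta> = psize \<gamma> + a}"
    then have "\<gamma> i = 0" if "i \<ge> N" for i
      using Cons.prems[OF that] by (metis (mono_tags, lifting) le_zero_eq mem_Collect_eq)
    then show "\<gamma> \<in> removals N a \<beta>"
      using \<gamma> Cons.prems psize_eq[of N \<beta>] psize_eq[of N \<gamma>] by (simp add: removals_def)
  qed
  finally show ?case by simp
qed

section \<open>Symmetry of the Kostka numbers in their content\<close>

lemma psize_bij:
  assumes "bij \<sigma>"
  shows "psize (\<lambda>i. \<beta> (\<sigma> i)) = psize \<beta>"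
proof -
  have "bij_betw \<sigma> {i. \<beta> (\<sigma> i) \<noteq> 0} {i. \<beta> i \<noteq> 0}"
    by (rule bij_betw_byWitness[where f' = "inv \<sigma>"])
      (use assms in \<open>auto simp: bij_is_inj bij_is_surj surj_f_inv_f\<close>)
  then show ?thesis
    unfolding psize_def by (rule sum.reindex_bij_betw)
qed

lemma hcoeff_bij:
  assumes \<sigma>: "bij \<sigma>"
  shows "hcoeff as (\<lambda>i. \<beta> (\<sigma> i)) = hcoeff as \<beta>"
proof (induction as arbitrary: \<beta>)
  case Nil
  have "(\<lambda>i. \<beta> (\<sigma> i)) = (\<lambda>_. 0) \<longleftrightarrow> \<beta> = (\<lambda>_. 0)"
    using \<sigma> by (auto simp: fun_eq_iff) (metis bij_pointE)
  then show ?case by simp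
next
  case (Cons a as)
  have inv: "\<sigma> (inv \<sigma> i) = i" "inv \<sigma> (\<sigma> i) = i" for i
    using \<sigma> by (simp_all add: bij_is_surj surj_f_inv_f bij_is_inj)
  have size: "psize (\<lambda>i. \<gamma> (\<sigma> i)) = psize \<gamma>" "psize (\<lambda>i. \<gamma> (inv \<sigma> i)) = psize \<gamma>" for \<gamma>
    using psize_bij \<sigma> bij_imp_bij_inv by blast+
  show ?case
    unfolding hcoeff.simps
  proof (rule sum.reindex_bij_witness[where i = "\<lambda>\<gamma> i. \<gamma> (\<sigma> i)" and j = "\<lambda>\<gamma> i. \<gamma> (inv \<sigma> i)"])
    fix \<gamma> assume "\<gamma> \<in> {\<gamma>. (\<forall>i. \<gamma> i \<le> \<beta> (\<sigma> i)) \<and> psize (\<lambda>i. \<beta> (\<sigma> i)) = psize \<gamma> + a}"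
    then show "(\<lambda>i. \<gamma> (inv \<sigma> i)) \<in> {\<gamma>. (\<forall>i. \<gamma> i \<le> \<beta> i) \<and> psize \<beta> = psize \<gamma> + a}"
      using size inv by (simp, metis)
    show "hcoeff as (\<lambda>i. \<gamma> (inv \<sigma> i)) = hcoeff as \<gamma>"
      using Cons.IH[of "\<lambda>i. \<gamma> (inv \<sigma> i)"] inv by simp
  qed (use size inv in auto)
qed

text \<open>The coefficients \<open>hcoeff\<close> are symmetric by relabelling. By the RSK
  identity, the Kostka numbers for \<open>\<beta>\<close> and for its rearrangement therefore solve
  the same linear system, whose matrix of Kostka numbers is unitriangular; so they agree.\<close>

lemma kos_bij:
  assumes \<sigma>: "bij \<sigma>" and \<rho>: "\<rho> \<in> partitions_of n"
    and N: "\<And>i. i \<ge> N \<Longrightarrow> \<beta> i = 0" and N': "\<And>i. i \<ge> N' \<Longrightarrow> \<beta> (\<sigma> i) = 0"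
  shows "kos N' (\<lambda>i. \<beta> (\<sigma> i)) \<rho> = kos N \<beta> \<rho>"
proof -
  let ?S = "partitions_of n"
  define a where "a \<rho> = int (kos N' (\<lambda>i. \<beta> (\<sigma> i)) \<rho>) - int (kos N \<beta> \<rho>)" for \<rho>
  define T where "T \<rho> \<mu> = int (kos n \<mu> \<rho>)" for \<rho> \<mu>
  \<comment> \<open>The sum of all partial sums is strictly monotone for dominance on partitions of
    \<open>n\<close>, so it serves as a numerical rank.\<close>
  define rk where "rk \<rho> = (\<Sum>j\<le>n. sum \<rho> {..<j})" for \<rho> :: "nat \<Rightarrow> nat"
  have "a \<rho> = 0"
  proof (rule triangular_system[where S = ?S and T = T and rk = rk and a = a and L = \<rho>])
    show "finite ?S" by (rule finite_partitions_of)
    show "\<rho> \<in> ?S" by (rule \<rho>)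
    show "T \<mu> \<mu> \<noteq> 0" if "\<mu> \<in> ?S" for \<mu>
      using kos_self[of \<mu> n] partitions_of_bound[OF that] that by (simp add: T_def partitions_of_def)
    show "\<nu> = \<mu> \<or> rk \<mu> < rk \<nu>" if \<nu>: "\<nu> \<in> ?S" and \<mu>: "\<mu> \<in> ?S" and "T \<nu> \<mu> \<noteq> 0" for \<nu> \<mu>
    proof (rule disjCI)
      assume "\<not> rk \<mu> < rk \<nu>"
      have le: "sum \<mu> {..<j} \<le> sum \<nu> {..<j}" if "j \<le> n" for j
        using kos_nonzeroD[of n \<mu> \<nu>] \<open>T \<nu> \<mu> \<noteq> 0\<close> that by (simp add: T_def)
      have eq: "sum \<mu> {..<j} = sum \<nu> {..<j}" if "j \<le> n" for j
      proof (rule ccontr)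
        assume "sum \<mu> {..<j} \<noteq> sum \<nu> {..<j}"
        then have "sum \<mu> {..<j} < sum \<nu> {..<j}"
          using le[OF that] by simp
        then have "rk \<mu> < rk \<nu>"
          unfolding rk_def using le that by (intro sum_strict_mono_ex1) auto
        then show False
          using \<open>\<not> rk \<mu> < rk \<nu>\<close> by simp
      qed
      show "\<nu> = \<mu>"
      proof
        fix i
        show "\<nu> i = \<mu> i"
        proof (cases "i < n")
          case True
          then show ?thesis
            using eq[of i] eq[of "Suc i"] by simp
        next
          case False
          then show ?thesis
            using partitions_of_bound(2)[OF \<mu>, of i] partitions_of_bound(2)[OF \<nu>, of i] by simp
        qed
      qed
    qed
    show "(\<Sum>\<rho>\<in>?S. a \<rho> * T \<rho> \<mu>) = 0" if "\<mu> \<in> ?S" for \<mu>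
    proof -
      \<comment> \<open>Reversed so that \<open>nth (rev as)\<close> is \<open>\<mu>\<close> on the
        first \<open>n\<close> indices; trailing zero parts are harmless factors.\<close>
      define as where "as = rev (map \<mu> [0..<n])"
      have "sum_list as = sum \<mu> {..<n}"
        unfolding as_def by (simp add: interv_sum_list_conv_sum_set_nat lessThan_atLeast0)
      also have "\<dots> = n"
        using psize_eq[of n \<mu>] partitions_of_bound(2)[OF that] that by (simp add: partitions_of_def)
      finally have sum: "sum_list as = n" .
      have k: "kos (length as) (nth (rev as)) \<rho> = kos n \<mu> \<rho>" for \<rho>
        by (auto simp: as_def intro!: kos_cong)
      have "(\<Sum>\<rho>\<in>?S. a \<rho> * T \<rho> \<mu>)
          = int (\<Sum>\<rho>\<in>?S. kos n \<mu> \<rho> * kos N' (\<lambda>i. \<beta> (\<sigma> i)) \<rho>) - int (\<Sum>\<rho>\<in>?S. kos n \<mu> \<rho> * kos N \<beta> \<rho>)"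
        by (simp add: a_def T_def algebra_simps sum_subtractf)
      also have "(\<Sum>\<rho>\<in>?S. kos n \<mu> \<rho> * kos N \<beta> \<rho>) = hcoeff as \<beta>"
        using hcoeff_eq_sum_kos[of N \<beta> as] N by (simp add: sum k)
      also have "(\<Sum>\<rho>\<in>?S. kos n \<mu> \<rho> * kos N' (\<lambda>i. \<beta> (\<sigma> i)) \<rho>) = hcoeff as (\<lambda>i. \<beta> (\<sigma> i))"
        using hcoeff_eq_sum_kos[of N' "\<lambda>i. \<beta> (\<sigma> i)" as] N' by (simp add: sum k)
      finally show ?thesis
        using hcoeff_bij[OF \<sigma>] by simp
    qed
  qed
  then show ?thesis
    by (simp add: a_def)
qed

subsection \<open>Semistandard tableaux\<close>

definition fcells :: "(nat \<Rightarrow> nat) \<Rightarrow> (nat \<times> nat) set" where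
  "fcells \<rho> = {(i, j). j < \<rho> i}"

text \<open>In contrast to \<open>ssyt\<close>, the entries are bounded by \<open>N\<close> and the
  content is prescribed below \<open>N\<close>, which permits induction on the largest possible
  entry.\<close>

definition tableaux :: "nat \<Rightarrow> (nat \<Rightarrow> nat) \<Rightarrow> (nat \<Rightarrow> nat) \<Rightarrow> (nat \<times> nat \<Rightarrow> nat) set" where
  "tableaux N \<alpha> \<rho> = {T. (\<forall>c. c \<notin> fcells \<rho> \<longrightarrow> T c = 0)
     \<and> (\<forall>i j. (i, Suc j) \<in> fcells \<rho> \<longrightarrow> T (i,j) \<le> T (i, Suc j))
     \<and> (\<forall>i j. (Suc i, j) \<in> fcells \<rho> \<longrightarrow> T (i,j) < T (Suc i, j))
     \<and> (\<forall>c\<in>fcells \<rho>. T c < N) \<and> (\<forall>v<N. card {c\<in>fcells \<rho>. T c = v} = \<alpha> v)}"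

lemma in_fcells: "(i, j) \<in> fcells \<rho> \<longleftrightarrow> j < \<rho> i"
  by (simp add: fcells_def)

lemma card_fcells:
  assumes "fin_supp \<rho>"
  shows "finite (fcells \<rho>)" "card (fcells \<rho>) = psize \<rho>"
proof -
  have eq: "fcells \<rho> = Sigma {i. \<rho> i \<noteq> 0} (\<lambda>i. {..<\<rho> i})"
    by (auto simp: fcells_def)
  have fin: "finite {i. \<rho> i \<noteq> 0}"
    using assms by (simp add: fin_supp_finite)
  show "finite (fcells \<rho>)"
    unfolding eq using fin by blast
  show "card (fcells \<rho>) = psize \<rho>"
    unfolding eq psize_def using fin by (subst card_SigmaI) auto
qed

lemma down_closed_eq_lessThan:
  fixes A :: "nat set"
  assumes fin: "finite A" and down: "\<And>x y. x \<in> A \<Longrightarrow> y < x \<Longrightarrow> y \<in> A"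
  shows "A = {..<card A}"
proof (cases "A = {}")
  case False
  have "A = {..<Suc (Max A)}"
  proof
    show "A \<subseteq> {..<Suc (Max A)}"
      using fin by (auto simp: less_Suc_eq_le)
    show "{..<Suc (Max A)} \<subseteq> A"
      using Max_in[OF fin False] down by (auto simp: less_Suc_eq)
  qed
  then show ?thesis
    by (metis card_lessThan)
qed simp

lemma finite_tableaux:
  assumes "fin_supp \<rho>"
  shows "finite (tableaux N \<alpha> \<rho>)"
proof -
  have "finite {T. \<forall>c. (c \<in> fcells \<rho> \<longrightarrow> T c \<in> {..N}) \<and> (c \<notin> fcells \<rho> \<longrightarrow> T c = 0)}"
    using card_fcells(1)[OF assms] by (intro finite_set_of_finite_funs) simp_all
  then show ?thesis
    by (rule finite_subset[rotated]) (auto simp: tableaux_def less_imp_le)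
qed

text \<open>The cells with entry \<open>N\<close> form a horizontal strip, by strictness down the
  columns. Deleting them (\<open>F\<close>) and filling the strip with \<open>N\<close>
  (\<open>G\<close>) are inverse to each other, which is the recursion of
  \<open>kos\<close>.\<close>

lemma card_tableaux:
  assumes "antimono \<rho>" "fin_supp \<rho>"
  shows "card (tableaux N \<alpha> \<rho>) = kos N \<alpha> \<rho>"
  using assms
proof (induction N arbitrary: \<rho>)
  case 0
  show ?case
  proof (cases "\<rho> = (\<lambda>_. 0)")
    case True
    then have "tableaux 0 \<alpha> \<rho> = {\<lambda>_. 0}"
      by (auto simp: tableaux_def fcells_def)
    then show ?thesis
      using True by simp
  next
    case False
    then obtain i where "\<rho> i \<noteq> 0" by auto
    then have "(i, 0) \<in> fcells \<rho>" by (simp add: fcells_def)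
    then have "tableaux 0 \<alpha> \<rho> = {}"
      by (auto simp: tableaux_def)
    then show ?thesis
      using False by simp
  qed
next
  case (Suc N)
  note fin = card_fcells(1)[OF Suc.prems(2)]
  define \<mu> where "\<mu> T i = card {j. j < \<rho> i \<and> T (i, j) < N}" for T i
  define F where "F T = (\<mu> T, \<lambda>c. if c \<in> fcells (\<mu> T) then T c else 0)" for T
  define G where "G = (\<lambda>(\<nu>, T) c. if c \<in> fcells \<nu> then T c else if c \<in> fcells \<rho> then N else 0)"
  have le: "\<rho> (Suc i) \<le> \<rho> i" for i
    using Suc.prems(1) by (simp add: antimono_iff_le_Suc)
  have F: "F T \<in> Sigma (strips_below (\<alpha> N) \<rho>) (tableaux N \<alpha>) \<and> G (F T) = T"
    if "T \<in> tableaux (Suc N) \<alpha> \<rho>" for T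
  proof -
    have T0: "\<And>c. c \<notin> fcells \<rho> \<Longrightarrow> T c = 0"
      and row: "\<And>i j. Suc j < \<rho> i \<Longrightarrow> T (i,j) \<le> T (i, Suc j)"
      and col: "\<And>i j. j < \<rho> (Suc i) \<Longrightarrow> T (i,j) < T (Suc i, j)"
      and less: "\<And>c. c \<in> fcells \<rho> \<Longrightarrow> T c < Suc N"
      and cont: "\<And>v. v < Suc N \<Longrightarrow> card {c\<in>fcells \<rho>. T c = v} = \<alpha> v"
      using that by (auto simp: tableaux_def in_fcells)
    have rowle: "T (i, j) \<le> T (i, j')" if "j \<le> j'" "j' < \<rho> i" for i j j'
      using that
    proof (induction j' rule: dec_induct)
      case (step m)
      then show ?case
        using row[of m i] by simp
    qed simp
    have "{j. j < \<rho> i \<and> T (i, j) < N} = {..<\<mu> T i}" for i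
      unfolding \<mu>_def
    proof (rule down_closed_eq_lessThan)
      show "y \<in> {j. j < \<rho> i \<and> T (i, j) < N}" if "x \<in> {j. j < \<rho> i \<and> T (i, j) < N}" "y < x" for x y
        using that rowle[of y x i] by auto
    qed simp
    then have \<mu>: "j < \<mu> T i \<longleftrightarrow> j < \<rho> i \<and> T (i, j) < N" for i j
      by blast
    have cells: "fcells (\<mu> T) = {c\<in>fcells \<rho>. T c < N}"
      by (auto simp: fcells_def \<mu>)
    have strip: "hstrip (\<mu> T) \<rho>"
      unfolding hstrip_def
    proof (intro allI conjI)
      fix i
      show "\<mu> T i \<le> \<rho> i"
        using \<mu>[of "\<rho> i" i] by simp
      \<comment> \<open>Otherwise the cell \<open>(Suc i, \<mu> T i)\<close> lies in the diagram
        with an entry of at most \<open>N\<close>. The entry directly above it is then below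
        \<open>N\<close>, although \<open>\<mu> T i\<close> is the first column of row
        \<open>i\<close> where this fails.\<close>
      show "\<rho> (Suc i) \<le> \<mu> T i"
      proof (rule ccontr)
        assume "\<not> \<rho> (Suc i) \<le> \<mu> T i"
        then have j: "\<mu> T i < \<rho> (Suc i)" by simp
        then have "T (i, \<mu> T i) < N"
          using col[of "\<mu> T i" i] less[of "(Suc i, \<mu> T i)"] by (simp add: in_fcells)
        then show False
          using \<mu>[of "\<mu> T i" i] j le[of i] by simp
      qed
    qed
    have fs: "fin_supp (\<mu> T)"
      using strip Suc.prems(2) hstrip_fin_supp by blast
    have "fcells \<rho> = fcells (\<mu> T) \<union> {c\<in>fcells \<rho>. T c = N}"
      using less by (auto simp: cells less_Suc_eq)
    moreover have "fcells (\<mu> T) \<inter> {c\<in>fcells \<rho>. T c = N} = {}"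
      by (auto simp: cells)
    ultimately have "card (fcells \<rho>) = card (fcells (\<mu> T)) + card {c\<in>fcells \<rho>. T c = N}"
      using fin card_Un_disjoint[of "fcells (\<mu> T)" "{c\<in>fcells \<rho>. T c = N}"] by (simp add: cells)
    then have size: "psize \<rho> = psize (\<mu> T) + \<alpha> N"
      using card_fcells(2) fs Suc.prems(2) cont[of N] by simp
    have cont': "{c\<in>fcells (\<mu> T). (if c \<in> fcells (\<mu> T) then T c else 0) = v} = {c\<in>fcells \<rho>. T c = v}"
      if "v < N" for v
      using that by (auto simp: cells)
    have "(\<lambda>c. if c \<in> fcells (\<mu> T) then T c else 0) \<in> tableaux N \<alpha> (\<mu> T)"
      unfolding tableaux_def mem_Collect_eq
    proof (intro conjI allI impI ballI)
      fix i j assume "(i, Suc j) \<in> fcells (\<mu> T)"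
      then show "(if (i, j) \<in> fcells (\<mu> T) then T (i, j) else 0)
          \<le> (if (i, Suc j) \<in> fcells (\<mu> T) then T (i, Suc j) else 0)"
        using row[of j i] by (simp add: in_fcells \<mu>)
    next
      fix i j assume *: "(Suc i, j) \<in> fcells (\<mu> T)"
      then have "j < \<rho> (Suc i)" "T (Suc i, j) < N"
        by (simp_all add: in_fcells \<mu>)
      then show "(if (i, j) \<in> fcells (\<mu> T) then T (i, j) else 0)
          < (if (Suc i, j) \<in> fcells (\<mu> T) then T (Suc i, j) else 0)"
        using col[of j i] * le[of i] by (simp add: in_fcells \<mu>)
    next
      fix v assume "v < N"
      then show "card {c\<in>fcells (\<mu> T). (if c \<in> fcells (\<mu> T) then T c else 0) = v} = \<alpha> v"
        using cont' cont[of v] by simp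
    qed (auto simp: cells)
    moreover have "G (F T) = T"
      using T0 less by (auto simp: G_def F_def fun_eq_iff cells less_Suc_eq)
    ultimately show ?thesis
      using strip size by (simp add: F_def strips_below_def)
  qed
  have G: "G (\<nu>, T) \<in> tableaux (Suc N) \<alpha> \<rho> \<and> F (G (\<nu>, T)) = (\<nu>, T)"
    if \<nu>: "\<nu> \<in> strips_below (\<alpha> N) \<rho>" and T: "T \<in> tableaux N \<alpha> \<nu>" for \<nu> T
  proof -
    have strip: "hstrip \<nu> \<rho>" and size: "psize \<rho> = psize \<nu> + \<alpha> N"
      using \<nu> by (auto simp: strips_below_def)
    have fs: "fin_supp \<nu>"
      using strip Suc.prems(2) hstrip_fin_supp by blast
    have T0: "\<And>c. c \<notin> fcells \<nu> \<Longrightarrow> T c = 0"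
      and row: "\<And>i j. Suc j < \<nu> i \<Longrightarrow> T (i,j) \<le> T (i, Suc j)"
      and col: "\<And>i j. j < \<nu> (Suc i) \<Longrightarrow> T (i,j) < T (Suc i, j)"
      and less: "\<And>c. c \<in> fcells \<nu> \<Longrightarrow> T c < N"
      and cont: "\<And>v. v < N \<Longrightarrow> card {c\<in>fcells \<nu>. T c = v} = \<alpha> v"
      using T by (auto simp: tableaux_def in_fcells)
    have sub: "fcells \<nu> \<subseteq> fcells \<rho>"
      using hstrip_le[OF strip] by (auto simp: fcells_def intro: less_le_trans)
    have GT: "G (\<nu>, T) c = (if c \<in> fcells \<nu> then T c else if c \<in> fcells \<rho> then N else 0)" for c
      by (simp add: G_def)
    have lessN: "G (\<nu>, T) c < N \<longleftrightarrow> c \<in> fcells \<nu>" if "c \<in> fcells \<rho>" for c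
      using that less by (auto simp: GT)
    have "\<mu> (G (\<nu>, T)) = \<nu>"
    proof
      fix i
      have "{j. j < \<rho> i \<and> G (\<nu>, T) (i, j) < N} = {..<\<nu> i}"
        using lessN[of "(i, _)"] hstrip_le[OF strip, of i] by (auto simp: in_fcells intro: less_le_trans)
      then show "\<mu> (G (\<nu>, T)) i = \<nu> i"
        by (simp add: \<mu>_def)
    qed
    moreover have "(\<lambda>c. if c \<in> fcells \<nu> then G (\<nu>, T) c else 0) = T"
      using T0 by (auto simp: GT)
    ultimately have FG: "F (G (\<nu>, T)) = (\<nu>, T)"
      by (simp add: F_def)
    have "G (\<nu>, T) \<in> tableaux (Suc N) \<alpha> \<rho>"
      unfolding tableaux_def mem_Collect_eq
    proof (intro conjI allI impI ballI)
      fix c assume "c \<notin> fcells \<rho>"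
      then show "G (\<nu>, T) c = 0"
        using sub by (auto simp: GT)
    next
      fix i j assume "(i, Suc j) \<in> fcells \<rho>"
      then show "G (\<nu>, T) (i, j) \<le> G (\<nu>, T) (i, Suc j)"
        using row[of j i] less[of "(i, j)"] by (auto simp: GT in_fcells)
    next
      fix i j assume "(Suc i, j) \<in> fcells \<rho>"
      then have "(i, j) \<in> fcells \<nu>"
        using hstrip_ge[OF strip, of i] by (simp add: in_fcells)
      then show "G (\<nu>, T) (i, j) < G (\<nu>, T) (Suc i, j)"
        using \<open>(Suc i, j) \<in> fcells \<rho>\<close> col[of j i] less[of "(i, j)"] by (auto simp: GT in_fcells)
    next
      fix c assume "c \<in> fcells \<rho>"
      then show "G (\<nu>, T) c < Suc N"
        using less[of c] by (auto simp: GT)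
    next
      fix v assume v: "v < Suc N"
      show "card {c\<in>fcells \<rho>. G (\<nu>, T) c = v} = \<alpha> v"
      proof (cases "v = N")
        case True
        have "{c\<in>fcells \<rho>. G (\<nu>, T) c = v} = fcells \<rho> - fcells \<nu>"
          unfolding True using less by (auto simp: GT)
        then show ?thesis
          using card_Diff_subset[of "fcells \<nu>" "fcells \<rho>"] card_fcells fs Suc.prems(2) size sub True
          by simp
      next
        case False
        then have "{c\<in>fcells \<rho>. G (\<nu>, T) c = v} = {c\<in>fcells \<nu>. T c = v}"
          using sub by (auto simp: GT)
        then show ?thesis
          using cont[of v] v False by simp
      qed
    qed
    then show ?thesis
      using FG by blast
  qed
  have "bij_betw F (tableaux (Suc N) \<alpha> \<rho>) (Sigma (strips_below (\<alpha> N) \<rho>) (tableaux N \<alpha>))"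
    by (rule bij_betw_byWitness[where f' = G]) (use F G in blast)+
  then have "card (tableaux (Suc N) \<alpha> \<rho>) = card (Sigma (strips_below (\<alpha> N) \<rho>) (tableaux N \<alpha>))"
    by (rule bij_betw_same_card)
  also have "\<dots> = (\<Sum>\<nu>\<in>strips_below (\<alpha> N) \<rho>. card (tableaux N \<alpha> \<nu>))"
  proof (rule card_SigmaI)
    show "\<forall>\<nu>\<in>strips_below (\<alpha> N) \<rho>. finite (tableaux N \<alpha> \<nu>)"
      using finite_tableaux hstrip_fin_supp Suc.prems(2) unfolding strips_below_def by blast
  qed (rule finite_strips_below[OF Suc.prems(2)])
  also have "\<dots> = (\<Sum>\<nu>\<in>strips_below (\<alpha> N) \<rho>. kos N \<alpha> \<nu>)"
  proof (rule sum.cong[OF refl])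
    fix \<nu> assume "\<nu> \<in> strips_below (\<alpha> N) \<rho>"
    then have "hstrip \<nu> \<rho>"
      by (simp add: strips_below_def)
    then show "card (tableaux N \<alpha> \<nu>) = kos N \<alpha> \<nu>"
      using Suc.IH hstrip_antimono(1) hstrip_fin_supp Suc.prems(2) by blast
  qed
  finally show ?case by simp
qed

section \<open>Partitions as lists and as functions\<close>

lemma part_partition:
  assumes "is_partition l"
  shows "part l \<in> partitions_of (sum_list l)"
proof -
  have "part l (Suc i) \<le> part l i" for i
    using assms sorted_rev_nth_mono[of l i "Suc i"] by (auto simp: part_def is_partition_def)
  moreover have "psize (part l) = sum_list l"
  proof -
    have "psize (part l) = sum (part l) {..<length l}"
      by (rule psize_eq) (simp add: part_def)
    also have "\<dots> = (\<Sum>i<length l. l ! i)"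
      by (simp add: part_def)
    also have "\<dots> = sum_list l"
      by (simp add: sum_list_sum_nth lessThan_atLeast0)
    finally show ?thesis .
  qed
  moreover have "fin_supp (part l)"
    unfolding fin_supp_def part_def by (intro exI[of _ "length l"]) simp
  ultimately show ?thesis
    by (simp add: partitions_of_def antimono_iff_le_Suc)
qed

lemma part_nonzero_iff: "is_partition l \<Longrightarrow> part l i \<noteq> 0 \<longleftrightarrow> i < length l"
  by (auto simp: part_def is_partition_def) (metis gr0I nth_mem)

lemma part_inj: "is_partition l \<Longrightarrow> is_partition l' \<Longrightarrow> part l = part l' \<Longrightarrow> l = l'"
proof -
  assume l: "is_partition l" "is_partition l'" and eq: "part l = part l'"
  have "i < length l \<longleftrightarrow> i < length l'" for i
    using part_nonzero_iff[OF l(1), of i] part_nonzero_iff[OF l(2), of i] eq by simp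
  then have len: "length l = length l'"
    by (metis linorder_neqE_nat less_irrefl)
  show "l = l'"
  proof (rule nth_equalityI[OF len])
    fix i assume "i < length l"
    then show "l ! i = l' ! i"
      using fun_cong[OF eq, of i] len by (simp add: part_def)
  qed
qed

lemma part_surj:
  assumes "\<rho> \<in> partitions_of n"
  obtains l where "is_partition l" "part l = \<rho>"
proof -
  have am: "antimono \<rho>" and fs: "finite {i. \<rho> i \<noteq> 0}"
    using assms by (auto simp: partitions_of_def fin_supp_finite)
  define N where "N = card {i. \<rho> i \<noteq> 0}"
  have N: "{i. \<rho> i \<noteq> 0} = {..<N}"
    unfolding N_def
  proof (rule down_closed_eq_lessThan[OF fs])
    fix x y assume "x \<in> {i. \<rho> i \<noteq> 0}" "y < x"
    then show "y \<in> {i. \<rho> i \<noteq> 0}"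
      using antimonoD[OF am, of y x] by simp
  qed
  define l where "l = map \<rho> [0..<N]"
  have N': "\<rho> i \<noteq> 0 \<longleftrightarrow> i < N" for i
    using N by (metis lessThan_iff mem_Collect_eq)
  have "sorted (rev l)"
    unfolding sorted_rev_iff_nth_mono
  proof (intro allI impI)
    fix i j assume "i \<le> j" "j < length l"
    then show "l ! j \<le> l ! i"
      using antimonoD[OF am \<open>i \<le> j\<close>] by (simp add: l_def)
  qed
  moreover have "0 \<notin> set l"
  proof
    assume "0 \<in> set l"
    then obtain i where "i < N" "\<rho> i = 0"
      by (auto simp: l_def)
    then show False
      using N'[of i] by simp
  qed
  ultimately have "is_partition l"
    by (simp add: is_partition_def)
  moreover have "part l = \<rho>"
  proof
    fix i
    show "part l i = \<rho> i"
      using N'[of i] by (cases "i < N") (simp_all add: part_def l_def)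
  qed
  ultimately show thesis
    by (rule that)
qed

text \<open>The entries in \<open>ssyt\<close> carry no bound; it comes from the content, since a
  value \<open>v \<ge> N\<close> has to occur 0 times in a finite diagram.\<close>

lemma card_ssyt:
  assumes l: "is_partition l" and N: "\<And>v. v \<ge> N \<Longrightarrow> \<alpha> v = 0"
  shows "card {T. ssyt l T \<and> (\<forall>v. \<alpha> v = card {c\<in>cells l. T c = v})} = kos N \<alpha> (part l)"
proof -
  have p: "antimono (part l)" "fin_supp (part l)"
    using part_partition[OF l] by (auto simp: partitions_of_def)
  have cells: "cells l = fcells (part l)"
    by (auto simp: cells_def fcells_def part_def split: if_splits)
  have "{T. ssyt l T \<and> (\<forall>v. \<alpha> v = card {c\<in>cells l. T c = v})} = tableaux N \<alpha> (part l)"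
  proof (intro set_eqI iffI)
    fix T assume T: "T \<in> {T. ssyt l T \<and> (\<forall>v. \<alpha> v = card {c\<in>cells l. T c = v})}"
    have "T c < N" if "c \<in> fcells (part l)" for c
    proof (rule ccontr)
      assume "\<not> T c < N"
      then have "card {c'\<in>fcells (part l). T c' = T c} = 0"
        using T N[of "T c"] by (simp add: cells)
      moreover have "{c'\<in>fcells (part l). T c' = T c} \<noteq> {}"
        using that by blast
      ultimately show False
        using card_fcells(1)[OF p(2)] by (simp only: card_eq_0_iff) simp
    qed
    then show "T \<in> tableaux N \<alpha> (part l)"
      using T by (auto simp: tableaux_def ssyt_def cells)
  next
    fix T assume T: "T \<in> tableaux N \<alpha> (part l)"
    have "\<alpha> v = card {c\<in>fcells (part l). T c = v}" for v
    proof (cases "v < N")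
      case False
      then have "{c\<in>fcells (part l). T c = v} = {}"
        using T by (auto simp: tableaux_def)
      then show ?thesis
        using N[of v] False by (simp only: card.empty)
    qed (use T in \<open>auto simp: tableaux_def\<close>)
    then show "T \<in> {T. ssyt l T \<and> (\<forall>v. \<alpha> v = card {c\<in>cells l. T c = v})}"
      using T by (auto simp: tableaux_def ssyt_def cells)
  qed
  then show ?thesis
    using card_tableaux[OF p] by simp
qed

subsection \<open>Formal series in several families of variables\<close>

lemma mdeg_eq:
  assumes "finite V" "\<And>v. v \<notin> V \<Longrightarrow> m v = 0"
  shows "mdeg m = sum m V"
  unfolding mdeg_def
proof (rule sum.mono_neutral_left[OF assms(1)])
  show "msupp m \<subseteq> V"
  proof
    fix v assume "v \<in> msupp m"
    then show "v \<in> V"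
      using assms(2)[of v] by (cases "v \<in> V") (auto simp: msupp_def)
  qed
qed (simp add: msupp_def)

lemma msupp_le:
  assumes "\<And>v. a v \<le> m v"
  shows "msupp a \<subseteq> msupp m"
proof
  fix v assume "v \<in> msupp a"
  then show "v \<in> msupp m"
    using assms[of v] by (simp add: msupp_def)
qed

text \<open>Makes the Cauchy product \<open>smult\<close> a genuine sum. At monomials of infinite
  support the index set is infinite and the sum has its default value 0.\<close>

lemma finite_below:
  assumes "finite (msupp m)"
  shows "finite {a. \<forall>v. a v \<le> m v}"
proof -
  have fin: "finite {a. \<forall>v. (v \<in> msupp m \<longrightarrow> a v \<in> {..mdeg m}) \<and> (v \<notin> msupp m \<longrightarrow> a v = 0)}"
    using assms by (intro finite_set_of_finite_funs) simp_all
  have le: "m v \<le> mdeg m" if "v \<in> msupp m" for v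
    unfolding mdeg_def using assms that by (intro member_le_sum) auto
  have "{a. \<forall>v. a v \<le> m v}
      \<subseteq> {a. \<forall>v. (v \<in> msupp m \<longrightarrow> a v \<in> {..mdeg m}) \<and> (v \<notin> msupp m \<longrightarrow> a v = 0)}"
  proof (intro subsetI CollectI allI)
    fix a v assume "a \<in> {a. \<forall>v. a v \<le> m v}"
    then have "a v \<le> m v" by blast
    then show "(v \<in> msupp m \<longrightarrow> a v \<in> {..mdeg m}) \<and> (v \<notin> msupp m \<longrightarrow> a v = 0)"
      using le[of v] by (auto simp: msupp_def)
  qed
  then show ?thesis
    using fin by (rule finite_subset)
qed

lemma msupp_add: "msupp (\<lambda>v. a v + b v) = msupp a \<union> msupp b"
  by (auto simp: msupp_def)

lemma mdeg_add:
  assumes "finite (msupp a)" "finite (msupp b)"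
  shows "mdeg (\<lambda>v. a v + b v) = mdeg a + mdeg b"
proof -
  let ?V = "msupp a \<union> msupp b"
  have V: "finite ?V"
    using assms by blast
  have "mdeg a = sum a ?V" "mdeg b = sum b ?V" "mdeg (\<lambda>v. a v + b v) = (\<Sum>v\<in>?V. a v + b v)"
    by (rule mdeg_eq[OF V], simp add: msupp_def)+
  then show ?thesis
    by (simp add: sum.distrib)
qed

lemma smult_nonzeroE:
  assumes "smult f g m \<noteq> 0"
  obtains a b where "m = (\<lambda>v. a v + b v)" "f a \<noteq> 0" "g b \<noteq> 0"
proof -
  obtain a where a: "\<forall>v. a v \<le> m v" "f a * g (\<lambda>v. m v - a v) \<noteq> 0"
    using assms unfolding smult_def by (metis (mono_tags, lifting) mem_Collect_eq sum.neutral)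
  show thesis
    by (rule that[of a "\<lambda>v. m v - a v"]) (use a in auto)
qed

text \<open>Series in the variables of the families in \<open>K\<close> only. Finiteness of the
  support is included because monomials are arbitrary exponent functions.\<close>

definition supp_in :: "nat set \<Rightarrow> 'a::comm_ring_1 series \<Rightarrow> bool" where
  "supp_in K f \<longleftrightarrow> (\<forall>m. f m \<noteq> 0 \<longrightarrow> finite (msupp m) \<and> (\<forall>v\<in>msupp m. fst v \<in> K))"

lemma supp_in_mono: "supp_in K f \<Longrightarrow> K \<subseteq> K' \<Longrightarrow> supp_in K' f"
  unfolding supp_in_def by blast

lemma supp_in_sone: "supp_in K sone"
  by (auto simp: supp_in_def sone_def msupp_def)

lemma supp_in_smult:
  assumes "supp_in K f" "supp_in K g"
  shows "supp_in K (smult f g)"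
  unfolding supp_in_def
proof (intro allI impI)
  fix m assume "smult f g m \<noteq> 0"
  then obtain a b where "m = (\<lambda>v. a v + b v)" "f a \<noteq> 0" "g b \<noteq> 0"
    by (rule smult_nonzeroE)
  then show "finite (msupp m) \<and> (\<forall>v\<in>msupp m. fst v \<in> K)"
    using assms by (auto simp: supp_in_def msupp_add)
qed

lemma supp_in_sprod_list: "(\<And>f. f \<in> set fs \<Longrightarrow> supp_in K f) \<Longrightarrow> supp_in K (sprod_list fs)"
  unfolding sprod_list_def by (induction fs) (auto simp: supp_in_sone supp_in_smult)

section \<open>Products of series in disjoint families of variables\<close>

definition mrestr :: "nat set \<Rightarrow> mono \<Rightarrow> mono" where
  "mrestr K m = (\<lambda>(j, i). if j \<in> K then m (j, i) else 0)"

lemma mrestr_apply: "mrestr K m v = (if fst v \<in> K then m v else 0)"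
  by (cases v) (simp add: mrestr_def)

lemma msupp_mrestr: "msupp (mrestr K m) = {v\<in>msupp m. fst v \<in> K}"
  by (auto simp: msupp_def mrestr_apply)

lemma mrestr_id:
  assumes "\<And>v. v \<in> msupp m \<Longrightarrow> fst v \<in> K"
  shows "mrestr K m = m"
proof
  fix v show "mrestr K m v = m v"
    using assms[of v] by (cases "m v = 0") (auto simp: mrestr_apply msupp_def)
qed

lemma mrestr_mrestr: "mrestr K (mrestr K' m) = mrestr (K \<inter> K') m"
  by (auto simp: fun_eq_iff mrestr_apply)

lemma mdeg_mrestr_split:
  assumes "finite (msupp m)"
  shows "mdeg m = mdeg (mrestr K m) + mdeg (mrestr (- K) m)"
proof -
  have "mdeg (\<lambda>v. mrestr K m v + mrestr (- K) m v) = mdeg (mrestr K m) + mdeg (mrestr (- K) m)"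
    using assms by (intro mdeg_add) (simp_all add: msupp_mrestr)
  moreover have "(\<lambda>v. mrestr K m v + mrestr (- K) m v) = m"
    by (auto simp: mrestr_apply)
  ultimately show ?thesis by simp
qed

text \<open>A factor in the families \<open>K\<close> can only use the \<open>K\<close> part of a
  monomial, so the rest of the monomial is left to \<open>g2\<close>. The hypothesis on
  \<open>g\<close> is the coefficientwise form of being a product over disjoint sets of
  variables.\<close>

lemma smult_mrestr:
  assumes f: "supp_in K f" and m: "finite (msupp m)"
    and g: "\<And>b. g b = g1 (mrestr K b) * g2 (mrestr (- K) b)"
  shows "smult f g m = smult f g1 (mrestr K m) * g2 (mrestr (- K) m)"
proof -
  let ?A = "{a. \<forall>v. a v \<le> m v}" and ?B = "{a. \<forall>v. a v \<le> mrestr K m v}"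
  have fin: "finite ?A"
    using finite_below[OF m] .
  have le: "mrestr K m v \<le> m v" for v
    by (simp add: mrestr_apply)
  then have BA: "?B \<subseteq> ?A"
    by (blast intro: order_trans)
  have zero: "f a = 0" if "a \<in> ?A - ?B" for a
  proof (rule ccontr)
    assume "f a \<noteq> 0"
    then have "fst v \<in> K" if "a v \<noteq> 0" for v
      using f that unfolding supp_in_def msupp_def by blast
    moreover have "a v \<le> m v" for v
      using that by blast
    ultimately have "a v \<le> mrestr K m v" for v
      by (cases "a v = 0") (simp_all add: mrestr_apply)
    then have "a \<in> ?B" by blast
    then show False
      using that by blast
  qed
  have "smult f g m = (\<Sum>a\<in>?B. f a * g (\<lambda>v. m v - a v))"
    unfolding smult_def using fin BA zero by (intro sum.mono_neutral_right) auto
  also have "\<dots> = (\<Sum>a\<in>?B. f a * g1 (\<lambda>v. mrestr K m v - a v) * g2 (mrestr (- K) m))"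
  proof (rule sum.cong[OF refl])
    fix a assume a: "a \<in> ?B"
    have "a v = 0" if "fst v \<notin> K" for v
    proof -
      have "a v \<le> mrestr K m v"
        using a by blast
      then show ?thesis
        using that by (simp add: mrestr_apply)
    qed
    then have "mrestr K (\<lambda>v. m v - a v) = (\<lambda>v. mrestr K m v - a v)"
      "mrestr (- K) (\<lambda>v. m v - a v) = mrestr (- K) m"
      by (auto simp: mrestr_apply)
    then show "f a * g (\<lambda>v. m v - a v) = f a * g1 (\<lambda>v. mrestr K m v - a v) * g2 (mrestr (- K) m)"
      by (simp add: g)
  qed
  also have "\<dots> = smult f g1 (mrestr K m) * g2 (mrestr (- K) m)"
    by (simp add: smult_def sum_distrib_right)
  finally show ?thesis .
qed

lemma smult_sone:
  assumes "finite (msupp m)"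
  shows "smult f sone m = f m"
proof -
  have "smult f sone m = (\<Sum>a\<in>{a. \<forall>v. a v \<le> m v}. if a = m then f m else 0)"
    unfolding smult_def
  proof (rule sum.cong[OF refl])
    fix a assume a: "a \<in> {a. \<forall>v. a v \<le> m v}"
    have "(\<lambda>v. m v - a v) = (\<lambda>_. 0) \<longleftrightarrow> a = m"
    proof
      assume *: "(\<lambda>v. m v - a v) = (\<lambda>_. 0)"
      show "a = m"
      proof
        fix v
        have "a v \<le> m v" using a by blast
        then show "a v = m v"
          using fun_cong[OF *, of v] by simp
      qed
    qed simp
    then show "f a * sone (\<lambda>v. m v - a v) = (if a = m then f m else 0)"
      by (simp add: sone_def)
  qed
  also have "\<dots> = f m"
    using finite_below[OF assms] by simp
  finally show ?thesis .
qed

text \<open>The case \<open>g1 = sone\<close> of \<open>smult_mrestr\<close>: a series without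
  variables in \<open>K\<close> has zero coefficients wherever the \<open>K\<close> part is not
  trivial.\<close>

lemma smult_disjoint:
  assumes f: "supp_in K f" and g: "supp_in (- K) g" and m: "finite (msupp m)"
  shows "smult f g m = f (mrestr K m) * g (mrestr (- K) m)"
proof -
  have "g b = sone (mrestr K b) * g (mrestr (- K) b)" for b
  proof (cases "mrestr K b = (\<lambda>_. 0)")
    case True
    have "fst v \<in> - K" if "v \<in> msupp b" for v
      using that fun_cong[OF True, of v] by (simp add: mrestr_apply msupp_def split: if_splits)
    then show ?thesis
      using True by (simp add: sone_def mrestr_id)
  next
    case False
    then obtain v where "mrestr K b v \<noteq> 0" by blast
    then have "fst v \<in> K" "v \<in> msupp b"
      by (auto simp: mrestr_apply msupp_def split: if_splits)
    then have "g b = 0"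
      using g unfolding supp_in_def by blast
    then show ?thesis
      using False by (simp add: sone_def)
  qed
  from smult_mrestr[OF f m, of g sone g, OF this] show ?thesis
    using m by (simp add: smult_sone msupp_mrestr)
qed

text \<open>Coefficients factor at each step of the induction on \<open>xs\<close>, so neither
  associativity nor commutativity of \<open>smult\<close> enters.\<close>

lemma sprod_list_append_disjoint:
  assumes xs: "\<And>f. f \<in> set xs \<Longrightarrow> supp_in K f" and ys: "\<And>f. f \<in> set ys \<Longrightarrow> supp_in (- K) f"
    and m: "finite (msupp m)"
  shows "sprod_list (xs @ ys) m = sprod_list xs (mrestr K m) * sprod_list ys (mrestr (- K) m)"
  using xs m
proof (induction xs arbitrary: m)
  case Nil
  have "supp_in K (sone :: 'a series)" "supp_in (- K) (sprod_list ys)"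
    using supp_in_sone ys supp_in_sprod_list by blast+
  moreover have "smult sone g m = g m" if "supp_in (- K) g" for g :: "'a series"
  proof -
    have "smult sone g m = (\<Sum>a\<in>{\<lambda>_. 0}. sone a * g (\<lambda>v. m v - a v))"
      unfolding smult_def using finite_below[OF Nil(2)]
      by (intro sum.mono_neutral_right) (auto simp: sone_def)
    then show ?thesis
      by (simp add: sone_def)
  qed
  ultimately show ?case
    using smult_disjoint[of K sone "sprod_list ys" m] Nil(2) by (simp add: sprod_list_def)
next
  case (Cons f xs)
  show ?case
  proof -
    have eq: "sprod_list (xs @ ys) b = sprod_list xs (mrestr K b) * sprod_list ys (mrestr (- K) b)"
      if "finite (msupp b)" for b
      using Cons.IH[of b] Cons.prems that by simp
    have supp: "supp_in K (sprod_list xs)" "supp_in (- K) (sprod_list ys)"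
      using Cons.prems ys by (auto intro!: supp_in_sprod_list)
    have "supp_in UNIV f" if "f \<in> set (xs @ ys)" for f
      using that Cons.prems(1)[of f] ys[of f] supp_in_mono[of _ f UNIV] by auto
    then have supp3: "supp_in UNIV (sprod_list (xs @ ys))"
      by (rule supp_in_sprod_list)
    \<comment> \<open>\<open>smult_mrestr\<close> asks for the factorization at every exponent
      function. At infinite support both sides vanish, because one of the two restrictions has
      infinite support as well.\<close>
    have "sprod_list (xs @ ys) b = sprod_list xs (mrestr K b) * sprod_list ys (mrestr (- K) b)" for b
    proof (cases "finite (msupp b)")
      case False
      have "msupp b = msupp (mrestr K b) \<union> msupp (mrestr (- K) b)"
        by (auto simp: msupp_mrestr)
      then have "\<not> finite (msupp (mrestr K b)) \<or> \<not> finite (msupp (mrestr (- K) b))"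
        using False by simp
      then have "sprod_list xs (mrestr K b) = 0 \<or> sprod_list ys (mrestr (- K) b) = 0"
        using supp(1,2) unfolding supp_in_def by blast
      moreover have "sprod_list (xs @ ys) b = 0"
        using supp3 False unfolding supp_in_def by blast
      ultimately show ?thesis
        by auto
    qed (rule eq)
    then show ?thesis
      using smult_mrestr[of K f m "sprod_list (xs @ ys)" "sprod_list xs" "sprod_list ys"] Cons.prems
      by (simp add: sprod_list_def)
  qed
qed

text \<open>Reduces Schur functions, and the functions q at the origin, to computations in a single
  family.\<close>

lemma sprod_list_concat_disjoint:
  assumes "distinct ks" and "\<And>k f. k \<in> set ks \<Longrightarrow> f \<in> set (g k) \<Longrightarrow> supp_in {k} f"
    and "finite (msupp m)" and "\<And>v. v \<in> msupp m \<Longrightarrow> fst v \<in> set ks"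
  shows "sprod_list (concat (map g ks)) m = (\<Prod>k\<in>set ks. sprod_list (g k) (mrestr {k} m))"
  using assms
proof (induction ks arbitrary: m)
  case Nil
  have "m v = 0" for v
    using Nil.prems(4)[of v] by (auto simp: msupp_def)
  then have "m = (\<lambda>_. 0)" ..
  then show ?case
    by (simp add: sprod_list_def sone_def)
next
  case (Cons k ks)
  have k: "k \<notin> set ks" using Cons.prems(1) by simp
  have "sprod_list (g k @ concat (map g ks)) m
      = sprod_list (g k) (mrestr {k} m) * sprod_list (concat (map g ks)) (mrestr (- {k}) m)"
  proof (rule sprod_list_append_disjoint)
    show "supp_in {k} f" if "f \<in> set (g k)" for f
      using Cons.prems(2)[of k f] that by simp
    show "supp_in (- {k}) f" if f: "f \<in> set (concat (map g ks))" for f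
    proof -
      obtain k' where k': "k' \<in> set ks" "f \<in> set (g k')"
        using f by auto
      then have "supp_in {k'} f" "{k'} \<subseteq> - {k}"
        using Cons.prems(2)[of k' f] k by auto
      then show ?thesis
        by (rule supp_in_mono)
    qed
  qed (rule Cons.prems(3))
  also have "sprod_list (concat (map g ks)) (mrestr (- {k}) m)
      = (\<Prod>k'\<in>set ks. sprod_list (g k') (mrestr {k'} (mrestr (- {k}) m)))"
    using Cons.prems by (intro Cons.IH) (auto simp: msupp_mrestr)
  also have "\<dots> = (\<Prod>k'\<in>set ks. sprod_list (g k') (mrestr {k'} m))"
  proof (rule prod.cong[OF refl])
    fix k' assume "k' \<in> set ks"
    then have "{k'} \<inter> - {k} = {k'}" using k by auto
    then show "sprod_list (g k') (mrestr {k'} (mrestr (- {k}) m)) = sprod_list (g k') (mrestr {k'} m)"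
      by (simp add: mrestr_mrestr)
  qed
  finally show ?case
    using k by simp
qed

subsection \<open>Symmetric series\<close>

text \<open>The permutation of variables behind the symmetry condition in \<open>Xi\<close>. As a
  map on index pairs it turns that condition into invariance under composition, to which general
  facts about bijections apply.\<close>

definition famperm :: "nat \<Rightarrow> (nat \<Rightarrow> nat) \<Rightarrow> nat \<times> nat \<Rightarrow> nat \<times> nat" where
  "famperm k \<sigma> = (\<lambda>(j, i). (j, if j = k then \<sigma> i else i))"

lemma fst_famperm: "fst (famperm k \<sigma> v) = fst v"
  by (simp add: famperm_def split: prod.split)

lemma bij_famperm:
  assumes "bij \<sigma>"
  shows "bij (famperm k \<sigma>)"
proof (rule o_bij[where g = "famperm k (inv \<sigma>)"])
  have inv: "\<sigma> (inv \<sigma> i) = i" "inv \<sigma> (\<sigma> i) = i" for i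
    using assms by (simp_all add: bij_is_surj surj_f_inv_f bij_is_inj)
  show "famperm k (inv \<sigma>) \<circ> famperm k \<sigma> = id" "famperm k \<sigma> \<circ> famperm k (inv \<sigma>) = id"
    by (auto simp: famperm_def inv)
qed

lemma Xi_iff:
  "F \<in> Xi r n C \<longleftrightarrow> (\<forall>m. F m \<in> C)
     \<and> (\<forall>m. F m \<noteq> 0 \<longrightarrow> finite (msupp m) \<and> mdeg m = n \<and> (\<forall>v\<in>msupp m. fst v \<in> {1..r}))
     \<and> (\<forall>k \<sigma> m. bij \<sigma> \<longrightarrow> F (m \<circ> famperm k \<sigma>) = F m)"
proof -
  have "(\<lambda>(j,i). if j = k then m (j, \<sigma> i) else m (j, i)) = m \<circ> famperm k \<sigma>" for m :: mono and k \<sigma>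
    by (auto simp: famperm_def)
  then show ?thesis
    unfolding Xi_def case_prod_beta' by simp
qed

lemma bij_betw_msupp:
  assumes "bij \<tau>"
  shows "bij_betw \<tau> (msupp (m \<circ> \<tau>)) (msupp m)"
proof -
  have "\<tau> ` msupp (m \<circ> \<tau>) = msupp m"
  proof (intro set_eqI iffI)
    fix v assume "v \<in> msupp m"
    moreover obtain u where "v = \<tau> u"
      using assms by (metis bij_pointE)
    ultimately show "v \<in> \<tau> ` msupp (m \<circ> \<tau>)"
      by (simp add: msupp_def)
  qed (auto simp: msupp_def)
  then show ?thesis
    using assms by (simp add: bij_betw_def inj_on_subset[OF bij_is_inj])
qed

lemma finite_msupp_bij: "bij \<tau> \<Longrightarrow> finite (msupp (m \<circ> \<tau>)) \<longleftrightarrow> finite (msupp m)"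
  using bij_betw_finite[OF bij_betw_msupp] .

lemma mdeg_bij: "bij \<tau> \<Longrightarrow> mdeg (m \<circ> \<tau>) = mdeg m"
  unfolding mdeg_def using sum.reindex_bij_betw[OF bij_betw_msupp, of \<tau> m m] by simp

lemma msupp_fst_bij:
  assumes "bij \<sigma>"
  shows "(\<forall>v\<in>msupp (m \<circ> famperm k \<sigma>). P (fst v)) \<longleftrightarrow> (\<forall>v\<in>msupp m. P (fst v))"
proof -
  have "fst ` msupp m = fst ` famperm k \<sigma> ` msupp (m \<circ> famperm k \<sigma>)"
    using bij_betw_imp_surj_on[OF bij_betw_msupp[OF bij_famperm[OF assms]]] by metis
  also have "\<dots> = fst ` msupp (m \<circ> famperm k \<sigma>)"
    by (simp add: image_image fst_famperm)
  finally show ?thesis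
    by (metis (mono_tags, lifting) image_iff)
qed

lemma Xi_nonzeroD:
  assumes "F \<in> Xi r n C" "F m \<noteq> 0"
  shows "finite (msupp m)" "mdeg m = n" "v \<in> msupp m \<Longrightarrow> fst v \<in> {1..r}"
  using assms unfolding Xi_iff by blast+

lemma Xi_perm: "F \<in> Xi r n C \<Longrightarrow> bij \<sigma> \<Longrightarrow> F (m \<circ> famperm k \<sigma>) = F m"
  unfolding Xi_iff by blast

lemma Xi_UNIV_I:
  assumes "\<And>m. F m \<noteq> 0 \<Longrightarrow> finite (msupp m) \<and> mdeg m = n \<and> (\<forall>v\<in>msupp m. fst v \<in> {1..r})"
    and "\<And>k \<sigma> m. bij \<sigma> \<Longrightarrow> F (m \<circ> famperm k \<sigma>) = F m"
  shows "F \<in> Xi r n UNIV"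
  using assms unfolding Xi_iff by simp

lemma Xi_smult:
  assumes F: "F \<in> Xi r a UNIV" and G: "G \<in> Xi r b UNIV"
  shows "smult F G \<in> Xi r (a + b) UNIV"
proof (rule Xi_UNIV_I)
  fix m assume "smult F G m \<noteq> 0"
  then obtain c d where m: "m = (\<lambda>v. c v + d v)" and "F c \<noteq> 0" "G d \<noteq> 0"
    by (rule smult_nonzeroE)
  then show "finite (msupp m) \<and> mdeg m = a + b \<and> (\<forall>v\<in>msupp m. fst v \<in> {1..r})"
    using Xi_nonzeroD[OF F \<open>F c \<noteq> 0\<close>] Xi_nonzeroD[OF G \<open>G d \<noteq> 0\<close>]
    by (auto simp: msupp_add mdeg_add m)
next
  fix k \<sigma> and m :: mono assume \<sigma>: "bij (\<sigma> :: nat \<Rightarrow> nat)"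
  define \<tau> where "\<tau> = famperm k \<sigma>"
  have \<tau>: "bij \<tau>" using bij_famperm[OF \<sigma>] by (simp add: \<tau>_def)
  have inv: "\<tau> (inv \<tau> v) = v" "inv \<tau> (\<tau> v) = v" for v
    using \<tau> by (simp_all add: bij_is_surj surj_f_inv_f bij_is_inj)
  have perm: "F (c \<circ> \<tau>) = F c" "G (c \<circ> \<tau>) = G c" for c
    using Xi_perm[OF F \<sigma>] Xi_perm[OF G \<sigma>] by (simp_all add: \<tau>_def)
  show "smult F G (m \<circ> famperm k \<sigma>) = smult F G m"
    unfolding smult_def \<tau>_def[symmetric]
  proof (rule sum.reindex_bij_witness[where i = "\<lambda>c. c \<circ> \<tau>" and j = "\<lambda>c. c \<circ> inv \<tau>"])
    fix c assume c: "c \<in> {c. \<forall>v. c v \<le> (m \<circ> \<tau>) v}"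
    show "(c \<circ> inv \<tau>) \<circ> \<tau> = c"
      by (simp add: fun_eq_iff inv del: split_paired_All)
    have "(c \<circ> inv \<tau>) v \<le> m v" for v
    proof -
      have "c (inv \<tau> v) \<le> (m \<circ> \<tau>) (inv \<tau> v)" using c by blast
      then show ?thesis by (simp add: inv)
    qed
    then show "c \<circ> inv \<tau> \<in> {c. \<forall>v. c v \<le> m v}" by blast
    have "F (c \<circ> inv \<tau>) = F c"
      using perm(1)[of "c \<circ> inv \<tau>"] \<open>(c \<circ> inv \<tau>) \<circ> \<tau> = c\<close> by simp
    moreover have "(\<lambda>v. m v - (c \<circ> inv \<tau>) v) \<circ> \<tau> = (\<lambda>v. (m \<circ> \<tau>) v - c v)"
      by (simp add: fun_eq_iff inv del: split_paired_All)
    then have "G (\<lambda>v. m v - (c \<circ> inv \<tau>) v) = G (\<lambda>v. (m \<circ> \<tau>) v - c v)"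
      using perm(2)[of "\<lambda>v. m v - (c \<circ> inv \<tau>) v"] by simp
    ultimately show "F (c \<circ> inv \<tau>) * G (\<lambda>v. m v - (c \<circ> inv \<tau>) v) = F c * G (\<lambda>v. (m \<circ> \<tau>) v - c v)"
      by simp
  next
    fix c assume c: "c \<in> {c. \<forall>v. c v \<le> m v}"
    show "(c \<circ> \<tau>) \<circ> inv \<tau> = c"
      by (simp add: fun_eq_iff inv del: split_paired_All)
    show "c \<circ> \<tau> \<in> {c. \<forall>v. c v \<le> (m \<circ> \<tau>) v}"
      using c by (simp del: split_paired_All)
  qed
qed

lemma Xi_sone: "sone \<in> Xi r 0 UNIV"
proof (rule Xi_UNIV_I)
  fix k \<sigma> and m :: mono assume \<sigma>: "bij (\<sigma> :: nat \<Rightarrow> nat)"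
  have "m \<circ> famperm k \<sigma> = (\<lambda>_. 0) \<longleftrightarrow> m = (\<lambda>_. 0)"
  proof
    assume *: "m \<circ> famperm k \<sigma> = (\<lambda>_. 0)"
    show "m = (\<lambda>_. 0)"
    proof
      fix v
      obtain u where "v = famperm k \<sigma> u"
        using bij_famperm[OF \<sigma>] by (metis bij_pointE)
      then show "m v = 0"
        using fun_cong[OF *, of u] by simp
    qed
  qed auto
  then show "sone (m \<circ> famperm k \<sigma>) = sone m"
    by (simp add: sone_def)
qed (auto simp: sone_def msupp_def mdeg_def split: if_splits)

lemma Xi_sprod_list:
  "(\<And>x. x \<in> set xs \<Longrightarrow> f x \<in> Xi r (d x) UNIV)
    \<Longrightarrow> sprod_list (map f xs) \<in> Xi r (sum_list (map d xs)) UNIV"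
  unfolding sprod_list_def by (induction xs) (auto simp: Xi_sone Xi_smult)

lemma Xi_lincomb:
  assumes B: "\<And>x. x \<in> S \<Longrightarrow> B x \<in> Xi r n UNIV"
  shows "lincomb S a B \<in> Xi r n UNIV"
proof (rule Xi_UNIV_I)
  fix m assume "lincomb S a B m \<noteq> 0"
  then obtain x where "x \<in> S" "a x * B x m \<noteq> 0"
    unfolding lincomb_def by (meson sum.neutral)
  then have "B x \<in> Xi r n UNIV" "B x m \<noteq> 0"
    using B by auto
  then show "finite (msupp m) \<and> mdeg m = n \<and> (\<forall>v\<in>msupp m. fst v \<in> {1..r})"
    unfolding Xi_iff by blast
next
  fix k \<sigma> and m :: mono assume \<sigma>: "bij (\<sigma> :: nat \<Rightarrow> nat)"
  show "lincomb S a B (m \<circ> famperm k \<sigma>) = lincomb S a B m"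
    unfolding lincomb_def using Xi_perm[OF B \<sigma>] by simp
qed

section \<open>Symmetry and homogeneity of the complete, elementary, q and Schur functions\<close>

lemma ball_msupp_case: "(\<forall>(j,i)\<in>msupp m. P j) \<longleftrightarrow> (\<forall>v\<in>msupp m. P (fst v))"
  by auto

lemma Xi_hfam: "k \<in> {1..r} \<Longrightarrow> hfam k a \<in> Xi r a UNIV"
  unfolding hfam_def ball_msupp_case
  by (rule Xi_UNIV_I)
    (simp_all del: split_paired_All split_paired_Ex add: finite_msupp_bij[OF bij_famperm]
      mdeg_bij[OF bij_famperm] msupp_fst_bij[where P = "\<lambda>x. x = k"] split: if_splits)

lemma Xi_efam:
  assumes "k \<in> {1..r}"
  shows "efam k a \<in> Xi r a UNIV"
  unfolding efam_def ball_msupp_case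
proof (rule Xi_UNIV_I)
  fix j \<sigma> and m :: mono assume \<sigma>: "bij (\<sigma> :: nat \<Rightarrow> nat)"
  have "(\<forall>v. (m \<circ> famperm j \<sigma>) v \<le> 1) \<longleftrightarrow> (\<forall>v. m v \<le> 1)"
  proof (intro iffI allI)
    fix v assume *: "\<forall>v. (m \<circ> famperm j \<sigma>) v \<le> 1"
    obtain u where "v = famperm j \<sigma> u"
      using bij_famperm[OF \<sigma>] by (metis bij_pointE)
    moreover have "(m \<circ> famperm j \<sigma>) u \<le> 1" using * by blast
    ultimately show "m v \<le> 1" by simp
  qed (auto simp del: split_paired_All)
  then show "(if finite (msupp (m \<circ> famperm j \<sigma>)) \<and> (\<forall>v\<in>msupp (m \<circ> famperm j \<sigma>). fst v = k) \<and>
          (\<forall>v. (m \<circ> famperm j \<sigma>) v \<le> 1) \<and> mdeg (m \<circ> famperm j \<sigma>) = a then 1 else 0) =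
       (if finite (msupp m) \<and> (\<forall>v\<in>msupp m. fst v = k) \<and> (\<forall>v. m v \<le> 1) \<and> mdeg m = a then 1 else 0)"
    using \<sigma> by (simp only: finite_msupp_bij[OF bij_famperm] mdeg_bij[OF bij_famperm]
        msupp_fst_bij[where P = "\<lambda>x. x = k"])
qed (use assms in \<open>simp split: if_splits\<close>)

lemma Xi_qfun:
  assumes "k \<in> {1..r}" "j \<in> {1..r}"
  shows "qfun k j t s \<in> Xi r s UNIV"
proof -
  have "qfun k j t s = lincomb {..s} (\<lambda>b. (- t) ^ b) (\<lambda>b. smult (hfam k (s - b)) (efam j b))"
    by (simp add: qfun_def lincomb_def)
  also have "\<dots> \<in> Xi r s UNIV"
  proof (rule Xi_lincomb)
    fix b assume "b \<in> {..s}"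
    then show "smult (hfam k (s - b)) (efam j b) \<in> Xi r s (UNIV :: ratfun set)"
      using Xi_smult[OF Xi_hfam[OF assms(1), of "s - b"] Xi_efam[OF assms(2), of b]] by simp
  qed
  finally show ?thesis .
qed

lemma umod_range: "r \<ge> 1 \<Longrightarrow> umod r k \<in> {1..r}"
proof -
  assume "r \<ge> 1"
  then have "0 \<le> (k - 1) mod int r" "(k - 1) mod int r < int r"
    by simp_all
  then show ?thesis
    by (simp add: umod_def)
qed

lemma Xi_qsingle:
  assumes "k \<in> {1..r}"
  shows "qsingle r eps k s \<in> Xi r s UNIV"
proof -
  have "r \<ge> 1" using assms by simp
  then show ?thesis
    unfolding qsingle_def using Xi_qfun[OF assms] umod_range by simp
qed

lemma schur1_eq:
  assumes "is_partition l" "finite (msupp m)" "\<And>v. v \<in> msupp m \<Longrightarrow> fst v = k"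
    and "\<And>v. v \<ge> N \<Longrightarrow> m (k, v) = 0"
  shows "schur1 k l m = of_nat (kos N (\<lambda>v. m (k, v)) (part l))"
  unfolding schur1_def ball_msupp_case using assms(2,3) card_ssyt[OF assms(1), of N "\<lambda>v. m (k, v)"] assms(4)
  by simp

lemma finite_msupp_bound:
  assumes "finite (msupp m)"
  obtains N where "\<And>v. v \<ge> N \<Longrightarrow> m (k, v) = 0"
proof -
  have "{i. m (k, i) \<noteq> 0} \<subseteq> snd ` msupp m"
    by (force simp: msupp_def)
  then have "finite {i. m (k, i) \<noteq> 0}"
    using assms finite_subset by blast
  then have "fin_supp (\<lambda>i. m (k, i))"
    by (simp add: fin_supp_finite)
  then show thesis
    using that unfolding fin_supp_def by blast
qed

lemma mdeg_single_family:
  assumes "\<And>v. v \<in> msupp m \<Longrightarrow> fst v = k" and N: "\<And>i. i \<ge> N \<Longrightarrow> m (k, i) = 0"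
  shows "mdeg m = (\<Sum>i<N. m (k, i))"
proof -
  have "mdeg m = sum m (Pair k ` {..<N})"
  proof (rule mdeg_eq)
    fix v assume "v \<notin> Pair k ` {..<N}"
    then show "m v = 0"
      using assms(1)[of v] N[of "snd v"] by (cases v) (force simp: msupp_def)
  qed simp
  then show ?thesis
    by (simp add: sum.reindex inj_on_def)
qed

text \<open>Symmetry of the tableau sum is \<open>kos_bij\<close>; homogeneity is the size clause of
  \<open>kos_nonzeroD\<close>.\<close>

lemma Xi_schur1:
  assumes l: "is_partition l" and k: "k \<in> {1..r}"
  shows "schur1 k l \<in> Xi r (sum_list l) UNIV"
proof (rule Xi_UNIV_I)
  fix m assume nz: "schur1 k l m \<noteq> (0 :: 'a)"
  then have fin: "finite (msupp m)" and fam: "\<And>v. v \<in> msupp m \<Longrightarrow> fst v = k"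
    unfolding schur1_def ball_msupp_case by (auto split: if_splits)
  obtain N where N: "\<And>v. v \<ge> N \<Longrightarrow> m (k, v) = 0"
    using finite_msupp_bound[OF fin] by blast
  have "of_nat (kos N (\<lambda>v. m (k, v)) (part l)) \<noteq> (0 :: 'a)"
    using nz schur1_eq[where 'a = 'a, OF l fin fam N] by simp
  then have "kos N (\<lambda>v. m (k, v)) (part l) \<noteq> 0"
    by (metis of_nat_0)
  then have "psize (part l) = (\<Sum>v<N. m (k, v))"
    using kos_nonzeroD by blast
  then have "mdeg m = sum_list l"
    using mdeg_single_family[of m k N] fam N part_partition[OF l] by (simp add: partitions_of_def)
  then show "finite (msupp m) \<and> mdeg m = sum_list l \<and> (\<forall>v\<in>msupp m. fst v \<in> {1..r})"
    using fin fam k by (simp del: split_paired_All)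
next
  fix j \<sigma> and m :: mono assume \<sigma>: "bij (\<sigma> :: nat \<Rightarrow> nat)"
  let ?m = "m \<circ> famperm j \<sigma>"
  have eq: "finite (msupp ?m) \<longleftrightarrow> finite (msupp m)"
    "(\<forall>v\<in>msupp ?m. fst v = k) \<longleftrightarrow> (\<forall>v\<in>msupp m. fst v = k)"
    by (rule finite_msupp_bij[OF bij_famperm[OF \<sigma>]], rule msupp_fst_bij[OF \<sigma>, where P = "\<lambda>x. x = k"])
  show "schur1 k l ?m = (schur1 k l m :: 'a)"
  proof (cases "finite (msupp m) \<and> (\<forall>v\<in>msupp m. fst v = k)")
    case False
    then have "\<not> (finite (msupp ?m) \<and> (\<forall>v\<in>msupp ?m. fst v = k))"
      using eq by blast
    with False show ?thesis
      unfolding schur1_def ball_msupp_case by (simp only: if_False)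
  next
    case True
    then have fin: "finite (msupp m)" "finite (msupp ?m)"
      and fam: "\<And>v. v \<in> msupp m \<Longrightarrow> fst v = k" "\<And>v. v \<in> msupp ?m \<Longrightarrow> fst v = k"
      using eq by blast+
    obtain N where N: "\<And>v. v \<ge> N \<Longrightarrow> m (k, v) = 0"
      using finite_msupp_bound[OF fin(1)] by blast
    obtain N' where N': "\<And>v. v \<ge> N' \<Longrightarrow> ?m (k, v) = 0"
      using finite_msupp_bound[OF fin(2)] by blast
    define \<sigma>' where "\<sigma>' = (if j = k then \<sigma> else id)"
    have \<sigma>': "bij \<sigma>'" "?m (k, v) = m (k, \<sigma>' v)" for v
      using \<sigma> by (auto simp: \<sigma>'_def famperm_def)
    have "kos N' (\<lambda>v. m (k, \<sigma>' v)) (part l) = kos N (\<lambda>v. m (k, v)) (part l)"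
      using kos_bij[OF \<sigma>'(1) part_partition[OF l], of N "\<lambda>v. m (k, v)" N'] N N' \<sigma>'(2) by simp
    moreover have "schur1 k l m = (of_nat (kos N (\<lambda>v. m (k, v)) (part l)) :: 'a)"
      by (rule schur1_eq[OF l fin(1) fam(1) N])
    moreover have "schur1 k l ?m = (of_nat (kos N' (\<lambda>v. ?m (k, v)) (part l)) :: 'a)"
      by (rule schur1_eq[OF l fin(2) fam(2) N'])
    ultimately show ?thesis
      unfolding \<sigma>'(2) by simp
  qed
qed

lemma Xi_schur:
  assumes "L \<in> Pnr n r"
  shows "schur r L \<in> Xi r n UNIV"
proof -
  have "schur r L \<in> Xi r (sum_list (map (\<lambda>k. sum_list (L k)) [1..<Suc r])) UNIV"
    unfolding schur_def using assms by (intro Xi_sprod_list Xi_schur1) (auto simp: Pnr_def)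
  also have "sum_list (map (\<lambda>k. sum_list (L k)) [1..<Suc r]) = n"
    using assms by (simp add: Pnr_def sum_set_upt_conv_sum_list_nat[symmetric] atLeastLessThanSuc_atLeastAtMost
        del: upt_Suc)
  finally show ?thesis .
qed

text \<open>The rows of a multipartition as index pairs. This list enumerates the support of
  \<open>rep L\<close>, so factors of a product and variables of a monomial are indexed alike and
  can later be exchanged.\<close>

definition rows :: "nat \<Rightarrow> multipart \<Rightarrow> (nat \<times> nat) list" where
  "rows r L = concat (map (\<lambda>k. map (Pair k) [0..<length (L k)]) [1..<Suc r])"

lemma qmulti_rows: "qmulti r eps L = sprod_list (map (\<lambda>(k,i). qsingle r eps k (L k ! i)) (rows r L))"
proof -
  have "map (qsingle r eps k) (L k) = map (\<lambda>(k,i). qsingle r eps k (L k ! i)) (map (Pair k) [0..<length (L k)])" for k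
    by (rule nth_equalityI) simp_all
  then show ?thesis
    unfolding qmulti_def rows_def map_concat map_map comp_def by simp
qed

lemma sum_list_rows: "sum_list (map (\<lambda>(k,i). L k ! i) (rows r L)) = (\<Sum>k=1..r. sum_list (L k))"
proof -
  have sum_concat: "sum_list (concat (map L ks)) = sum_list (map (\<lambda>k. sum_list (L k)) ks)" for ks
    by (induction ks) simp_all
  have "map (\<lambda>i. L k ! i) [0..<length (L k)] = L k" for k
    by (rule map_nth)
  then have "sum_list (map (\<lambda>(k,i). L k ! i) (rows r L)) = sum_list (concat (map L [1..<Suc r]))"
    unfolding rows_def map_concat map_map comp_def by simp
  also have "\<dots> = sum_list (map (\<lambda>k. sum_list (L k)) [1..<Suc r])"
    by (rule sum_concat)
  also have "\<dots> = (\<Sum>k=1..r. sum_list (L k))"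
    by (simp add: sum_set_upt_conv_sum_list_nat[symmetric] atLeastLessThanSuc_atLeastAtMost del: upt_Suc)
  finally show ?thesis .
qed

lemma Xi_qmulti:
  assumes "L \<in> Pnr n r"
  shows "qmulti r eps L \<in> Xi r n UNIV"
proof -
  have "qmulti r eps L \<in> Xi r (sum_list (map (\<lambda>(k,i). L k ! i) (rows r L))) UNIV"
    unfolding qmulti_rows by (rule Xi_sprod_list) (auto simp: rows_def intro!: Xi_qsingle)
  then show ?thesis
    using assms by (simp add: sum_list_rows Pnr_def)
qed

subsection \<open>The basis of monomial symmetric functions\<close>

text \<open>The monomial in which variable \<open>i\<close> of family \<open>k\<close> has the
  \<open>i\<close>-th part of \<open>M k\<close> as exponent. Evaluating a symmetric series there
  reads off its coordinate at \<open>monsym r M\<close>.\<close>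

definition rep :: "multipart \<Rightarrow> mono" where
  "rep M = (\<lambda>(k, i). part (M k) i)"

lemma rep_apply: "rep M (k, i) = part (M k) i"
  by (simp add: rep_def)

lemma Pnr_partition: "M \<in> Pnr n r \<Longrightarrow> is_partition (M k)"
  by (cases "k \<in> {1..r}") (auto simp: Pnr_def is_partition_def)

lemma msupp_rep:
  assumes "M \<in> Pnr n r"
  shows "msupp (rep M) = (SIGMA k:{1..r}. {..<length (M k)})"
proof -
  have "k \<in> {1..r}" if "i < length (M k)" for k i
    using assms that by (cases "k \<in> {1..r}") (auto simp: Pnr_def)
  then show ?thesis
    using part_nonzero_iff[OF Pnr_partition[OF assms]] by (auto simp: msupp_def rep_apply)
qed

lemma finite_msupp_rep: "M \<in> Pnr n r \<Longrightarrow> finite (msupp (rep M))"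
  by (simp add: msupp_rep)

lemma fst_msupp_rep: "M \<in> Pnr n r \<Longrightarrow> v \<in> msupp (rep M) \<Longrightarrow> fst v \<in> {1..r}"
  by (auto simp: msupp_rep)

section \<open>Exponent multisets and orbits of monomials\<close>

definition fexp :: "(nat \<Rightarrow> nat) \<Rightarrow> nat multiset" where
  "fexp f = image_mset f (mset_set {i. f i \<noteq> 0})"

lemma fam_exps_eq: "fam_exps m k = fexp (\<lambda>i. m (k, i))"
  by (simp add: fam_exps_def fexp_def)

lemma fexp_bij:
  assumes "bij \<sigma>"
  shows "fexp (\<lambda>i. f (\<sigma> i)) = fexp f"
proof -
  have "bij_betw \<sigma> {i. f (\<sigma> i) \<noteq> 0} {i. f i \<noteq> 0}"
    by (rule bij_betw_byWitness[where f' = "inv \<sigma>"])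
      (use assms in \<open>auto simp: bij_is_inj bij_is_surj surj_f_inv_f\<close>)
  then have e: "image_mset \<sigma> (mset_set {i. f (\<sigma> i) \<noteq> 0}) = mset_set {i. f i \<noteq> 0}"
    using image_mset_mset_set[of \<sigma> "{i. f (\<sigma> i) \<noteq> 0}"] unfolding bij_betw_def by metis
  show ?thesis
    unfolding fexp_def e[symmetric] image_mset.compositionality comp_def ..
qed

lemma fexp_part:
  assumes "is_partition l"
  shows "fexp (part l) = mset l"
proof -
  have "{i. part l i \<noteq> 0} = {0..<length l}"
    using part_nonzero_iff[OF assms] by (simp only: set_eq_iff mem_Collect_eq) simp
  then have "fexp (part l) = image_mset (part l) (mset [0..<length l])"
    by (simp add: fexp_def)
  also have "\<dots> = mset (map (part l) [0..<length l])"
    by simp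
  also have "map (part l) [0..<length l] = l"
    by (rule nth_equalityI) (simp_all add: part_def)
  finally show ?thesis .
qed

lemma mset_map_upt_fexp:
  assumes "\<And>i. i \<ge> N \<Longrightarrow> f i = 0"
  shows "mset (map f [0..<N]) = fexp f + replicate_mset (N - size (fexp f)) 0"
proof -
  let ?A = "{i. f i \<noteq> 0}"
  have A: "?A \<subseteq> {0..<N}"
  proof
    fix i assume "i \<in> ?A"
    then show "i \<in> {0..<N}"
      using assms[of i] by (cases "i < N") auto
  qed
  then have fin: "finite ?A"
    using finite_subset by blast
  have "mset_set {0..<N} = mset_set ?A + mset_set ({0..<N} - ?A)"
    using A mset_set_Union[of ?A "{0..<N} - ?A"] fin by (simp add: Un_absorb1)
  then have "mset (map f [0..<N]) = fexp f + image_mset f (mset_set ({0..<N} - ?A))"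
    by (simp add: fexp_def)
  also have "image_mset f (mset_set ({0..<N} - ?A)) = image_mset (\<lambda>_. 0) (mset_set ({0..<N} - ?A))"
    by (intro image_mset_cong) simp
  also have "\<dots> = replicate_mset (card ({0..<N} - ?A)) 0"
    by (simp add: image_mset_const_eq)
  also have "card ({0..<N} - ?A) = N - size (fexp f)"
    using A fin by (simp add: card_Diff_subset fexp_def)
  finally show ?thesis .
qed

text \<open>Pad both functions with zeros to a common length \<open>N\<close>. Lists with equal
  multisets differ by a permutation of their positions, which is the identity from \<open>N\<close>
  on.\<close>

lemma fexp_eq_imp_bij:
  assumes "fin_supp f" "fin_supp g" "fexp f = fexp g"
  obtains \<sigma> where "bij \<sigma>" "g = (\<lambda>i. f (\<sigma> i))"
proof -
  obtain B1 where B1: "\<And>i. i \<ge> B1 \<Longrightarrow> f i = 0" using assms(1) by (auto simp: fin_supp_def)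
  obtain B2 where B2: "\<And>i. i \<ge> B2 \<Longrightarrow> g i = 0" using assms(2) by (auto simp: fin_supp_def)
  define N where "N = max B1 B2"
  have N: "\<And>i. i \<ge> N \<Longrightarrow> f i = 0" "\<And>i. i \<ge> N \<Longrightarrow> g i = 0"
    using B1 B2 by (simp_all add: N_def)
  have "mset (map g [0..<N]) = mset (map f [0..<N])"
    using mset_map_upt_fexp[of N f] mset_map_upt_fexp[of N g] N assms(3) by simp
  then obtain p where p: "p permutes {..<length (map f [0..<N])}"
      "permute_list p (map f [0..<N]) = map g [0..<N]"
    by (rule mset_eq_permutation)
  have "g i = f (p i)" for i
  proof (cases "i < N")
    case True
    then have "p i < N"
      using permutes_in_image[OF p(1), of i] by simp
    have "map g [0..<N] ! i = map f [0..<N] ! p i"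
      using permute_list_nth[OF p(1), of i] p(2) True by simp
    then show ?thesis
      using True \<open>p i < N\<close> by simp
  next
    case False
    then have "p i = i"
      using permutes_not_in[OF p(1), of i] by simp
    then show ?thesis
      using N[of i] False by simp
  qed
  then show thesis
    using that[of p] permutes_bij[OF p(1)] by blast
qed

lemma fin_supp_family:
  assumes "finite (msupp m)"
  shows "fin_supp (\<lambda>i. m (k, i))"
proof -
  have "{i. m (k, i) \<noteq> 0} \<subseteq> snd ` msupp m"
    by (force simp: msupp_def)
  then show ?thesis
    using assms finite_subset unfolding fin_supp_finite by blast
qed

text \<open>Passes from \<open>m\<close> to \<open>m'\<close> one family at a time: the hybrid
  \<open>h j\<close> follows \<open>m'\<close> in families up to \<open>j\<close> and
  \<open>m\<close> in the others, and \<open>h (Suc j)\<close> arises from \<open>h j\<close> by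
  permuting a single family.\<close>

lemma Xi_eq_of_fam_exps:
  assumes F: "F \<in> Xi r n UNIV"
    and m: "finite (msupp m)" "\<And>v. v \<in> msupp m \<Longrightarrow> fst v \<in> {1..r}"
    and m': "finite (msupp m')" "\<And>v. v \<in> msupp m' \<Longrightarrow> fst v \<in> {1..r}"
    and eq: "\<And>k. k \<in> {1..r} \<Longrightarrow> fam_exps m k = fam_exps m' k"
  shows "F m = F m'"
proof -
  define h where "h j = (\<lambda>(k,i). if k \<le> j then m' (k,i) else m (k,i))" for j :: nat
  have zero: "m (k, i) = 0" "m' (k, i) = 0" if "k \<notin> {1..r}" for k i
    using m(2)[of "(k,i)"] m'(2)[of "(k,i)"] that by (auto simp: msupp_def)
  have fs: "fin_supp (\<lambda>i. m (k,i))" "fin_supp (\<lambda>i. m' (k,i))" for k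
    by (rule fin_supp_family[OF m(1)], rule fin_supp_family[OF m'(1)])
  have "F (h j) = F m" if "j \<le> r" for j
    using that
  proof (induction j)
    case 0
    have "h 0 = m"
      using zero[of 0] by (auto simp: h_def fun_eq_iff)
    then show ?case by simp
  next
    case (Suc j)
    have "fexp (\<lambda>i. m (Suc j, i)) = fexp (\<lambda>i. m' (Suc j, i))"
      using eq[of "Suc j"] Suc.prems by (simp add: fam_exps_eq)
    then obtain \<sigma> where \<sigma>: "bij \<sigma>" "(\<lambda>i. m' (Suc j, i)) = (\<lambda>i. m (Suc j, \<sigma> i))"
      using fexp_eq_imp_bij[OF fs(1)[of "Suc j"] fs(2)[of "Suc j"]] by blast
    have "h (Suc j) = h j \<circ> famperm (Suc j) \<sigma>"
    proof
      fix p :: "nat \<times> nat"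
      obtain k i where p: "p = (k, i)" by (cases p)
      show "h (Suc j) p = (h j \<circ> famperm (Suc j) \<sigma>) p"
        using fun_cong[OF \<sigma>(2), of i] by (cases "k = Suc j") (simp_all add: p h_def famperm_def le_Suc_eq)
    qed
    then show ?case
      using Suc Xi_perm[OF F \<sigma>(1), of "h j" "Suc j"] by (simp only: Suc_leD)
  qed
  moreover have "h r = m'"
  proof
    fix p :: "nat \<times> nat"
    obtain k i where p: "p = (k, i)" by (cases p)
    show "h r p = m' p"
      using zero[of k i] by (cases "k \<in> {1..r}") (simp_all add: p h_def)
  qed
  ultimately show ?thesis by auto
qed

lemma mdeg_fam_exps:
  assumes "finite (msupp m)" "\<And>v. v \<in> msupp m \<Longrightarrow> fst v \<in> {1..r}"
  shows "mdeg m = (\<Sum>k=1..r. sum_mset (fam_exps m k))"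
proof -
  have eq: "msupp m = (SIGMA k:{1..r}. {i. m (k,i) \<noteq> 0})"
    using assms(2) by (auto simp: msupp_def)
  have fin: "finite {i. m (k,i) \<noteq> 0}" for k
    using fin_supp_family[OF assms(1)] by (simp only: fin_supp_finite)
  have "mdeg m = (\<Sum>k=1..r. \<Sum>i | m (k,i) \<noteq> 0. m (k,i))"
    unfolding mdeg_def eq by (subst sum.Sigma) (use fin in auto)
  also have "\<dots> = (\<Sum>k=1..r. sum_mset (fam_exps m k))"
    by (simp add: fam_exps_def sum_unfold_sum_mset)
  finally show ?thesis .
qed

lemma partition_mset_inj:
  assumes "is_partition l" "is_partition l'" "mset l = mset l'"
  shows "l = l'"
proof -
  have "sort l' = rev l"
    by (rule properties_for_sort) (use assms in \<open>simp_all add: is_partition_def\<close>)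
  moreover have "sort l' = rev l'"
    by (rule properties_for_sort) (use assms in \<open>simp_all add: is_partition_def\<close>)
  ultimately show ?thesis by simp
qed

lemma monsym_rep:
  assumes "L \<in> Pnr n r" "M \<in> Pnr n r"
  shows "monsym r L (rep M) = (if L = M then 1 else 0)"
proof -
  have "fam_exps (rep M) k = mset (M k)" for k
    by (simp add: fam_exps_eq rep_apply fexp_part[OF Pnr_partition[OF assms(2)]])
  moreover have "(\<forall>k\<in>{1..r}. mset (M k) = mset (L k)) \<longleftrightarrow> L = M"
  proof
    assume *: "\<forall>k\<in>{1..r}. mset (M k) = mset (L k)"
    show "L = M"
    proof
      fix k
      show "L k = M k"
        using partition_mset_inj[OF Pnr_partition[OF assms(1)] Pnr_partition[OF assms(2)], of k] * assms
        by (cases "k \<in> {1..r}") (auto simp: Pnr_def)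
    qed
  qed simp
  ultimately show ?thesis
    using finite_msupp_rep[OF assms(2)] fst_msupp_rep[OF assms(2)]
    by (auto simp: monsym_def)
qed

lemma Xi_monsym:
  assumes "L \<in> Pnr n r"
  shows "monsym r L \<in> Xi r n UNIV"
proof (rule Xi_UNIV_I)
  fix m assume "monsym r L m \<noteq> (0 :: 'a)"
  then have m: "finite (msupp m)" "\<And>v. v \<in> msupp m \<Longrightarrow> fst v \<in> {1..r}"
      "\<And>k. k \<in> {1..r} \<Longrightarrow> fam_exps m k = mset (L k)"
    unfolding monsym_def ball_msupp_case by (auto split: if_splits)
  have "mdeg m = (\<Sum>k=1..r. sum_mset (fam_exps m k))"
    using m(1,2) by (rule mdeg_fam_exps)
  also have "\<dots> = (\<Sum>k=1..r. sum_list (L k))"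
    using m(3) by (simp add: sum_mset_sum_list)
  finally show "finite (msupp m) \<and> mdeg m = n \<and> (\<forall>v\<in>msupp m. fst v \<in> {1..r})"
    using m(1,2) assms unfolding Pnr_def by blast
next
  fix j \<sigma> and m :: mono assume \<sigma>: "bij (\<sigma> :: nat \<Rightarrow> nat)"
  let ?m = "m \<circ> famperm j \<sigma>"
  have "fam_exps ?m k = fam_exps m k" for k
    using fexp_bij[OF \<sigma>, of "\<lambda>i. m (k, i)"] by (cases "k = j") (simp_all add: fam_exps_eq famperm_def)
  moreover have "finite (msupp ?m) \<longleftrightarrow> finite (msupp m)"
    by (rule finite_msupp_bij[OF bij_famperm[OF \<sigma>]])
  moreover have "(\<forall>v\<in>msupp ?m. fst v \<in> {1..r}) \<longleftrightarrow> (\<forall>v\<in>msupp m. fst v \<in> {1..r})"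
    by (rule msupp_fst_bij[OF \<sigma>, where P = "\<lambda>x. x \<in> {1..r}"])
  ultimately show "monsym r L ?m = (monsym r L m :: 'a)"
    unfolding monsym_def ball_msupp_case by (simp only:)
qed

lemma length_le_sum_list: "is_partition l \<Longrightarrow> length l \<le> sum_list l"
proof -
  assume "is_partition l"
  then have "0 \<notin> set l" by (simp add: is_partition_def)
  then show ?thesis
    by (induction l) auto
qed

lemma Pnr_sum_list_le: "M \<in> Pnr n r \<Longrightarrow> sum_list (M k) \<le> n"
proof -
  assume M: "M \<in> Pnr n r"
  show ?thesis
  proof (cases "k \<in> {1..r}")
    case True
    then have "sum_list (M k) \<le> (\<Sum>k=1..r. sum_list (M k))"
      by (intro member_le_sum) auto
    then show ?thesis
      using M by (simp add: Pnr_def)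
  next
    case False
    then show ?thesis
      using M by (simp add: Pnr_def)
  qed
qed

lemma Pnr_length_le: "M \<in> Pnr n r \<Longrightarrow> length (M k) \<le> n"
  by (rule order_trans[OF length_le_sum_list[OF Pnr_partition] Pnr_sum_list_le])

lemma finite_Pnr: "finite (Pnr n r)"
proof -
  have "finite {M. \<forall>k. (k \<in> {1..r} \<longrightarrow> M k \<in> {l. set l \<subseteq> {..n} \<and> length l \<le> n}) \<and> (k \<notin> {1..r} \<longrightarrow> M k = [])}"
    by (intro finite_set_of_finite_funs finite_lists_length_le) simp_all
  moreover have "M k \<in> {l. set l \<subseteq> {..n} \<and> length l \<le> n}" if "M \<in> Pnr n r" for M k
    using Pnr_length_le[OF that] Pnr_sum_list_le[OF that, of k] member_le_sum_list[of _ "M k"]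
    by (fastforce intro: order_trans)
  then have "Pnr n r \<subseteq> {M. \<forall>k. (k \<in> {1..r} \<longrightarrow> M k \<in> {l. set l \<subseteq> {..n} \<and> length l \<le> n})
      \<and> (k \<notin> {1..r} \<longrightarrow> M k = [])}"
    by (auto simp: Pnr_def)
  ultimately show ?thesis
    by (rule finite_subset[rotated])
qed

text \<open>Both sides are symmetric, and they agree at each \<open>rep M\<close>. Every monomial of
  degree \<open>n\<close> in these families has the exponent multisets of some \<open>rep M\<close>,
  found by sorting its exponents.\<close>

theorem Xi_expand:
  assumes F: "F \<in> Xi r n UNIV"
  shows "F = lincomb (Pnr n r) (\<lambda>M. F (rep M)) (monsym r)"
proof
  fix m
  let ?G = "lincomb (Pnr n r) (\<lambda>M. F (rep M)) (monsym r)"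
  have G: "?G \<in> Xi r n UNIV"
    by (rule Xi_lincomb) (rule Xi_monsym)
  show "F m = ?G m"
  proof (cases "finite (msupp m) \<and> mdeg m = n \<and> (\<forall>v\<in>msupp m. fst v \<in> {1..r})")
    case False
    then have "F m = 0" "?G m = 0"
      using F G unfolding Xi_iff by blast+
    then show ?thesis by simp
  next
    case True
    then have m: "finite (msupp m)" "\<And>v. v \<in> msupp m \<Longrightarrow> fst v \<in> {1..r}" "mdeg m = n"
      by blast+
    define M where "M k = (if k \<in> {1..r} then rev (sorted_list_of_multiset (fam_exps m k)) else [])" for k
    have mset: "mset (M k) = fam_exps m k" if "k \<in> {1..r}" for k
      using that by (simp add: M_def)
    have fin: "finite {i. m (k,i) \<noteq> 0}" for k
      using fin_supp_family[OF m(1)] by (simp only: fin_supp_finite)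
    have "is_partition (M k)" for k
      using fin[of k] by (auto simp: M_def is_partition_def fam_exps_def)
    moreover have "(\<Sum>k=1..r. sum_list (M k)) = n"
    proof -
      have "(\<Sum>k=1..r. sum_list (M k)) = (\<Sum>k=1..r. sum_mset (fam_exps m k))"
        by (intro sum.cong refl) (simp add: mset[symmetric] sum_mset_sum_list)
      then show ?thesis
        using mdeg_fam_exps[of m r] m by simp
    qed
    moreover have "M k = []" if "k \<notin> {1..r}" for k
      using that by (simp only: M_def if_False)
    ultimately have M: "M \<in> Pnr n r"
      unfolding Pnr_def by blast
    have exps: "fam_exps m k = fam_exps (rep M) k" if "k \<in> {1..r}" for k
      using mset[OF that] fexp_part[OF Pnr_partition[OF M], of k] by (simp add: fam_exps_eq rep_apply)
    have agree: "H m = H (rep M)" if "H \<in> Xi r n UNIV" for H :: "'a series"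
      by (rule Xi_eq_of_fam_exps[OF that m(1,2) finite_msupp_rep[OF M] fst_msupp_rep[OF M] exps])
    have "?G (rep M) = (\<Sum>M'\<in>Pnr n r. if M' = M then F (rep M) else 0)"
      unfolding lincomb_def by (intro sum.cong refl) (simp add: monsym_rep[OF _ M])
    also have "\<dots> = F (rep M)"
      using M finite_Pnr by simp
    finally show ?thesis
      using agree[OF F] agree[OF G] by simp
  qed
qed

lemma monsym_independent: "independent_on (Pnr n r) (monsym r :: _ \<Rightarrow> 'a::comm_ring_1 series)"
  unfolding independent_on_def
proof (intro allI impI ballI)
  fix a :: "multipart \<Rightarrow> 'a" and L
  assume a: "lincomb (Pnr n r) a (monsym r) = (\<lambda>_. 0)" and L: "L \<in> Pnr n r"
  have "lincomb (Pnr n r) a (monsym r) (rep L) = (\<Sum>M\<in>Pnr n r. if M = L then a L else 0)"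
    unfolding lincomb_def by (intro sum.cong refl) (simp add: monsym_rep[OF _ L])
  then show "a L = 0"
    using a L finite_Pnr by simp
qed

subsection \<open>Arrays of nonnegative integers and transposition\<close>

text \<open>Matrices of nonnegative integers with row sums \<open>s\<close> and column sums
  \<open>m\<close>. A row records the monomial chosen from one factor of a product, a column the
  exponents of one variable.\<close>

definition arrays :: "'u set \<Rightarrow> 'v set \<Rightarrow> ('u \<Rightarrow> nat) \<Rightarrow> ('v \<Rightarrow> nat) \<Rightarrow> ('u \<Rightarrow> 'v \<Rightarrow> nat) set" where
  "arrays U V s m = {X. (\<forall>u v. u \<notin> U \<or> v \<notin> V \<longrightarrow> X u v = 0)
     \<and> (\<forall>u\<in>U. (\<Sum>v\<in>V. X u v) = s u) \<and> (\<forall>v\<in>V. (\<Sum>u\<in>U. X u v) = m v)}"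

lemma finite_arrays:
  assumes "finite U" "finite V"
  shows "finite (arrays U V s m)"
proof -
  define B where "B = {a :: 'b \<Rightarrow> nat. \<forall>v. (v \<in> V \<longrightarrow> a v \<in> {..sum s U}) \<and> (v \<notin> V \<longrightarrow> a v = 0)}"
  have "finite B"
    unfolding B_def using assms(2) by (intro finite_set_of_finite_funs) simp_all
  then have "finite {X. \<forall>u. (u \<in> U \<longrightarrow> X u \<in> B) \<and> (u \<notin> U \<longrightarrow> X u = (\<lambda>_. 0))}"
    using assms(1) by (intro finite_set_of_finite_funs)
  moreover have "arrays U V s m \<subseteq> {X. \<forall>u. (u \<in> U \<longrightarrow> X u \<in> B) \<and> (u \<notin> U \<longrightarrow> X u = (\<lambda>_. 0))}"
  proof (intro subsetI CollectI allI conjI impI)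
    fix X u assume X: "X \<in> arrays U V s m"
    show "X u = (\<lambda>_. 0)" if "u \<notin> U"
      using X that by (auto simp: arrays_def)
    assume u: "u \<in> U"
    have "X u v \<le> sum s U" if "v \<in> V" for v
    proof -
      have "X u v \<le> (\<Sum>v\<in>V. X u v)"
        using assms(2) that by (intro member_le_sum) auto
      also have "\<dots> = s u"
        using X u by (simp add: arrays_def)
      also have "\<dots> \<le> sum s U"
        using assms(1) u by (intro member_le_sum) auto
      finally show ?thesis .
    qed
    then show "X u \<in> B"
      using X by (simp add: B_def arrays_def)
  qed
  ultimately show ?thesis
    by (rule finite_subset[rotated])
qed

lemma sum_arrays_transpose:
  "(\<Sum>X\<in>arrays U V s m. \<Prod>u\<in>U. \<Prod>v\<in>V. \<phi> u v (X u v))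
    = (\<Sum>Y\<in>arrays V U m s. \<Prod>v\<in>V. \<Prod>u\<in>U. \<phi> u v (Y v u))"
  by (rule sum.reindex_bij_witness[where i = "\<lambda>Y u v. Y v u" and j = "\<lambda>X v u. X u v"])
    (auto simp: arrays_def prod.swap[of _ V U])

lemma arrays_insert_iff:
  assumes "finite U" "u0 \<notin> U" and X0: "\<And>v. X u0 v = 0"
  shows "X(u0 := a) \<in> arrays (insert u0 U) V s m \<longleftrightarrow>
    (\<forall>v. v \<notin> V \<longrightarrow> a v = 0) \<and> (\<forall>v\<in>V. a v \<le> m v) \<and> sum a V = s u0
      \<and> X \<in> arrays U V s (\<lambda>v. m v - a v)"
proof -
  have sum: "(\<Sum>u\<in>insert u0 U. (X(u0 := a)) u v) = a v + (\<Sum>u\<in>U. X u v)" for v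
    using assms(1,2) by (auto intro!: sum.cong)
  have eq: "a v + (\<Sum>u\<in>U. X u v) = m v \<longleftrightarrow> a v \<le> m v \<and> (\<Sum>u\<in>U. X u v) = m v - a v" for v
    by linarith
  show ?thesis
    unfolding arrays_def mem_Collect_eq sum eq using assms(2) X0 by (auto split: if_splits)
qed

text \<open>Expanding a product means choosing a monomial \<open>X u\<close> from each factor:
  homogeneity of the factor fixes the row sum, and the resulting monomial fixes the column sums.
  Distinctness of \<open>us\<close> lets the rows be indexed by a set.\<close>

lemma sprod_list_eq_sum_arrays:
  fixes f :: "'u \<Rightarrow> 'a::comm_ring_1 series" and m :: mono
  assumes V: "finite V" and "distinct us" and m: "\<And>v. v \<notin> V \<Longrightarrow> m v = 0"
    and f: "\<And>u a. u \<in> set us \<Longrightarrow> (\<And>v. v \<notin> V \<Longrightarrow> a v = 0)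
      \<Longrightarrow> f u a = (if sum a V = s u then \<Prod>v\<in>V. \<phi> u v (a v) else 0)"
  shows "sprod_list (map f us) m
    = (\<Sum>X\<in>arrays (set us) V s m. \<Prod>u\<in>set us. \<Prod>v\<in>V. \<phi> u v (X u v))"
  using assms(2-4)
proof (induction us arbitrary: m)
  case Nil
  show ?case
  proof (cases "m = (\<lambda>_. 0)")
    case True
    then have "arrays {} V s m = {\<lambda>_ _. 0}"
      by (auto simp: arrays_def simp del: split_paired_All)
    then show ?thesis
      using True by (simp add: sprod_list_def sone_def)
  next
    case False
    then obtain v where "m v \<noteq> 0" by blast
    then have "v \<in> V" using Nil(2)[of v] by (cases "v \<in> V") auto
    then have "arrays {} V s m = {}"
      using \<open>m v \<noteq> 0\<close> unfolding arrays_def by fastforce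
    then show ?thesis
      using False by (simp add: sprod_list_def sone_def)
  qed
next
  case (Cons u0 us)
  let ?U = "set us"
  let ?P = "\<lambda>X. \<Prod>u\<in>?U. \<Prod>v\<in>V. \<phi> u v (X u v)"
  have u0: "u0 \<notin> ?U" using Cons.prems(1) by simp
  have m0: "\<And>v. v \<notin> V \<Longrightarrow> m v = 0" by (rule Cons.prems(2))
  have "msupp m \<subseteq> V"
  proof
    fix v assume "v \<in> msupp m"
    then show "v \<in> V"
      using m0[of v] by (cases "v \<in> V") (auto simp: msupp_def)
  qed
  then have finm: "finite (msupp m)"
    using V finite_subset by blast
  define A where "A = {a. (\<forall>v. a v \<le> m v) \<and> sum a V = s u0}"
  have A_eq: "A = {a\<in>{a. \<forall>v. a v \<le> m v}. sum a V = s u0}"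
    by (simp only: A_def mem_Collect_eq)
  have finA: "finite A"
    unfolding A_def by (rule finite_subset[OF _ finite_below[OF finm]]) blast
  have a0: "a v = 0" if "\<forall>v. a v \<le> m v" "v \<notin> V" for a v
  proof -
    have "a v \<le> m v" using that(1) by blast
    then show ?thesis using m0[OF that(2)] by simp
  qed
  have "sprod_list (map f (u0 # us)) m
      = (\<Sum>a | \<forall>v. a v \<le> m v. f u0 a * sprod_list (map f us) (\<lambda>v. m v - a v))"
    by (simp add: sprod_list_def smult_def)
  also have "\<dots> = (\<Sum>a | \<forall>v. a v \<le> m v. if sum a V = s u0 then
      \<Sum>X\<in>arrays ?U V s (\<lambda>v. m v - a v). (\<Prod>v\<in>V. \<phi> u0 v (a v)) * ?P X else 0)"
  proof (rule sum.cong[OF refl])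
    fix a assume "a \<in> {a. \<forall>v. a v \<le> m v}"
    then have a: "\<forall>v. a v \<le> m v" by simp
    have "f u0 a = (if sum a V = s u0 then \<Prod>v\<in>V. \<phi> u0 v (a v) else 0)"
      by (rule Cons.prems(3)) (simp, rule a0[OF a])
    moreover have "sprod_list (map f us) (\<lambda>v. m v - a v) = (\<Sum>X\<in>arrays ?U V s (\<lambda>v. m v - a v). ?P X)"
    proof (rule Cons.IH)
      show "f u b = (if sum b V = s u then \<Prod>v\<in>V. \<phi> u v (b v) else 0)"
        if "u \<in> ?U" "\<And>v. v \<notin> V \<Longrightarrow> b v = 0" for u b
        by (rule Cons.prems(3)) (use that in auto)
    qed (use Cons.prems(1) m0 in auto)
    ultimately show "f u0 a * sprod_list (map f us) (\<lambda>v. m v - a v) = (if sum a V = s u0 then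
      \<Sum>X\<in>arrays ?U V s (\<lambda>v. m v - a v). (\<Prod>v\<in>V. \<phi> u0 v (a v)) * ?P X else 0)"
      by (simp add: sum_distrib_left)
  qed
  also have "\<dots> = (\<Sum>a\<in>A. \<Sum>X\<in>arrays ?U V s (\<lambda>v. m v - a v). (\<Prod>v\<in>V. \<phi> u0 v (a v)) * ?P X)"
    unfolding A_eq by (rule sum.inter_filter[symmetric, OF finite_below[OF finm]])
  also have "\<dots> = (\<Sum>(a,X)\<in>(SIGMA a:A. arrays ?U V s (\<lambda>v. m v - a v)). (\<Prod>v\<in>V. \<phi> u0 v (a v)) * ?P X)"
    by (rule sum.Sigma) (use finA finite_arrays[OF _ V] in auto)
  also have "\<dots> = (\<Sum>X\<in>arrays (insert u0 ?U) V s m. \<Prod>u\<in>insert u0 ?U. \<Prod>v\<in>V. \<phi> u v (X u v))"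
  proof (rule sum.reindex_bij_witness[where i = "\<lambda>X. (X u0, X(u0 := \<lambda>_. 0))" and j = "\<lambda>(a,X). X(u0 := a)"])
    fix p assume "p \<in> (SIGMA a:A. arrays ?U V s (\<lambda>v. m v - a v))"
    then obtain a X where p: "p = (a, X)" "a \<in> A" "X \<in> arrays ?U V s (\<lambda>v. m v - a v)"
      by blast
    have a: "\<forall>v. a v \<le> m v" "sum a V = s u0" using p(2) by (simp_all add: A_def)
    have X0: "X u0 v = 0" for v
      using p(3) u0 unfolding arrays_def by blast
    show "((case p of (a, X) \<Rightarrow> X(u0 := a)) u0, (case p of (a, X) \<Rightarrow> X(u0 := a))(u0 := \<lambda>_. 0)) = p"
      using X0 by (auto simp: p(1) fun_eq_iff)
    have "X(u0 := a) \<in> arrays (insert u0 ?U) V s m"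
      using arrays_insert_iff[of ?U u0 X a V s m] u0 X0 p(3) a a0[OF a(1)] by blast
    then show "(case p of (a, X) \<Rightarrow> X(u0 := a)) \<in> arrays (insert u0 ?U) V s m"
      by (simp add: p(1))
    have "?P (X(u0 := a)) = ?P X"
      using u0 by (intro prod.cong refl) auto
    then show "(\<Prod>u\<in>insert u0 ?U. \<Prod>v\<in>V. \<phi> u v ((case p of (a, X) \<Rightarrow> X(u0 := a)) u v))
        = (case p of (a, X) \<Rightarrow> (\<Prod>v\<in>V. \<phi> u0 v (a v)) * ?P X)"
      using u0 by (simp add: p(1))
  next
    fix X assume X: "X \<in> arrays (insert u0 ?U) V s m"
    define Y where "Y = X(u0 := \<lambda>_. 0)"
    have XY: "Y(u0 := X u0) = X" by (simp add: Y_def)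
    then show "(case (X u0, X(u0 := \<lambda>_. 0)) of (a, X) \<Rightarrow> X(u0 := a)) = X"
      by (simp add: Y_def)
    have *: "(\<forall>v. v \<notin> V \<longrightarrow> X u0 v = 0) \<and> (\<forall>v\<in>V. X u0 v \<le> m v) \<and> sum (X u0) V = s u0
      \<and> Y \<in> arrays ?U V s (\<lambda>v. m v - X u0 v)"
      using arrays_insert_iff[of ?U u0 Y "X u0" V s m] u0 X XY by (simp add: Y_def)
    have "X u0 v \<le> m v" for v
      using * by (cases "v \<in> V") (simp_all del: split_paired_All)
    then have "X u0 \<in> A"
      using * unfolding A_def by blast
    then show "(X u0, X(u0 := \<lambda>_. 0)) \<in> (SIGMA a:A. arrays ?U V s (\<lambda>v. m v - a v))"
      using * by (simp add: Y_def)
  qed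
  finally show ?case by simp
qed

subsection \<open>The functions \<open>q\<close> in the monomial basis\<close>

text \<open>The contribution of one variable of family \<open>k'\<close> with exponent
  \<open>x\<close> to a coefficient in the generating product: the denominators allow every power in
  family \<open>k\<close>, the numerators give 1 or \<open>- t\<close> in family \<open>j\<close>,
  and other families do not occur.\<close>

definition qweight :: "nat \<Rightarrow> nat \<Rightarrow> ratfun \<Rightarrow> nat \<Rightarrow> nat \<Rightarrow> ratfun" where
  "qweight k j t k' x = (if k' = k then 1 else if x = 0 then 1 else if k' = j \<and> x = 1 then - t else 0)"

lemma supp_in_hfam: "supp_in {k} (hfam k a)"
  by (auto simp: supp_in_def hfam_def split: if_splits)

lemma supp_in_efam: "supp_in {k} (efam k a)"
  by (auto simp: supp_in_def efam_def split: if_splits)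

text \<open>With \<open>k \<noteq> j\<close> the monomial splits into its part in family
  \<open>k\<close> and the rest. The degree \<open>E\<close> of the rest forces the index
  \<open>b\<close>, so the sum over \<open>b\<close> collapses, and the power of \<open>- t\<close>
  is distributed over the variables.\<close>

lemma qfun_eq_prod:
  assumes "k \<noteq> j" and V: "finite V" and a: "\<And>v. v \<notin> V \<Longrightarrow> a v = 0"
  shows "qfun k j t s a = (if sum a V = s then \<Prod>v\<in>V. qweight k j t (fst v) (a v) else 0)"
proof -
  have sub: "msupp a \<subseteq> V"
  proof
    fix v assume "v \<in> msupp a"
    then show "v \<in> V"
      using a[of v] by (cases "v \<in> V") (auto simp: msupp_def)
  qed
  then have fin: "finite (msupp a)"
    using V finite_subset by blast
  define H where "H = mdeg (mrestr {k} a)"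
  define E where "E = mdeg (mrestr (- {k}) a)"
  define good where "good \<longleftrightarrow> (\<forall>v. fst v \<noteq> k \<longrightarrow> a v \<noteq> 0 \<longrightarrow> fst v = j \<and> a v = 1)"
  have HE: "H + E = sum a V"
    using mdeg_mrestr_split[OF fin, of "{k}"] mdeg_eq[OF V a] by (simp add: H_def E_def)
  have "supp_in (- {k}) (efam j b :: ratfun series)" for b
    by (rule supp_in_mono[OF supp_in_efam]) (use assms(1) in auto)
  then have term_eq: "smult (hfam k c) (efam j b) a = hfam k c (mrestr {k} a) * (efam j b (mrestr (- {k}) a) :: ratfun)" for b c
    using smult_disjoint[OF supp_in_hfam _ fin] by blast
  have h: "hfam k c (mrestr {k} a) = (if H = c then 1 else (0 :: ratfun))" for c
  proof -
    have "finite (msupp (mrestr {k} a))" "\<forall>v\<in>msupp (mrestr {k} a). fst v = k"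
      using fin by (simp_all add: msupp_mrestr)
    then show ?thesis
      unfolding hfam_def ball_msupp_case H_def by simp
  qed
  have good_eq: "(\<forall>v\<in>msupp (mrestr (- {k}) a). fst v = j) \<and> (\<forall>v. mrestr (- {k}) a v \<le> 1) \<longleftrightarrow> good"
  proof
    assume *: "(\<forall>v\<in>msupp (mrestr (- {k}) a). fst v = j) \<and> (\<forall>v. mrestr (- {k}) a v \<le> 1)"
    show good
      unfolding good_def
    proof (intro allI impI)
      fix v assume v: "fst v \<noteq> k" "a v \<noteq> 0"
      have av: "mrestr (- {k}) a v = a v"
        using v(1) by (simp add: mrestr_apply)
      then have "v \<in> msupp (mrestr (- {k}) a)"
        using v(2) by (simp add: msupp_def)
      then have "fst v = j"
        using * by blast
      moreover have "mrestr (- {k}) a v \<le> 1"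
        using * by blast
      ultimately show "fst v = j \<and> a v = 1"
        using av v(2) by simp
    qed
  next
    assume g: good
    have "fst v = j" if "v \<in> msupp (mrestr (- {k}) a)" for v
    proof -
      have "fst v \<noteq> k" "a v \<noteq> 0"
        using that by (auto simp: mrestr_apply msupp_def split: if_splits)
      then show ?thesis
        using g unfolding good_def by blast
    qed
    moreover have "mrestr (- {k}) a v \<le> 1" for v
    proof (cases "fst v \<noteq> k \<and> a v \<noteq> 0")
      case True
      then have "a v = 1" using g unfolding good_def by blast
      then show ?thesis by (simp add: mrestr_apply)
    qed (auto simp: mrestr_apply)
    ultimately show "(\<forall>v\<in>msupp (mrestr (- {k}) a). fst v = j) \<and> (\<forall>v. mrestr (- {k}) a v \<le> 1)"
      by blast
  qed
  have e: "efam j b (mrestr (- {k}) a) = (if good \<and> E = b then 1 else (0 :: ratfun))" for b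
  proof -
    have "finite (msupp (mrestr (- {k}) a))"
      using fin by (simp add: msupp_mrestr)
    then show ?thesis
      unfolding efam_def ball_msupp_case E_def good_eq[symmetric] by (simp only: simp_thms conj_assoc)
  qed
  have "qfun k j t s a = (\<Sum>b\<le>s. if b = E then (if good \<and> H = s - E then (- t) ^ E else 0) else 0)"
    unfolding qfun_def term_eq h e by (intro sum.cong) auto
  also have "\<dots> = (if good \<and> H + E = s then (- t) ^ E else 0)"
    by auto
  also have "\<dots> = (if sum a V = s then \<Prod>v\<in>V. qweight k j t (fst v) (a v) else 0)"
  proof (cases good)
    case True
    have "(- t) ^ E = (- t) ^ (\<Sum>v\<in>V. mrestr (- {k}) a v)"
      unfolding E_def using mdeg_eq[OF V, of "mrestr (- {k}) a"] a by (simp add: mrestr_apply)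
    also have "\<dots> = (\<Prod>v\<in>V. (- t) ^ mrestr (- {k}) a v)"
      by (rule power_sum)
    also have "\<dots> = (\<Prod>v\<in>V. qweight k j t (fst v) (a v))"
    proof (rule prod.cong[OF refl])
      fix v
      have "fst v \<noteq> k \<Longrightarrow> a v \<noteq> 0 \<Longrightarrow> fst v = j \<and> a v = 1"
        using True unfolding good_def by blast
      then show "(- t) ^ mrestr (- {k}) a v = qweight k j t (fst v) (a v)"
        by (cases "fst v \<noteq> k \<and> a v \<noteq> 0") (auto simp: mrestr_apply qweight_def)
    qed
    finally show ?thesis
      using True HE by simp
  next
    case False
    then obtain v where v: "fst v \<noteq> k" "a v \<noteq> 0" "\<not> (fst v = j \<and> a v = 1)"
      unfolding good_def by blast
    then have "qweight k j t (fst v) (a v) = 0"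
      by (auto simp: qweight_def)
    moreover have "v \<in> V"
      using v(2) sub unfolding msupp_def by blast
    ultimately have "(\<Prod>v\<in>V. qweight k j t (fst v) (a v)) = 0"
      using V by (meson prod_zero)
    then show ?thesis
      using False by simp
  qed
  finally show ?thesis .
qed

lemma umod_pred: "k \<in> {1..r} \<Longrightarrow> umod r (int k - 1) = (if k = 1 then r else k - 1)"
proof -
  assume k: "k \<in> {1..r}"
  show ?thesis
  proof (cases "k = 1")
    case True
    have "(- 1) mod int r = int r - 1"
      using k zmod_minus1[of "int r"] by simp
    then show ?thesis
      using True k by (simp add: umod_def nat_diff_distrib)
  next
    case False
    have "(int k - 1 - 1) mod int r = int k - 1 - 1"
      using k False by (intro mod_pos_pos_trivial) auto
    moreover have "Suc (nat (int k - 2)) = k - 1"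
      using False k by simp arith
    ultimately show ?thesis
      using False by (simp add: umod_def)
  qed
qed

lemma umod_succ: "k \<in> {1..r} \<Longrightarrow> umod r (int k + 1) = (if k = r then 1 else k + 1)"
  by (cases "k = r") (auto simp: umod_def)

lemma umod_self: "k \<in> {1..r} \<Longrightarrow> umod r (int k) = k"
proof -
  assume k: "k \<in> {1..r}"
  have "(int k - 1) mod int r = int k - 1"
    using k by (intro mod_pos_pos_trivial) auto
  moreover have "Suc (nat (int k - 1)) = k"
    using k by simp arith
  ultimately show ?thesis
    by (simp add: umod_def)
qed

lemma tmod_eq_umod: "tmod = umod"
  by (simp add: fun_eq_iff tmod_def umod_def)

definition pweight :: "nat \<Rightarrow> nat \<Rightarrow> nat \<Rightarrow> nat \<Rightarrow> ratfun" where
  "pweight r k = qweight k (umod r (int k - 1)) (tt r (int k - 1))"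

text \<open>The weights of the minus functions are those of the plus functions with the two families
  exchanged: \<open>k'\<close> follows \<open>k\<close> cyclically exactly if \<open>k\<close>
  precedes \<open>k'\<close>, and then both signs use the same indeterminate. This is the symmetry
  of the kernel.\<close>

lemma mweight_eq:
  assumes "k \<in> {1..r}" "k' \<in> {1..r}"
  shows "qweight k (umod r (int k + 1)) (tt r (int k)) k' x = pweight r k' k x"
proof -
  have "k' = umod r (int k + 1) \<longleftrightarrow> k = umod r (int k' - 1)"
    unfolding umod_pred[OF assms(2)] umod_succ[OF assms(1)] using assms by auto
  moreover have "tt r (int k) = tt r (int k' - 1)" if "k = umod r (int k' - 1)"
    unfolding tt_def tmod_eq_umod umod_self[OF assms(1)] using that by simp
  ultimately show ?thesis
    by (auto simp: pweight_def qweight_def)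
qed

text \<open>For \<open>r \<ge> 2\<close> both cyclic neighbours of \<open>k\<close> differ from
  \<open>k\<close>, as \<open>qfun_eq_prod\<close> requires; they coincide with each other when
  \<open>r = 2\<close>.\<close>

lemma qsingle_eq_prod:
  assumes r: "r \<ge> 2" and k: "k \<in> {1..r}" and V: "finite V" "\<And>v. v \<in> V \<Longrightarrow> fst v \<in> {1..r}"
    and a: "\<And>v. v \<notin> V \<Longrightarrow> a v = 0"
  shows "qsingle r True k s a = (if sum a V = s then \<Prod>v\<in>V. pweight r k (fst v) (a v) else 0)"
    and "qsingle r False k s a = (if sum a V = s then \<Prod>v\<in>V. pweight r (fst v) k (a v) else 0)"
proof -
  have "k \<noteq> umod r (int k - 1)"
    unfolding umod_pred[OF k] using r k by auto
  from qfun_eq_prod[OF this V(1) a, where t = "tt r (int k - 1)" and s = s]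
  show "qsingle r True k s a = (if sum a V = s then \<Prod>v\<in>V. pweight r k (fst v) (a v) else 0)"
    by (simp add: qsingle_def pweight_def)
  have "k \<noteq> umod r (int k + 1)"
    unfolding umod_succ[OF k] using r k by auto
  from qfun_eq_prod[OF this V(1) a, where t = "tt r (int k)" and s = s]
  show "qsingle r False k s a = (if sum a V = s then \<Prod>v\<in>V. pweight r (fst v) k (a v) else 0)"
    using mweight_eq[OF k] V(2) by (simp add: qsingle_def)
qed

lemma distinct_rows: "distinct (rows r L)"
proof -
  have "distinct (concat (map (\<lambda>k. map (Pair k) [0..<length (L k)]) ks))" if "distinct ks" for ks
    using that by (induction ks) (auto simp: distinct_map inj_on_def)
  then show ?thesis
    by (simp add: rows_def)
qed

lemma set_rows:
  assumes "L \<in> Pnr n r"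
  shows "set (rows r L) = msupp (rep L)"
  unfolding msupp_rep[OF assms] rows_def by auto

text \<open>Comparing the coefficients of \<open>\<Prod> (1 - t\<^bsub>k-1\<^esub> x\<^bsup>(k-1)\<^esup>\<^sub>i y\<^bsup>(k)\<^esup>\<^sub>j) / (1 - x\<^bsup>(k)\<^esup>\<^sub>i y\<^bsup>(k)\<^esup>\<^sub>j)\<close>
  read as a series in \<open>x\<close> and as a series in \<open>y\<close>.\<close>

lemma qmulti_transpose:
  assumes r: "r \<ge> 2" and L: "L \<in> Pnr n r" and M: "M \<in> Pnr n r"
  shows "qmulti r False M (rep L) = qmulti r True L (rep M)"
proof -
  have 1: "qmulti r True K (rep N) = (\<Sum>X\<in>arrays (msupp (rep K)) (msupp (rep N)) (rep K) (rep N).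
      \<Prod>u\<in>msupp (rep K). \<Prod>v\<in>msupp (rep N). pweight r (fst u) (fst v) (X u v))" (is ?P)
    and 2: "qmulti r False K (rep N) = (\<Sum>X\<in>arrays (msupp (rep K)) (msupp (rep N)) (rep K) (rep N).
      \<Prod>u\<in>msupp (rep K). \<Prod>v\<in>msupp (rep N). pweight r (fst v) (fst u) (X u v))" (is ?M)
    if K: "K \<in> Pnr n r" and N: "N \<in> Pnr n r" for K N
  proof -
    have row: "fst u \<in> {1..r}" "K (fst u) ! snd u = rep K u" if "u \<in> msupp (rep K)" for u
      using that K by (auto simp: msupp_rep rep_apply part_def)
    have "sprod_list (map (\<lambda>(k,i). qsingle r True k (K k ! i)) (rows r K)) (rep N)
        = (\<Sum>X\<in>arrays (set (rows r K)) (msupp (rep N)) (rep K) (rep N).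
            \<Prod>u\<in>set (rows r K). \<Prod>v\<in>msupp (rep N). pweight r (fst u) (fst v) (X u v))"
    proof (rule sprod_list_eq_sum_arrays[OF finite_msupp_rep[OF N] distinct_rows])
      fix u and a :: mono assume "u \<in> set (rows r K)" and a: "\<And>v. v \<notin> msupp (rep N) \<Longrightarrow> a v = 0"
      then have u: "u \<in> msupp (rep K)" by (simp add: set_rows[OF K])
      show "(case u of (k,i) \<Rightarrow> qsingle r True k (K k ! i)) a = (if sum a (msupp (rep N)) = rep K u
          then \<Prod>v\<in>msupp (rep N). pweight r (fst u) (fst v) (a v) else 0)"
        using qsingle_eq_prod(1)[OF r row(1)[OF u] finite_msupp_rep[OF N] fst_msupp_rep[OF N] a, where s = "rep K u"]
        by (simp add: case_prod_beta row(2)[OF u])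
    qed (simp add: msupp_def)
    then show ?P
      by (simp add: qmulti_rows set_rows[OF K])
    have "sprod_list (map (\<lambda>(k,i). qsingle r False k (K k ! i)) (rows r K)) (rep N)
        = (\<Sum>X\<in>arrays (set (rows r K)) (msupp (rep N)) (rep K) (rep N).
            \<Prod>u\<in>set (rows r K). \<Prod>v\<in>msupp (rep N). pweight r (fst v) (fst u) (X u v))"
    proof (rule sprod_list_eq_sum_arrays[OF finite_msupp_rep[OF N] distinct_rows])
      fix u and a :: mono assume "u \<in> set (rows r K)" and a: "\<And>v. v \<notin> msupp (rep N) \<Longrightarrow> a v = 0"
      then have u: "u \<in> msupp (rep K)" by (simp add: set_rows[OF K])
      show "(case u of (k,i) \<Rightarrow> qsingle r False k (K k ! i)) a = (if sum a (msupp (rep N)) = rep K u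
          then \<Prod>v\<in>msupp (rep N). pweight r (fst v) (fst u) (a v) else 0)"
        using qsingle_eq_prod(2)[OF r row(1)[OF u] finite_msupp_rep[OF N] fst_msupp_rep[OF N] a, where s = "rep K u"]
        by (simp add: case_prod_beta row(2)[OF u])
    qed (simp add: msupp_def)
    then show ?M
      by (simp add: qmulti_rows set_rows[OF K])
  qed
  show ?thesis
    unfolding 1[OF L M] 2[OF M L] by (rule sum_arrays_transpose[symmetric])
qed

subsection \<open>Specialization at the origin and Kostka matrices\<close>

lemma eval0_smult:
  assumes "\<And>m. f m \<in> Asub" "\<And>m. g m \<in> Asub"
  shows "smult f g m \<in> Asub" "eval0 (smult f g m) = smult (\<lambda>m. eval0 (f m)) (\<lambda>m. eval0 (g m)) m"
proof -
  have A: "f a * g b \<in> Asub" for a b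
    using assms subring_set_mult[OF local_hom_subring[OF local_hom_eval0]] by blast
  show "smult f g m \<in> Asub"
    unfolding smult_def by (rule subring_set_sum[OF local_hom_subring[OF local_hom_eval0]]) (rule A)
  show "eval0 (smult f g m) = smult (\<lambda>m. eval0 (f m)) (\<lambda>m. eval0 (g m)) m"
    unfolding smult_def by (subst local_hom_sum[OF local_hom_eval0, OF A])
      (simp add: local_hom_mult[OF local_hom_eval0] assms)
qed

lemma eval0_sprod_list:
  assumes "\<And>f m. f \<in> set fs \<Longrightarrow> f m \<in> Asub"
  shows "sprod_list fs m \<in> Asub \<and> eval0 (sprod_list fs m) = sprod_list (map (\<lambda>f m. eval0 (f m)) fs) m"
  using assms
proof (induction fs arbitrary: m)
  case Nil
  show ?case
    using subring_set_zero[OF local_hom_subring[OF local_hom_eval0]]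
      subring_set_one[OF local_hom_subring[OF local_hom_eval0]]
      local_hom_zero[OF local_hom_eval0] local_hom_one[OF local_hom_eval0]
    by (simp add: sprod_list_def sone_def)
next
  case (Cons f fs)
  have IH: "sprod_list fs m \<in> Asub" "eval0 (sprod_list fs m) = sprod_list (map (\<lambda>f m. eval0 (f m)) fs) m" for m
    using Cons.IH[of m] Cons.prems by auto
  have f: "\<And>m. f m \<in> Asub" using Cons.prems by simp
  have "(\<lambda>m. eval0 (sprod_list fs m)) = sprod_list (map (\<lambda>f m. eval0 (f m)) fs)"
    using IH(2) by (rule ext)
  then show ?case
    using eval0_smult[of f "sprod_list fs" m, OF f IH(1)] by (simp add: sprod_list_def)
qed

lemma efam_zero: "efam k 0 = sone"
proof
  fix m
  have "finite (msupp m) \<and> mdeg m = 0 \<longleftrightarrow> m = (\<lambda>_. 0)"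
  proof
    assume *: "finite (msupp m) \<and> mdeg m = 0"
    then have "\<forall>v\<in>msupp m. m v = 0"
      unfolding mdeg_def by (elim conjE) (simp only: sum_eq_0_iff)
    then have "m v = 0" for v
      unfolding msupp_def by blast
    then show "m = (\<lambda>_. 0)" ..
  qed (simp add: msupp_def mdeg_def)
  moreover have "(\<forall>v\<in>msupp m. fst v = k) \<and> (\<forall>v. m v \<le> 1)" if "m = (\<lambda>_. 0)"
    using that by (simp add: msupp_def)
  ultimately show "efam k 0 m = sone m"
    unfolding efam_def sone_def ball_msupp_case by (metis (no_types, lifting))
qed

lemma smult_hfam_sone: "smult (hfam k a) sone = hfam k a"
proof
  fix m
  show "smult (hfam k a) sone m = (hfam k a m :: 'a)"
  proof (cases "finite (msupp m)")
    case True
    then show ?thesis by (rule smult_sone)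
  next
    case False
    have "supp_in {k} (smult (hfam k a) (sone :: 'a series))"
      by (intro supp_in_smult supp_in_hfam supp_in_sone)
    then have "smult (hfam k a) (sone :: 'a series) m = 0"
      using False unfolding supp_in_def by blast
    moreover have "hfam k a m = (0 :: 'a)"
      using False by (simp add: hfam_def)
    ultimately show ?thesis by simp
  qed
qed

text \<open>Only the term \<open>b = 0\<close> survives when the indeterminate vanishes, so both
  signs degenerate to the same complete function.\<close>

lemma eval0_qsingle:
  shows "qsingle r eps k s m \<in> Asub" "eval0 (qsingle r eps k s m) = hfam k s m"
proof -
  note A = local_hom_subring[OF local_hom_eval0]
  have h: "hfam k a m \<in> Asub" "eval0 (hfam k a m) = hfam k a m" for k a m
    using subring_set_zero[OF A] subring_set_one[OF A] local_hom_zero[OF local_hom_eval0]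
      local_hom_one[OF local_hom_eval0] by (simp_all add: hfam_def)
  have e: "efam k a m \<in> Asub" "eval0 (efam k a m) = efam k a m" for k a m
    using subring_set_zero[OF A] subring_set_one[OF A] local_hom_zero[OF local_hom_eval0]
      local_hom_one[OF local_hom_eval0] by (simp_all add: efam_def)
  have q: "qfun k j t s m \<in> Asub \<and> eval0 (qfun k j t s m) = hfam k s m"
    if t: "t \<in> Asub" "eval0 t = 0" for j t
  proof -
    have pow: "(- t) ^ b \<in> Asub" "eval0 ((- t) ^ b) = (if b = 0 then 1 else 0)" for b
      using t subring_set_power[OF A subring_set_uminus[OF A t(1)], of b]
        local_hom_power[OF local_hom_eval0 subring_set_uminus[OF A t(1)], of b]
      by (simp_all add: local_hom_uminus[OF local_hom_eval0] zero_power)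
    have sm: "smult (hfam k a) (efam j b) m \<in> Asub"
      "eval0 (smult (hfam k a) (efam j b) m) = smult (hfam k a) (efam j b) m" for a b
      using eval0_smult[of "hfam k a" "efam j b" m] h e by simp_all
    have T: "(- t) ^ b * smult (hfam k (s - b)) (efam j b) m \<in> Asub" for b
      using subring_set_mult[OF A pow(1) sm(1)] .
    have "eval0 (qfun k j t s m) = (\<Sum>b\<le>s. eval0 ((- t) ^ b * smult (hfam k (s - b)) (efam j b) m))"
      unfolding qfun_def by (rule local_hom_sum[OF local_hom_eval0]) (rule T)
    also have "\<dots> = (\<Sum>b\<le>s. if b = 0 then smult (hfam k s) (efam j 0) m else 0)"
      by (intro sum.cong refl) (simp add: local_hom_mult[OF local_hom_eval0 pow(1) sm(1)] pow sm)
    also have "\<dots> = hfam k s m"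
      by (simp add: efam_zero smult_hfam_sone)
    finally have "eval0 (qfun k j t s m) = hfam k s m" .
    moreover have "qfun k j t s m \<in> Asub"
      unfolding qfun_def by (rule subring_set_sum[OF A]) (rule T)
    ultimately show ?thesis by blast
  qed
  have "tt r j \<in> Asub" "eval0 (tt r j) = 0" for j
    by (simp_all add: tt_def tvar_in_Asub eval0_tvar)
  then show "qsingle r eps k s m \<in> Asub" "eval0 (qsingle r eps k s m) = hfam k s m"
    using q by (simp_all add: qsingle_def)
qed

lemma sprod_list_hfam:
  assumes "finite (msupp m)" "\<And>v. v \<in> msupp m \<Longrightarrow> fst v = k"
  shows "sprod_list (map (hfam k) as) m = of_nat (hcoeff as (\<lambda>i. m (k, i)))"
  using assms
proof (induction as arbitrary: m)
  case Nil
  have "m = (\<lambda>_. 0) \<longleftrightarrow> (\<lambda>i. m (k, i)) = (\<lambda>_. 0)"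
  proof
    assume *: "(\<lambda>i. m (k, i)) = (\<lambda>_. 0)"
    show "m = (\<lambda>_. 0)"
    proof
      fix v show "m v = 0"
        using Nil(2)[of v] fun_cong[OF *, of "snd v"] by (cases v) (auto simp: msupp_def)
    qed
  qed simp
  then show ?case
    by (simp add: sprod_list_def sone_def)
next
  case (Cons a as)
  let ?\<beta> = "\<lambda>i. m (k, i)"
  \<comment> \<open>Here \<open>\<gamma>\<close> is what remains for the later factors, and
    \<open>up \<gamma>\<close> is the complementary monomial taken from the first one.\<close>
  define up where "up \<gamma> = (\<lambda>(j, i). if j = k then m (k, i) - \<gamma> i else 0)" for \<gamma> :: "nat \<Rightarrow> nat"
  have m0: "m (j, i) = 0" if "j \<noteq> k" for j i
    using Cons.prems(2)[of "(j, i)"] that by (auto simp: msupp_def)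
  have fs: "fin_supp ?\<beta>"
    by (rule fin_supp_family[OF Cons.prems(1)])
  have deg: "mdeg b = psize (\<lambda>i. b (k, i))" if b: "\<forall>v. b v \<le> m v" for b
  proof -
    obtain B where B: "\<And>i. i \<ge> B \<Longrightarrow> m (k, i) = 0"
      using fs by (auto simp: fin_supp_def)
    have le: "b v \<le> m v" for v using b by blast
    have bB: "b (k, i) = 0" if "i \<ge> B" for i
      using le[of "(k, i)"] B[OF that] by simp
    have "fst v = k" if "v \<in> msupp b" for v
      using that le[of v] m0[of "fst v" "snd v"] by (auto simp: msupp_def)
    then show ?thesis
      using mdeg_single_family[of b k B] psize_eq[of B "\<lambda>i. b (k, i)"] bB by simp
  qed
  have "sprod_list (map (hfam k) (a # as)) m
      = ((\<Sum>b | \<forall>v. b v \<le> m v. hfam k a b * sprod_list (map (hfam k) as) (\<lambda>v. m v - b v)) :: 'a)"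
    by (simp add: sprod_list_def smult_def)
  also have "\<dots> = (\<Sum>b | \<forall>v. b v \<le> m v. if mdeg b = a then of_nat (hcoeff as (\<lambda>i. m (k, i) - b (k, i))) else 0)"
  proof (rule sum.cong[OF refl])
    fix b assume "b \<in> {b. \<forall>v. b v \<le> m v}"
    then have le: "b v \<le> m v" for v by blast
    have sub: "msupp b \<subseteq> msupp m" by (rule msupp_le) (rule le)
    have fin: "finite (msupp b)"
      using sub Cons.prems(1) finite_subset by blast
    have fam: "fst v = k" if "v \<in> msupp b" for v
      using Cons.prems(2) sub that by blast
    have sub': "msupp (\<lambda>v. m v - b v) \<subseteq> msupp m" by (rule msupp_le) simp
    have "hfam k a b = (if mdeg b = a then 1 else (0 :: 'a))"
      unfolding hfam_def ball_msupp_case using fin fam by (simp del: split_paired_All)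
    moreover have "sprod_list (map (hfam k) as) (\<lambda>v. m v - b v)
        = (of_nat (hcoeff as (\<lambda>i. m (k, i) - b (k, i))) :: 'a)"
    proof (rule Cons.IH)
      show "finite (msupp (\<lambda>v. m v - b v))"
        using sub' Cons.prems(1) finite_subset by blast
      show "fst v = k" if "v \<in> msupp (\<lambda>v. m v - b v)" for v
        using Cons.prems(2) sub' that by blast
    qed
    ultimately show "hfam k a b * sprod_list (map (hfam k) as) (\<lambda>v. m v - b v)
      = (if mdeg b = a then of_nat (hcoeff as (\<lambda>i. m (k, i) - b (k, i))) else (0 :: 'a))"
      by simp
  qed
  also have "\<dots> = (\<Sum>b\<in>{b\<in>{b. \<forall>v. b v \<le> m v}. mdeg b = a}. of_nat (hcoeff as (\<lambda>i. m (k, i) - b (k, i))))"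
    by (rule sum.inter_filter[symmetric, OF finite_below[OF Cons.prems(1)]])
  also have "\<dots> = (\<Sum>\<gamma>\<in>{\<gamma>. (\<forall>i. \<gamma> i \<le> ?\<beta> i) \<and> psize ?\<beta> = psize \<gamma> + a}. of_nat (hcoeff as \<gamma>))"
  proof (rule sum.reindex_bij_witness[where i = up and j = "\<lambda>b i. m (k, i) - b (k, i)"])
    fix b assume "b \<in> {b\<in>{b. \<forall>v. b v \<le> m v}. mdeg b = a}"
    then have b: "\<forall>v. b v \<le> m v" "mdeg b = a" by blast+
    then have le: "b v \<le> m v" for v by blast
    show "up (\<lambda>i. m (k, i) - b (k, i)) = b"
    proof
      fix v :: "nat \<times> nat"
      obtain j i where v: "v = (j, i)" by (cases v)
      show "up (\<lambda>i. m (k, i) - b (k, i)) v = b v"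
        using le[of v] m0[of j i] by (cases "j = k") (simp_all add: up_def v)
    qed
    have "psize ?\<beta> = psize (\<lambda>i. m (k, i) - b (k, i)) + psize (\<lambda>i. b (k, i))"
    proof -
      obtain B where B: "\<And>i. i \<ge> B \<Longrightarrow> m (k, i) = 0"
        using fs by (auto simp: fin_supp_def)
      have bB: "b (k, i) = 0" if "i \<ge> B" for i
        using le[of "(k, i)"] B[OF that] by simp
      have "sum ?\<beta> {..<B} = (\<Sum>i<B. (m (k, i) - b (k, i)) + b (k, i))"
        using le by simp
      then show ?thesis
        using psize_eq[of B ?\<beta>] psize_eq[of B "\<lambda>i. m (k, i) - b (k, i)"] psize_eq[of B "\<lambda>i. b (k, i)"] B bB
        by (simp add: sum.distrib)
    qed
    then show "(\<lambda>i. m (k, i) - b (k, i)) \<in> {\<gamma>. (\<forall>i. \<gamma> i \<le> ?\<beta> i) \<and> psize ?\<beta> = psize \<gamma> + a}"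
      using deg[OF b(1)] b(2) by simp
  next
    fix \<gamma> assume "\<gamma> \<in> {\<gamma>. (\<forall>i. \<gamma> i \<le> ?\<beta> i) \<and> psize ?\<beta> = psize \<gamma> + a}"
    then have \<gamma>: "\<And>i. \<gamma> i \<le> m (k, i)" "psize ?\<beta> = psize \<gamma> + a" by blast+
    show "(\<lambda>i. m (k, i) - up \<gamma> (k, i)) = \<gamma>"
      using \<gamma>(1) by (simp add: up_def)
    have "up \<gamma> v \<le> m v" for v
      by (cases v) (simp add: up_def)
    then have up: "\<forall>v. up \<gamma> v \<le> m v" by blast
    have "psize (\<lambda>i. up \<gamma> (k, i)) = a"
    proof -
      obtain B where B: "\<And>i. i \<ge> B \<Longrightarrow> m (k, i) = 0"
        using fs by (auto simp: fin_supp_def)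
      have gB: "\<gamma> i = 0" if "i \<ge> B" for i
        using \<gamma>(1)[of i] B[OF that] by simp
      have "sum ?\<beta> {..<B} = (\<Sum>i<B. up \<gamma> (k, i) + \<gamma> i)"
        using \<gamma>(1) by (simp add: up_def)
      then show ?thesis
        using psize_eq[of B ?\<beta>] psize_eq[of B \<gamma>] psize_eq[of B "\<lambda>i. up \<gamma> (k, i)"] B gB \<gamma>(2)
        by (simp add: sum.distrib up_def)
    qed
    then show "up \<gamma> \<in> {b\<in>{b. \<forall>v. b v \<le> m v}. mdeg b = a}"
      using deg[OF up] up by simp
  qed simp
  also have "\<dots> = of_nat (hcoeff (a # as) ?\<beta>)"
    by simp
  finally show ?case .
qed

text \<open>Shape \<open>L\<close>, content \<open>M\<close>. Since \<open>n\<close> is at least the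
  length of every component, it is an admissible number of strips in each family at once.\<close>

definition kostka :: "nat \<Rightarrow> nat \<Rightarrow> multipart \<Rightarrow> multipart \<Rightarrow> nat" where
  "kostka n r L M = (\<Prod>k=1..r. kos n (part (M k)) (part (L k)))"

lemma mrestr_rep: "mrestr {k} (rep M) (k, i) = part (M k) i"
  by (simp add: mrestr_def rep_apply)

lemma msupp_mrestr_rep:
  assumes "M \<in> Pnr n r"
  shows "finite (msupp (mrestr {k} (rep M)))" "v \<in> msupp (mrestr {k} (rep M)) \<Longrightarrow> fst v = k"
  using finite_msupp_rep[OF assms] by (auto simp: msupp_mrestr)

lemma part_zero: "M \<in> Pnr n r \<Longrightarrow> i \<ge> n \<Longrightarrow> part (M k) i = 0"
  using Pnr_length_le[of M n r k] by (simp add: part_def)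

lemma schur_rep:
  assumes L: "L \<in> Pnr n r" and M: "M \<in> Pnr n r"
  shows "schur r L (rep M) = (of_nat (kostka n r L M) :: 'a::comm_ring_1)"
proof -
  have set: "set [1..<Suc r] = {1..r}" by auto
  have "schur r L (rep M) = (sprod_list (concat (map (\<lambda>k. [schur1 k (L k)]) [1..<Suc r])) (rep M) :: 'a)"
    by (simp only: schur_def concat_map_singleton)
  also have "\<dots> = (\<Prod>k\<in>set [1..<Suc r]. sprod_list [schur1 k (L k)] (mrestr {k} (rep M)))"
  proof (rule sprod_list_concat_disjoint)
    show "supp_in {k} f" if "f \<in> set [schur1 k (L k)]" for k and f :: "'a series"
      using that by (auto simp: supp_in_def schur1_def split: if_splits)
    show "finite (msupp (rep M))" by (rule finite_msupp_rep[OF M])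
    show "fst v \<in> set [1..<Suc r]" if "v \<in> msupp (rep M)" for v
      unfolding set by (rule fst_msupp_rep[OF M that])
  qed simp
  also have "\<dots> = (\<Prod>k=1..r. of_nat (kos n (part (M k)) (part (L k))))"
    unfolding set
  proof (rule prod.cong[OF refl])
    fix k
    have "sprod_list [schur1 k (L k)] (mrestr {k} (rep M)) = (schur1 k (L k) (mrestr {k} (rep M)) :: 'a)"
      using smult_sone[OF msupp_mrestr_rep(1)[OF M]] by (simp add: sprod_list_def)
    also have "\<dots> = of_nat (kos n (\<lambda>v. mrestr {k} (rep M) (k, v)) (part (L k)))"
      by (rule schur1_eq[OF Pnr_partition[OF L] msupp_mrestr_rep[OF M]]) (simp_all add: mrestr_rep part_zero[OF M])
    finally show "sprod_list [schur1 k (L k)] (mrestr {k} (rep M)) = (of_nat (kos n (part (M k)) (part (L k))) :: 'a)"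
      by (simp add: mrestr_rep)
  qed
  finally show ?thesis
    by (simp add: kostka_def)
qed

text \<open>The RSK identity yields the parts in reversed order and with no padding; the symmetry in
  the content removes both differences.\<close>

lemma kos_rev_list:
  assumes "length l \<le> n" "is_partition l'"
  shows "kos (length l) (nth (rev l)) (part l') = kos n (part l) (part l')"
proof -
  define \<sigma> where "\<sigma> i = (if i < length l then length l - 1 - i else i)" for i
  have "\<sigma> (\<sigma> i) = i" for i
    by (auto simp: \<sigma>_def)
  then have "bij \<sigma>"
    by (intro o_bij[of \<sigma> \<sigma>]) (auto simp: fun_eq_iff)
  have "kos (length l) (nth (rev l)) (part l') = kos (length l) (\<lambda>i. part l (\<sigma> i)) (part l')"
    by (rule kos_cong) (auto simp: rev_nth part_def \<sigma>_def)
  also have "\<dots> = kos n (part l) (part l')"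
    by (rule kos_bij[OF \<open>bij \<sigma>\<close> part_partition[OF assms(2)]]) (use assms(1) in \<open>auto simp: part_def \<sigma>_def\<close>)
  finally show ?thesis .
qed

lemma kos_size:
  assumes "is_partition l" "is_partition l'" "length l \<le> n" "kos n (part l) (part l') \<noteq> 0"
  shows "sum_list l' = sum_list l"
proof -
  have "psize (part l') = sum (part l) {..<n}"
    using kos_nonzeroD[OF assms(4)] by blast
  also have "\<dots> = psize (part l)"
    by (rule psize_eq[symmetric]) (use assms(3) in \<open>simp add: part_def\<close>)
  finally show ?thesis
    using part_partition[OF assms(1)] part_partition[OF assms(2)] by (simp add: partitions_of_def)
qed

text \<open>At the origin a product of functions q becomes a product of complete functions, whose
  coefficients factor over the families. RSK applies to each family, and expanding the product of
  sums gives a sum over tuples of partitions.\<close>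

lemma eval0_qmulti:
  assumes L: "L \<in> Pnr n r" and M: "M \<in> Pnr n r"
  shows "qmulti r eps L m \<in> Asub"
    and "eval0 (qmulti r eps L (rep M)) = (\<Sum>N\<in>Pnr n r. of_nat (kostka n r N L) * of_nat (kostka n r N M))"
proof -
  let ?fs = "concat (map (\<lambda>k. map (qsingle r eps k) (L k)) [1..<Suc r])"
  have set: "set [1..<Suc r] = {1..r}" by auto
  have A: "f m \<in> Asub" if "f \<in> set ?fs" for f m
    using that eval0_qsingle(1) by auto
  have ev: "qmulti r eps L m \<in> Asub" "eval0 (qmulti r eps L m) = sprod_list (map (\<lambda>f m. eval0 (f m)) ?fs) m" for m
  proof -
    have "sprod_list ?fs m \<in> Asub \<and> eval0 (sprod_list ?fs m) = sprod_list (map (\<lambda>f m. eval0 (f m)) ?fs) m"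
    proof (rule eval0_sprod_list)
      show "f m \<in> Asub" if "f \<in> set ?fs" for f m
        by (rule A[OF that])
    qed
    then show "qmulti r eps L m \<in> Asub"
      "eval0 (qmulti r eps L m) = sprod_list (map (\<lambda>f m. eval0 (f m)) ?fs) m"
      unfolding qmulti_def by blast+
  qed
  show "qmulti r eps L m \<in> Asub"
    by (rule ev(1))
  have map: "map (\<lambda>f m. eval0 (f m)) ?fs = concat (map (\<lambda>k. map (hfam k) (L k)) [1..<Suc r])"
    by (simp add: map_concat comp_def eval0_qsingle(2) del: upt_Suc)
  have "eval0 (qmulti r eps L (rep M))
      = (\<Prod>k\<in>set [1..<Suc r]. sprod_list (map (hfam k) (L k)) (mrestr {k} (rep M)))"
    unfolding ev(2) map
  proof (rule sprod_list_concat_disjoint)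
    show "supp_in {k} f" if "f \<in> set (map (hfam k) (L k))" for k and f :: "rat series"
      using that supp_in_hfam by auto
    show "finite (msupp (rep M))" by (rule finite_msupp_rep[OF M])
    show "fst v \<in> set [1..<Suc r]" if "v \<in> msupp (rep M)" for v
      unfolding set by (rule fst_msupp_rep[OF M that])
  qed simp
  also have "\<dots> = (\<Prod>k=1..r. of_nat (hcoeff (L k) (part (M k))))"
    unfolding set
  proof (rule prod.cong[OF refl])
    fix k
    have "sprod_list (map (hfam k) (L k)) (mrestr {k} (rep M))
        = (of_nat (hcoeff (L k) (\<lambda>i. mrestr {k} (rep M) (k, i))) :: rat)"
      by (rule sprod_list_hfam[OF msupp_mrestr_rep[OF M]])
    then show "sprod_list (map (hfam k) (L k)) (mrestr {k} (rep M)) = (of_nat (hcoeff (L k) (part (M k))) :: rat)"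
      by (simp add: mrestr_rep)
  qed
  also have "\<dots> = of_nat (\<Prod>k=1..r. hcoeff (L k) (part (M k)))"
    by simp
  also have "(\<Prod>k=1..r. hcoeff (L k) (part (M k))) = (\<Sum>N\<in>Pnr n r. kostka n r N L * kostka n r N M)"
  proof -
    define B where "B k = {l. is_partition l \<and> sum_list l = sum_list (L k)}" for k
    define g where "g k l = kos n (part (L k)) (part l) * kos n (part (M k)) (part l)" for k l
    have bij: "bij_betw part (B k) (partitions_of (sum_list (L k)))" for k
      unfolding bij_betw_def
    proof
      show "inj_on part (B k)"
        using part_inj by (auto simp: inj_on_def B_def)
      show "part ` B k = partitions_of (sum_list (L k))"
      proof (intro set_eqI iffI)
        fix \<rho> assume \<rho>: "\<rho> \<in> partitions_of (sum_list (L k))"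
        then obtain l where l: "is_partition l" "part l = \<rho>"
          by (rule part_surj)
        then have "sum_list l = sum_list (L k)"
          using \<rho> part_partition[OF l(1)] by (simp add: partitions_of_def)
        then show "\<rho> \<in> part ` B k"
          using l by (auto simp: B_def)
      next
        fix \<rho> assume "\<rho> \<in> part ` B k"
        then obtain l where "is_partition l" "sum_list l = sum_list (L k)" "\<rho> = part l"
          by (auto simp: B_def)
        then show "\<rho> \<in> partitions_of (sum_list (L k))"
          using part_partition[of l] by simp
      qed
    qed
    have finB: "finite (B k)" for k
      using bij_betw_finite[OF bij] finite_partitions_of by blast
    have h: "hcoeff (L k) (part (M k)) = (\<Sum>l\<in>B k. g k l)" for k
    proof -
      have "hcoeff (L k) (part (M k)) = (\<Sum>\<rho>\<in>partitions_of (sum_list (L k)).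
          kos (length (L k)) (nth (rev (L k))) \<rho> * kos n (part (M k)) \<rho>)"
        by (rule hcoeff_eq_sum_kos) (rule part_zero[OF M])
      also have "\<dots> = (\<Sum>l\<in>B k. kos (length (L k)) (nth (rev (L k))) (part l) * kos n (part (M k)) (part l))"
        by (rule sum.reindex_bij_betw[OF bij, symmetric])
      also have "\<dots> = (\<Sum>l\<in>B k. g k l)"
        by (intro sum.cong refl) (simp add: g_def B_def kos_rev_list[OF Pnr_length_le[OF L]])
      finally show ?thesis .
    qed
    have "(\<Prod>k=1..r. hcoeff (L k) (part (M k))) = (\<Sum>f\<in>PiE {1..r} B. \<Prod>k=1..r. g k (f k))"
      unfolding h by (rule prod_sum_PiE) (simp_all add: finB)
    also have "\<dots> = (\<Sum>N\<in>{N\<in>Pnr n r. \<forall>k\<in>{1..r}. sum_list (N k) = sum_list (L k)}. \<Prod>k=1..r. g k (N k))"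
    proof (rule sum.reindex_bij_witness[where i = "\<lambda>N. restrict N {1..r}" and j = "\<lambda>f k. if k \<in> {1..r} then f k else []"])
      fix f assume f: "f \<in> PiE {1..r} B"
      have fB: "is_partition (f k)" "sum_list (f k) = sum_list (L k)" if "k \<in> {1..r}" for k
        using f that by (auto simp: B_def PiE_def Pi_def)
      have "(\<Sum>k=1..r. sum_list (if k \<in> {1..r} then f k else [])) = (\<Sum>k=1..r. sum_list (L k))"
        using fB by (intro sum.cong) simp_all
      then show "(\<lambda>k. if k \<in> {1..r} then f k else []) \<in> {N\<in>Pnr n r. \<forall>k\<in>{1..r}. sum_list (N k) = sum_list (L k)}"
        using L fB unfolding Pnr_def by simp
      show "restrict (\<lambda>k. if k \<in> {1..r} then f k else []) {1..r} = f"
        using f by (auto simp: restrict_def PiE_def extensional_def fun_eq_iff)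
      show "(\<Prod>k=1..r. g k (if k \<in> {1..r} then f k else [])) = (\<Prod>k=1..r. g k (f k))"
        by (intro prod.cong) simp_all
    next
      fix N assume N: "N \<in> {N\<in>Pnr n r. \<forall>k\<in>{1..r}. sum_list (N k) = sum_list (L k)}"
      show "(\<lambda>k. if k \<in> {1..r} then restrict N {1..r} k else []) = N"
        using N by (auto simp: Pnr_def fun_eq_iff)
      show "restrict N {1..r} \<in> PiE {1..r} B"
        using N by (auto simp: B_def Pnr_def)
    qed
    \<comment> \<open>RSK only yields tuples with the same size as \<open>L\<close> in each family.
      The other multipartitions of \<open>n\<close> may be added, since a Kostka number vanishes if
      shape and content differ in size.\<close>
    also have "\<dots> = (\<Sum>N\<in>Pnr n r. \<Prod>k=1..r. g k (N k))"
    proof (rule sum.mono_neutral_left[OF finite_Pnr])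
      show "\<forall>N\<in>Pnr n r - {N\<in>Pnr n r. \<forall>k\<in>{1..r}. sum_list (N k) = sum_list (L k)}. (\<Prod>k=1..r. g k (N k)) = 0"
      proof
        fix N assume "N \<in> Pnr n r - {N\<in>Pnr n r. \<forall>k\<in>{1..r}. sum_list (N k) = sum_list (L k)}"
        then obtain k where N: "N \<in> Pnr n r" and k: "k \<in> {1..r}" "sum_list (N k) \<noteq> sum_list (L k)"
          by blast
        then have "g k (N k) = 0"
          using kos_size[OF Pnr_partition[OF L] Pnr_partition[OF N] Pnr_length_le[OF L], of k k]
          by (auto simp: g_def)
        then show "(\<Prod>k=1..r. g k (N k)) = 0"
          using k(1) by (intro prod_zero) auto
      qed
    qed blast
    also have "\<dots> = (\<Sum>N\<in>Pnr n r. kostka n r N L * kostka n r N M)"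
      by (simp add: kostka_def g_def prod.distrib)
    finally show ?thesis .
  qed
  finally show "eval0 (qmulti r eps L (rep M)) = (\<Sum>N\<in>Pnr n r. of_nat (kostka n r N L) * of_nat (kostka n r N M))"
    by simp
qed

lemma kostka_self:
  assumes "L \<in> Pnr n r"
  shows "kostka n r L L = 1"
proof -
  have "kos n (part (L k)) (part (L k)) = 1" for k
    by (rule kos_self)
      (use part_partition[OF Pnr_partition[OF assms], of k] part_zero[OF assms] in \<open>auto simp: partitions_of_def\<close>)
  then show ?thesis
    by (simp add: kostka_def)
qed

text \<open>A nonzero Kostka number gives dominance in each family separately. An initial segment of
  the interleaved sequence meets every family in an initial segment, so these inequalities can be
  added.\<close>

lemma kostka_dominates:
  assumes r: "r \<ge> 1" and L: "L \<in> Pnr n r" and M: "M \<in> Pnr n r" and nz: "kostka n r L M \<noteq> 0"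
  shows "dominates r M L"
  unfolding dominates_def
proof
  fix N
  have le: "sum (part (M k)) {..<a} \<le> sum (part (L k)) {..<a}" if "k \<in> {1..r}" for k a
  proof -
    have "kos n (part (M k)) (part (L k)) \<noteq> 0"
      using nz that unfolding kostka_def by (meson finite_atLeastAtMost prod_zero)
    note D = kos_nonzeroD[OF this]
    show ?thesis
    proof (cases "a \<le> n")
      case True
      then show ?thesis using D by blast
    next
      case False
      have "sum (part (M k)) {..<a} = sum (part (M k)) {..<n}"
        using False part_zero[OF M] by (intro sum.mono_neutral_right) auto
      also have "\<dots> = psize (part (L k))"
        using D by simp
      also have "\<dots> = sum (part (L k)) {..<a}"
        using False part_zero[OF L] by (intro psize_eq) auto
      finally show ?thesis by simp
    qed
  qed
  \<comment> \<open>Position \<open>i * r + c\<close> of the sequence holds row \<open>i\<close>,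
    counted from 0, of family \<open>c + 1\<close>.\<close>
  have group: "(\<Sum>j<N. cseq r K j) = (\<Sum>c<r. sum (part (K (c + 1))) {i. i * r + c < N})" for K
  proof -
    have fin: "finite {i. i * r + c < N}" for c
    proof (rule finite_subset)
      show "{i. i * r + c < N} \<subseteq> {..<N}"
        using r by (auto intro: le_less_trans[rotated] simp: trans_le_add1)
    qed simp
    have "(\<Sum>c<r. sum (part (K (c + 1))) {i. i * r + c < N})
        = (\<Sum>(c,i)\<in>(SIGMA c:{..<r}. {i. i * r + c < N}). part (K (c + 1)) i)"
      using fin by (intro sum.Sigma) auto
    also have "\<dots> = (\<Sum>j<N. cseq r K j)"
      by (rule sum.reindex_bij_witness[where i = "\<lambda>j. (j mod r, j div r)" and j = "\<lambda>(c,i). i * r + c"])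
        (use r in \<open>auto simp: cseq_def\<close>)
    finally show ?thesis by simp
  qed
  show "(\<Sum>j<N. cseq r M j) \<le> (\<Sum>j<N. cseq r L j)"
    unfolding group
  proof (rule sum_mono)
    fix c assume c: "c \<in> {..<r}"
    have "{i. i * r + c < N} = {..<card {i. i * r + c < N}}"
    proof (rule down_closed_eq_lessThan)
      show "finite {i. i * r + c < N}"
      proof (rule finite_subset)
        show "{i. i * r + c < N} \<subseteq> {..<N}"
          using r by (auto intro: le_less_trans[rotated] simp: trans_le_add1)
      qed simp
      show "y \<in> {i. i * r + c < N}" if "x \<in> {i. i * r + c < N}" "y < x" for x y
      proof -
        have "y * r \<le> x * r" using that(2) by simp
        then show ?thesis using that(1) unfolding mem_Collect_eq by linarith
      qed
    qed
    then obtain a where a: "{i. i * r + c < N} = {..<a}" ..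
    show "sum (part (M (c + 1))) {i. i * r + c < N} \<le> sum (part (L (c + 1))) {i. i * r + c < N}"
      unfolding a using le[of "c + 1" a] c by simp
  qed
qed

subsection \<open>Two-sided triangularity\<close>

lemma lincomb_delta: "finite S \<Longrightarrow> L \<in> S \<Longrightarrow> lincomb S (\<lambda>M. if M = L then x else 0) B = ssmult x (B L)"
  by (simp add: lincomb_def ssmult_def if_distrib[of "\<lambda>x. x * _"] cong: if_cong)

lemma lincomb_scale: "ssmult x (lincomb S a B) = lincomb S (\<lambda>M. x * a M) B"
  by (simp add: lincomb_def ssmult_def sum_distrib_left mult.assoc)

text \<open>Expanded in \<open>P\<close>, a function of both kinds has no term of rank above
  \<open>L\<close> (from \<open>s\<close>) and none below (from \<open>q\<close>). The relation
  \<open>w L = c L * D L\<close> between the two leading coefficients translates the normalization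
  of one kind into that of the other; the last two claims provide existence for every multiple
  \<open>x\<close>.\<close>

lemma triangular_both_ways:
  fixes rk :: "'b \<Rightarrow> nat" and P q s :: "'b \<Rightarrow> 'a::field series"
  assumes fin: "finite S" and inj: "inj_on rk S" and ind: "independent_on S P"
    and P: "\<And>L. L \<in> S \<Longrightarrow> P L = lincomb {M\<in>S. rk M \<le> rk L} (u L) s \<and> u L L = 1"
    and q: "\<And>L. L \<in> S \<Longrightarrow> q L = lincomb S (v L) P"
    and v: "\<And>L M. L \<in> S \<Longrightarrow> M \<in> S \<Longrightarrow> v L M \<noteq> 0 \<Longrightarrow> rk L \<le> rk M"
    and D: "\<And>L. L \<in> S \<Longrightarrow> v L L = D L \<and> D L \<noteq> 0"
    and L: "L \<in> S"
  shows "F = lincomb {M\<in>S. rk L \<le> rk M} c q \<Longrightarrow> F = lincomb {M\<in>S. rk M \<le> rk L} w s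
      \<Longrightarrow> F = ssmult (w L) (P L) \<and> w L = c L * D L"
    and "\<exists>c. c L = x / D L \<and> ssmult x (P L) = lincomb {M\<in>S. rk L \<le> rk M} c q"
    and "\<exists>w. w L = x \<and> ssmult x (P L) = lincomb {M\<in>S. rk M \<le> rk L} w s"
proof -
  let ?lo = "{M\<in>S. rk M \<le> rk L}" and ?up = "{M\<in>S. rk L \<le> rk M}"
  assume F1: "F = lincomb ?up c q" and F2: "F = lincomb ?lo w s"
  obtain w' where w': "lincomb ?lo w s = lincomb ?lo w' P" "w' L * u L L = w L"
    by (rule triangular_span[OF fin inj subring_set_UNIV, of P u s w L]) (use P L in auto)
  \<comment> \<open>The same coordinates computed twice: \<open>a\<close> comes from the expansion
    in \<open>s\<close>, \<open>b\<close> from the one in \<open>q\<close>. Independence of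
    \<open>P\<close> identifies them.\<close>
  define a where "a M = (if M \<in> ?lo then w' M else 0)" for M
  define b where "b M = (\<Sum>N\<in>?up. c N * v N M)" for M
  have Fa: "F = lincomb S a P"
    unfolding F2 w'(1) a_def by (rule lincomb_mono_neutral[OF fin]) blast
  have Fb: "F = lincomb S b P"
    unfolding F1 b_def by (rule lincomb_lincomb) (use q in blast)
  have ab: "a M = b M" if "M \<in> S" for M
    using independent_onD[OF ind, of a b M] Fa Fb that by simp
  have b0: "b M = 0" if "M \<in> S" "\<not> rk L \<le> rk M" for M
    unfolding b_def
  proof (rule sum.neutral, rule ballI)
    fix N assume "N \<in> ?up"
    then show "c N * v N M = 0"
      using v[of N M] that by auto
  qed
  have bL: "b L = c L * D L"
  proof -
    have "b L = (\<Sum>N\<in>?up. if N = L then c L * D L else 0)"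
      unfolding b_def
    proof (rule sum.cong[OF refl])
      fix N assume N: "N \<in> ?up"
      show "c N * v N L = (if N = L then c L * D L else 0)"
      proof (cases "N = L")
        case False
        then have "rk N \<noteq> rk L"
          using inj N L by (auto simp: inj_on_def)
        then have "v N L = 0"
          using v[of N L] N L by auto
        then show ?thesis using False by simp
      qed (use D L in auto)
    qed
    then show ?thesis
      using fin L by simp
  qed
  have "a M = (if M = L then w L else 0)" if "M \<in> S" for M
  proof (cases "M = L")
    case True
    then show ?thesis
      using w'(2) P[OF L] L by (simp add: a_def)
  next
    case False
    then have "rk M \<noteq> rk L"
      using inj that L by (auto simp: inj_on_def)
    then have "\<not> rk M \<le> rk L \<or> \<not> rk L \<le> rk M" by linarith
    then have "a M = 0"
    proof
      assume "\<not> rk M \<le> rk L"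
      then show ?thesis by (simp add: a_def)
    next
      assume "\<not> rk L \<le> rk M"
      then show ?thesis using ab[OF that] b0[OF that] by simp
    qed
    then show ?thesis
      using False by simp
  qed
  then have "lincomb S a P = lincomb S (\<lambda>M. if M = L then w L else 0) P"
    by (intro lincomb_cong) auto
  then have "F = ssmult (w L) (P L)"
    using Fa lincomb_delta[OF fin L] by simp
  moreover have "w L = c L * D L"
    using ab[OF L] bL w'(2) P[OF L] L by (simp add: a_def)
  ultimately show "F = ssmult (w L) (P L) \<and> w L = c L * D L" by blast
next
  let ?up = "{M\<in>S. rk L \<le> rk M}"
  \<comment> \<open>Reversing the rank turns the upper triangular matrix of \<open>q\<close> over
    \<open>P\<close> into a lower triangular one, so \<open>triangular_span\<close> can invert
    it.\<close>
  define N where "N = Max (rk ` S)"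
  define rk' where "rk' M = N - rk M" for M
  have le: "rk M \<le> N" if "M \<in> S" for M
    unfolding N_def using fin that by simp
  have iff: "rk' M \<le> rk' K \<longleftrightarrow> rk K \<le> rk M" if "M \<in> S" "K \<in> S" for M K
    using le[OF that(1)] le[OF that(2)] by (auto simp: rk'_def)
  have inj': "inj_on rk' S"
    using inj le unfolding inj_on_def rk'_def by (metis diff_diff_cancel)
  have set: "{M\<in>S. rk' M \<le> rk' K} = {M\<in>S. rk K \<le> rk M}" if "K \<in> S" for K
    using iff that by blast
  have qK: "q K = lincomb {M\<in>S. rk' M \<le> rk' K} (v K) P" if "K \<in> S" for K
  proof -
    have "lincomb {M\<in>S. rk K \<le> rk M} (v K) P = lincomb S (\<lambda>M. if M \<in> {M\<in>S. rk K \<le> rk M} then v K M else 0) P"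
      by (rule lincomb_mono_neutral[OF fin]) blast
    also have "\<dots> = lincomb S (v K) P"
      using v[OF that] by (intro lincomb_cong) auto
    finally show ?thesis
      unfolding set[OF that] using q[OF that] by simp
  qed
  obtain c where c: "lincomb {M\<in>S. rk' M \<le> rk' L} (\<lambda>M. if M = L then x else 0) P
      = lincomb {M\<in>S. rk' M \<le> rk' L} c q" "c L * v L L = (if L = L then x else 0)"
    by (rule triangular_span[OF fin inj' subring_set_UNIV, of q v P "\<lambda>M. if M = L then x else 0" L])
      (use qK D L in auto)
  have "lincomb ?up (\<lambda>M. if M = L then x else 0) P = ssmult x (P L)"
    using fin L by (intro lincomb_delta) auto
  then have "ssmult x (P L) = lincomb ?up c q"
    using c(1) unfolding set[OF L] by simp
  moreover have "c L = x / D L"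
    using c(2) D[OF L] by (simp add: field_simps)
  ultimately show "\<exists>c. c L = x / D L \<and> ssmult x (P L) = lincomb ?up c q"
    by blast
next
  let ?lo = "{M\<in>S. rk M \<le> rk L}"
  have "ssmult x (P L) = lincomb ?lo (\<lambda>M. x * u L M) s"
    using P[OF L] lincomb_scale[of x ?lo "u L" s] by simp
  then show "\<exists>w. w L = x \<and> ssmult x (P L) = lincomb ?lo w s"
    using P[OF L] by (intro exI[of _ "\<lambda>M. x * u L M"]) simp
qed

text \<open>Independence settles the coefficients on \<open>Pnr n r\<close>, and the convention that
  they vanish elsewhere settles the rest, so the definite description is legitimate.\<close>

lemma coords_lincomb:
  assumes "independent_on (Pnr n r) B" "F = lincomb (Pnr n r) a B"
  shows "coords r n B F = (\<lambda>L. if L \<in> Pnr n r then a L else 0)"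
  unfolding coords_def
proof (rule the_equality)
  have "lincomb (Pnr n r) (\<lambda>L. if L \<in> Pnr n r then a L else 0) B = lincomb (Pnr n r) a B"
    by (rule lincomb_cong) auto
  then show "(\<forall>L. L \<notin> Pnr n r \<longrightarrow> (if L \<in> Pnr n r then a L else 0) = 0)
      \<and> F = lincomb (Pnr n r) (\<lambda>L. if L \<in> Pnr n r then a L else 0) B"
    using assms(2) by simp
next
  fix b assume b: "(\<forall>L. L \<notin> Pnr n r \<longrightarrow> b L = 0) \<and> F = lincomb (Pnr n r) b B"
  show "b = (\<lambda>L. if L \<in> Pnr n r then a L else 0)"
  proof
    fix L
    show "b L = (if L \<in> Pnr n r then a L else 0)"
      using independent_onD[OF assms(1), of b a L] b assms(2) by auto
  qed
qed

text \<open>Orthogonality of the two triangular families forces both transition matrices to be trivial,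
  row by row.\<close>

lemma orthogonal_unitriangular_trivial:
  fixes U W :: "'b \<Rightarrow> 'b \<Rightarrow> 'a::field" and rk :: "'b \<Rightarrow> nat"
  assumes fin: "finite S" and inj: "inj_on rk S"
    and U: "\<And>L M. L \<in> S \<Longrightarrow> M \<in> S \<Longrightarrow> U L M \<noteq> 0 \<Longrightarrow> rk M \<le> rk L"
    and W: "\<And>L M. L \<in> S \<Longrightarrow> M \<in> S \<Longrightarrow> W L M \<noteq> 0 \<Longrightarrow> rk M \<le> rk L"
    and diag: "\<And>L. L \<in> S \<Longrightarrow> U L L = 1 \<and> W L L = 1 \<and> d L \<noteq> 0"
    and orth: "\<And>L M. L \<in> S \<Longrightarrow> M \<in> S \<Longrightarrow> L \<noteq> M \<Longrightarrow> (\<Sum>a\<in>S. U L a * W M a * d a) = 0"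
    and "L \<in> S" "M \<in> S"
  shows "U L M = (if L = M then 1 else 0) \<and> W L M = (if L = M then 1 else 0)"
  using assms(7,8)
proof (induction "rk L" arbitrary: L M rule: less_induct)
  case less
  show ?case
  proof (cases "rk M < rk L")
    case True
    then have ne: "L \<noteq> M" by auto
    \<comment> \<open>Since row \<open>M\<close> is a unit vector by induction, pairing it with row
      \<open>L\<close> isolates the single entry at \<open>M\<close>; the two orders of the pair
      give the entries of \<open>U\<close> and of \<open>W\<close>.\<close>
    have row: "U M a = (if M = a then 1 else 0)" "W M a = (if M = a then 1 else 0)" if "a \<in> S" for a
      using less.hyps[OF True less.prems(2) that] by blast+
    have "(\<Sum>a\<in>S. U L a * W M a * d a) = (\<Sum>a\<in>S. if a = M then U L M * d M else 0)"
      by (intro sum.cong refl) (simp add: row)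
    then have "U L M * d M = 0"
      using orth[OF less.prems ne] fin less.prems by simp
    moreover have "(\<Sum>a\<in>S. U M a * W L a * d a) = (\<Sum>a\<in>S. if a = M then W L M * d M else 0)"
      by (intro sum.cong refl) (simp add: row)
    then have "W L M * d M = 0"
      using orth[OF less.prems(2,1)] ne fin less.prems by simp
    ultimately show ?thesis
      using diag[OF less.prems(2)] ne by simp
  next
    case False
    then show ?thesis
    proof (cases "L = M")
      case True
      then show ?thesis using diag less.prems by simp
    next
      case ne: False
      then have "rk M \<noteq> rk L"
        using inj less.prems by (auto simp: inj_on_def)
      then show ?thesis
        using U[OF less.prems] W[OF less.prems] False ne by auto
    qed
  qed
qed

subsection \<open>Hall--Littlewood functions\<close>

text \<open>The data of a factorization \<open>Y\<^sup>T D X\<close> of the matrix of the plus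
  functions in the monomial basis, together with a rank that represents the order \<open>R\<close>
  numerically.\<close>

locale hall_littlewood =
  fixes r n :: nat and R :: "multipart rel" and rk :: "multipart \<Rightarrow> nat"
    and X Y :: "multipart \<Rightarrow> multipart \<Rightarrow> ratfun" and D :: "multipart \<Rightarrow> ratfun"
  assumes r: "r \<ge> 2"
    and inj: "inj_on rk (Pnr n r)"
    and R_iff: "\<And>L M. L \<in> Pnr n r \<Longrightarrow> M \<in> Pnr n r \<Longrightarrow> (M, L) \<in> R \<longleftrightarrow> rk M \<le> rk L"
    and kostka_tri: "\<And>L M. L \<in> Pnr n r \<Longrightarrow> M \<in> Pnr n r \<Longrightarrow> kostka n r L M \<noteq> 0 \<Longrightarrow> rk M \<le> rk L"
    and XY: "\<And>L M. L \<in> Pnr n r \<Longrightarrow> M \<in> Pnr n r \<Longrightarrow> X L M \<in> Asub \<and> Y L M \<in> Asub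
          \<and> eval0 (X L M) = of_nat (kostka n r L M) \<and> eval0 (Y L M) = of_nat (kostka n r L M)
          \<and> (X L M \<noteq> 0 \<longrightarrow> rk M \<le> rk L) \<and> (Y L M \<noteq> 0 \<longrightarrow> rk M \<le> rk L)
          \<and> qmulti r True L (rep M) = (\<Sum>N\<in>Pnr n r. Y N L * D N * X N M)"
    and diag: "\<And>L. L \<in> Pnr n r \<Longrightarrow> X L L = 1 \<and> Y L L = 1 \<and> D L \<noteq> 0"
begin

definition T :: "bool \<Rightarrow> multipart \<Rightarrow> multipart \<Rightarrow> ratfun" where
  "T eps = (if eps then X else Y)"

lemma T_facts:
  assumes "L \<in> Pnr n r" "M \<in> Pnr n r"
  shows "T eps L M \<in> Asub" "eval0 (T eps L M) = of_nat (kostka n r L M)"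
    "T eps L M \<noteq> 0 \<Longrightarrow> rk M \<le> rk L" "T eps L L = 1"
  using XY[OF assms] diag[OF assms(1)] by (cases eps; simp add: T_def)+

text \<open>Zero outside \<open>Pnr n r\<close>, as the description \<open>HL_pair\<close>
  prescribes there.\<close>

definition P :: "bool \<Rightarrow> multipart \<Rightarrow> ratfun series" where
  "P eps L = (if L \<in> Pnr n r then lincomb (Pnr n r) (T eps L) (monsym r) else (\<lambda>_. 0))"

lemma P_eq: "L \<in> Pnr n r \<Longrightarrow> P eps L = lincomb (Pnr n r) (T eps L) (monsym r)"
  by (simp add: P_def)

lemma strict_or_eq: "L \<in> Pnr n r \<Longrightarrow> M \<in> Pnr n r \<Longrightarrow> rk M \<le> rk L \<Longrightarrow> L = M \<or> rk M < rk L"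
  using inj unfolding inj_on_def by (metis le_neq_implies_less)

lemma P_independent: "independent_on (Pnr n r) (P eps)"
proof (rule independent_on_triangular[OF finite_Pnr monsym_independent P_eq])
  show "L = M \<or> rk M < rk L" if "L \<in> Pnr n r" "M \<in> Pnr n r" "T eps L M \<noteq> 0" for L M
    using strict_or_eq[OF that(1,2)] T_facts(3)[OF that] by blast
  show "T eps L L \<noteq> 0" if "L \<in> Pnr n r" for L
    using T_facts(4)[OF that that] by simp
qed

lemma lincomb_lower:
  assumes "L \<in> Pnr n r" and "\<And>M. M \<in> Pnr n r \<Longrightarrow> a M \<noteq> 0 \<Longrightarrow> rk M \<le> rk L"
  shows "lincomb (Pnr n r) a B = lincomb {M\<in>Pnr n r. rk M \<le> rk L} a B"
proof -
  have "lincomb {M\<in>Pnr n r. rk M \<le> rk L} a B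
      = lincomb (Pnr n r) (\<lambda>M. if M \<in> {M\<in>Pnr n r. rk M \<le> rk L} then a M else 0) B"
    by (rule lincomb_mono_neutral[OF finite_Pnr]) blast
  also have "\<dots> = lincomb (Pnr n r) a B"
    using assms by (intro lincomb_cong) auto
  finally show ?thesis by simp
qed

lemma schur_lower:
  assumes "L \<in> Pnr n r"
  shows "schur r L = (lincomb {M\<in>Pnr n r. rk M \<le> rk L} (\<lambda>M. of_nat (kostka n r L M)) (monsym r) :: ratfun series)"
proof -
  have "(schur r L :: ratfun series) = lincomb (Pnr n r) (\<lambda>M. schur r L (rep M)) (monsym r)"
    by (rule Xi_expand[OF Xi_schur[OF assms]])
  also have "\<dots> = lincomb (Pnr n r) (\<lambda>M. of_nat (kostka n r L M)) (monsym r)"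
    by (rule lincomb_cong) (simp_all add: schur_rep[OF assms])
  also have "\<dots> = lincomb {M\<in>Pnr n r. rk M \<le> rk L} (\<lambda>M. of_nat (kostka n r L M)) (monsym r)"
  proof (rule lincomb_lower[OF assms])
    show "rk M \<le> rk L" if "M \<in> Pnr n r" "of_nat (kostka n r L M) \<noteq> (0 :: ratfun)" for M
      using kostka_tri[OF assms that(1)] that(2) by (metis of_nat_0)
  qed
  finally show ?thesis .
qed

text \<open>Both \<open>P\<close> and the Schur functions are unitriangular over the monomial
  functions, with coefficients in \<open>Asub\<close>; so the transition between them is as
  well.\<close>

lemma P_schur:
  assumes L: "L \<in> Pnr n r"
  shows "\<exists>u. (\<forall>M. u M \<in> Asub) \<and> u L = 1 \<and> P eps L = lincomb {M\<in>Pnr n r. rk M \<le> rk L} u (schur r)"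
proof -
  note A = local_hom_subring[OF local_hom_eval0]
  \<comment> \<open>Cut off outside \<open>Pnr n r\<close>: the entries of \<open>T\<close> are
    known to lie in \<open>Asub\<close> only inside, whereas \<open>triangular_span\<close> wants
    this for every index.\<close>
  define t where "t M = (if M \<in> Pnr n r then T eps L M else 0)" for M
  have tA: "t M \<in> Asub" for M
    using T_facts(1)[OF L] subring_set_zero[OF A] by (simp add: t_def)
  have "P eps L = lincomb {M\<in>Pnr n r. rk M \<le> rk L} (T eps L) (monsym r)"
    unfolding P_eq[OF L] by (rule lincomb_lower[OF L]) (rule T_facts(3)[OF L])
  also have "\<dots> = lincomb {M\<in>Pnr n r. rk M \<le> rk L} t (monsym r)"
    by (rule lincomb_cong) (auto simp: t_def)
  finally have P: "P eps L = lincomb {M\<in>Pnr n r. rk M \<le> rk L} t (monsym r)" .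
  obtain u where u: "\<And>M. u M \<in> Asub"
      "lincomb {M\<in>Pnr n r. rk M \<le> rk L} t (monsym r) = lincomb {M\<in>Pnr n r. rk M \<le> rk L} u (schur r)"
      "u L * of_nat (kostka n r L L) = t L"
  proof (rule triangular_span[OF finite_Pnr inj A, of "schur r" "\<lambda>L M. of_nat (kostka n r L M)" "monsym r" t L])
    show "of_nat (kostka n r K K) \<noteq> (0 :: ratfun) \<and> inverse (of_nat (kostka n r K K)) \<in> Asub" if "K \<in> Pnr n r" for K
      using kostka_self[OF that] subring_set_one[OF A] by simp
  qed (use schur_lower subring_set_of_nat[OF A] tA L in auto)
  have "u L = 1"
    using u(3) kostka_self[OF L] T_facts(4)[OF L L] L by (simp add: t_def)
  then show ?thesis
    using u(1,2) P by auto
qed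

text \<open>For \<open>eps = False\<close>, \<open>qmulti_transpose\<close> replaces the matrix
  entry at \<open>L, M\<close> by the one at \<open>M, L\<close>, which exchanges \<open>X\<close>
  and \<open>Y\<close> in the factorization.\<close>

lemma q_P:
  assumes L: "L \<in> Pnr n r"
  shows "qmulti r eps L = lincomb (Pnr n r) (\<lambda>N. T (\<not> eps) N L * D N) (P eps)"
proof -
  have "lincomb (Pnr n r) (\<lambda>N. T (\<not> eps) N L * D N) (P eps)
      = lincomb (Pnr n r) (\<lambda>M. \<Sum>N\<in>Pnr n r. T (\<not> eps) N L * D N * T eps N M) (monsym r)"
    by (rule lincomb_lincomb) (rule P_eq)
  also have "\<dots> = lincomb (Pnr n r) (\<lambda>M. qmulti r eps L (rep M)) (monsym r)"
  proof (rule lincomb_cong[OF refl _ refl])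
    fix M assume M: "M \<in> Pnr n r"
    show "(\<Sum>N\<in>Pnr n r. T (\<not> eps) N L * D N * T eps N M) = qmulti r eps L (rep M)"
    proof (cases eps)
      case True
      then show ?thesis
        using XY[OF L M] by (simp add: T_def)
    next
      case False
      have "qmulti r False L (rep M) = qmulti r True M (rep L)"
        by (rule qmulti_transpose[OF r M L])
      also have "\<dots> = (\<Sum>N\<in>Pnr n r. Y N M * D N * X N L)"
        using XY[OF M L] by blast
      finally show ?thesis
        using False by (simp add: T_def mult.commute mult.left_commute)
    qed
  qed
  also have "\<dots> = qmulti r eps L"
    by (rule Xi_expand[OF Xi_qmulti[OF L], symmetric])
  finally show ?thesis by simp
qed

lemma characterization:
  assumes L: "L \<in> Pnr n r"
  shows "F = lincomb {M\<in>Pnr n r. rk L \<le> rk M} c (qmulti r eps) \<Longrightarrow> F = lincomb {M\<in>Pnr n r. rk M \<le> rk L} w (schur r)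
      \<Longrightarrow> F = ssmult (w L) (P eps L) \<and> w L = c L * D L"
    and "\<exists>c. c L = x / D L \<and> ssmult x (P eps L) = lincomb {M\<in>Pnr n r. rk L \<le> rk M} c (qmulti r eps)"
    and "\<exists>w. w L = x \<and> ssmult x (P eps L) = lincomb {M\<in>Pnr n r. rk M \<le> rk L} w (schur r)"
proof -
  define u where "u L = (SOME u. u L = 1 \<and> P eps L = lincomb {M\<in>Pnr n r. rk M \<le> rk L} u (schur r))" for L
  have u: "P eps K = lincomb {M\<in>Pnr n r. rk M \<le> rk K} (u K) (schur r) \<and> u K K = 1" if "K \<in> Pnr n r" for K
  proof -
    have "\<exists>u. u K = 1 \<and> P eps K = lincomb {M\<in>Pnr n r. rk M \<le> rk K} u (schur r)"
      using P_schur[OF that, of eps] by blast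
    from someI_ex[OF this] show ?thesis
      unfolding u_def[of K, symmetric] by blast
  qed
  have v: "rk K \<le> rk M" if "K \<in> Pnr n r" "M \<in> Pnr n r" "T (\<not> eps) M K * D M \<noteq> 0" for K M
    using T_facts(3)[OF that(2,1), of "\<not> eps"] that(3) by simp
  have d: "T (\<not> eps) K K * D K = D K \<and> D K \<noteq> 0" if "K \<in> Pnr n r" for K
    using T_facts(4)[OF that that] diag[OF that] by simp
  note * = triangular_both_ways[OF finite_Pnr inj P_independent[of eps], where u = u and s = "schur r"
      and q = "qmulti r eps" and v = "\<lambda>K M. T (\<not> eps) M K * D M" and D = D and L = L, OF u q_P v d L]
  show "F = lincomb {M\<in>Pnr n r. rk L \<le> rk M} c (qmulti r eps) \<Longrightarrow> F = lincomb {M\<in>Pnr n r. rk M \<le> rk L} w (schur r)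
      \<Longrightarrow> F = ssmult (w L) (P eps L) \<and> w L = c L * D L"
    by (rule *(1))
  show "\<exists>c. c L = x / D L \<and> ssmult x (P eps L) = lincomb {M\<in>Pnr n r. rk L \<le> rk M} c (qmulti r eps)"
    by (rule *(2))
  show "\<exists>w. w L = x \<and> ssmult x (P eps L) = lincomb {M\<in>Pnr n r. rk M \<le> rk L} w (schur r)"
    by (rule *(3))
qed

text \<open>Needed to give meaning to the coordinates inside \<open>form\<close>. The matrix over
  \<open>P\<close> is upper triangular, hence the reversed rank.\<close>

lemma q_independent: "independent_on (Pnr n r) (qmulti r True)"
proof (rule independent_on_triangular[where rk = "\<lambda>L. Max (rk ` Pnr n r) - rk L",
      OF finite_Pnr P_independent q_P])
  show "L = M \<or> Max (rk ` Pnr n r) - rk M < Max (rk ` Pnr n r) - rk L"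
    if "L \<in> Pnr n r" "M \<in> Pnr n r" "T (\<not> True) M L * D M \<noteq> 0" for L M
  proof -
    have "rk L \<le> rk M"
      using T_facts(3)[OF that(2,1), of "\<not> True"] that(3) by simp
    moreover have "rk M \<le> Max (rk ` Pnr n r)"
      using finite_Pnr that(2) by simp
    ultimately show ?thesis
      using strict_or_eq[OF that(2,1)] by auto
  qed
  show "T (\<not> True) L L * D L \<noteq> 0" if "L \<in> Pnr n r" for L
    using T_facts(4)[OF that that] diag[OF that] by simp
qed

text \<open>The form pairs plus functions q with monomial functions, and the same \<open>Y\<close>
  occurs on both sides: \<open>q\<^sup>+ = Y\<^sup>T D P\<^sup>+\<close> and
  \<open>P\<^sup>- = Y m\<close>. It cancels and leaves the inverse of \<open>D\<close>.\<close>

lemma form_P: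
  "form r n (lincomb (Pnr n r) x (P True)) (lincomb (Pnr n r) y (P False))
    = (\<Sum>N\<in>Pnr n r. x N * y N * inverse (D N))"
proof -
  let ?S = "Pnr n r"
  define w where "w L = (SOME w. P True L = lincomb ?S w (qmulti r True))" for L
  have w: "P True L = lincomb ?S (w L) (qmulti r True)" if L: "L \<in> ?S" for L
  proof -
    obtain c where "ssmult 1 (P True L) = lincomb {M\<in>?S. rk L \<le> rk M} c (qmulti r True)"
      using characterization(2)[OF L, of 1 True] by blast
    then have "P True L = lincomb {M\<in>?S. rk L \<le> rk M} c (qmulti r True)"
      by (simp add: ssmult_def)
    also have "\<dots> = lincomb ?S (\<lambda>M. if M \<in> {M\<in>?S. rk L \<le> rk M} then c M else 0) (qmulti r True)"
      by (rule lincomb_mono_neutral[OF finite_Pnr]) blast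
    finally have "P True L = lincomb ?S (\<lambda>M. if M \<in> {M\<in>?S. rk L \<le> rk M} then c M else 0) (qmulti r True)" .
    then show ?thesis
      unfolding w_def by (rule someI[where P = "\<lambda>w. P True L = lincomb ?S w (qmulti r True)"])
  qed
  define z where "z M = (\<Sum>L\<in>?S. x L * w L M)" for M
  have F: "lincomb ?S x (P True) = lincomb ?S z (qmulti r True)"
    unfolding z_def by (rule lincomb_lincomb) (rule w)
  also have "\<dots> = lincomb ?S (\<lambda>N. \<Sum>M\<in>?S. z M * (Y N M * D N)) (P True)"
  proof (rule lincomb_lincomb)
    show "qmulti r True M = lincomb ?S (\<lambda>N. Y N M * D N) (P True)" if "M \<in> ?S" for M
      using q_P[OF that, of True] by (simp add: T_def)
  qed
  finally have eq: "lincomb ?S x (P True) = lincomb ?S (\<lambda>N. \<Sum>M\<in>?S. z M * (Y N M * D N)) (P True)" .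
  have xz: "x N = (\<Sum>M\<in>?S. z M * (Y N M * D N))" if "N \<in> ?S" for N
    by (rule independent_onD[OF P_independent eq that])
  have G: "lincomb ?S y (P False) = lincomb ?S (\<lambda>M. \<Sum>N\<in>?S. y N * Y N M) (monsym r)"
  proof (rule lincomb_lincomb)
    show "P False M = lincomb ?S (Y M) (monsym r)" if "M \<in> ?S" for M
      using P_eq[OF that, of False] by (simp add: T_def)
  qed
  have "form r n (lincomb ?S x (P True)) (lincomb ?S y (P False)) = (\<Sum>M\<in>?S. z M * (\<Sum>N\<in>?S. y N * Y N M))"
    unfolding form_def coords_lincomb[OF q_independent F] coords_lincomb[OF monsym_independent G] by simp
  also have "\<dots> = (\<Sum>N\<in>?S. y N * (\<Sum>M\<in>?S. z M * Y N M))"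
    unfolding sum_distrib_left by (subst sum.swap) (simp add: mult.left_commute)
  also have "\<dots> = (\<Sum>N\<in>?S. x N * y N * inverse (D N))"
  proof (rule sum.cong[OF refl])
    fix N assume N: "N \<in> ?S"
    have "x N = (\<Sum>M\<in>?S. z M * Y N M) * D N"
      unfolding xz[OF N] sum_distrib_right by (simp add: mult.assoc)
    then show "y N * (\<Sum>M\<in>?S. z M * Y N M) = x N * y N * inverse (D N)"
      using diag[OF N] by simp
  qed
  finally show ?thesis .
qed

lemma form_PP:
  assumes "L \<in> Pnr n r" "M \<in> Pnr n r"
  shows "form r n (P True L) (P False M) = (if L = M then inverse (D L) else 0)"
proof -
  have "lincomb (Pnr n r) (\<lambda>N. if N = K then 1 else 0) (P eps) = P eps K" if "K \<in> Pnr n r" for K eps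
    using lincomb_delta[OF finite_Pnr that, of 1 "P eps"] by (simp add: ssmult_def)
  then have "form r n (P True L) (P False M)
      = (\<Sum>N\<in>Pnr n r. (if N = L then 1 else 0) * (if N = M then 1 else 0) * inverse (D N))"
    using form_P[of "\<lambda>N. if N = L then 1 else 0" "\<lambda>N. if N = M then 1 else 0"] assms by simp
  also have "\<dots> = (\<Sum>N\<in>Pnr n r. if N = L then (if L = M then inverse (D L) else 0) else 0)"
    by (intro sum.cong) auto
  also have "\<dots> = (if L = M then inverse (D L) else 0)"
    using finite_Pnr assms by simp
  finally show ?thesis .
qed

lemma lower_R: "L \<in> Pnr n r \<Longrightarrow> {M\<in>Pnr n r. (M, L) \<in> R} = {M\<in>Pnr n r. rk M \<le> rk L}"
  using R_iff by blast

lemma upper_R: "L \<in> Pnr n r \<Longrightarrow> {M\<in>Pnr n r. (L, M) \<in> R} = {M\<in>Pnr n r. rk L \<le> rk M}"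
  using R_iff by blast

text \<open>At the origin the row of \<open>T\<close> at \<open>L\<close> becomes the Kostka row,
  which is the monomial expansion of \<open>schur r L\<close>. That expansion is used over the
  integers, because the condition compares with an integral series.\<close>

lemma HL_conds_P: "HL_conds r n R (P eps)"
  unfolding HL_conds_def
proof (intro ballI conjI allI)
  note A = local_hom_subring[OF local_hom_eval0]
  fix L assume L: "L \<in> Pnr n r"
  have mA: "monsym r M m \<in> Asub" "eval0 (monsym r M m) = monsym r M m" for M m
    using subring_set_zero[OF A] subring_set_one[OF A] local_hom_zero[OF local_hom_eval0]
      local_hom_one[OF local_hom_eval0] by (simp_all add: monsym_def)
  have tA: "T eps L M * monsym r M m \<in> Asub" if "M \<in> Pnr n r" for M m
    using subring_set_mult[OF A T_facts(1)[OF L that] mA(1)] .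
  have "P eps L \<in> Xi r n UNIV"
    unfolding P_eq[OF L] by (rule Xi_lincomb) (rule Xi_monsym)
  moreover have "P eps L m \<in> Asub" for m
    unfolding P_eq[OF L] lincomb_def by (rule subring_set_sum[OF A]) (rule tA)
  ultimately show "P eps L \<in> Xi r n Asub"
    unfolding Xi_iff by simp
  show "\<exists>u. (\<forall>M. u M \<in> Asub) \<and> u L = 1 \<and> P eps L = lincomb {M\<in>Pnr n r. (M,L) \<in> R} u (schur r)"
    unfolding lower_R[OF L] by (rule P_schur[OF L])
  fix m
  have "eval0 (P eps L m) = (\<Sum>M\<in>Pnr n r. eval0 (T eps L M * monsym r M m))"
    unfolding P_eq[OF L] lincomb_def by (rule local_hom_sum[OF local_hom_eval0]) (rule tA)
  also have "\<dots> = (\<Sum>M\<in>Pnr n r. of_nat (kostka n r L M) * monsym r M m)"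
    by (intro sum.cong refl)
      (simp add: local_hom_mult[OF local_hom_eval0] T_facts[OF L] mA)
  also have "\<dots> = of_int (\<Sum>M\<in>Pnr n r. of_nat (kostka n r L M) * monsym r M m)"
    by (simp add: monsym_def if_distrib[of of_int] cong: if_cong)
  also have "(\<Sum>M\<in>Pnr n r. of_nat (kostka n r L M) * monsym r M m) = (schur r L m :: int)"
  proof -
    have "(schur r L :: int series) = lincomb (Pnr n r) (\<lambda>M. schur r L (rep M)) (monsym r)"
      by (rule Xi_expand[OF Xi_schur[OF L]])
    also have "\<dots> = lincomb (Pnr n r) (\<lambda>M. of_nat (kostka n r L M)) (monsym r)"
      by (rule lincomb_cong) (simp_all add: schur_rep[OF L])
    finally have "schur r L m = (lincomb (Pnr n r) (\<lambda>M. of_nat (kostka n r L M)) (monsym r) m :: int)"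
      by (rule fun_cong)
    then show ?thesis
      by (simp add: lincomb_def)
  qed
  finally show "eval0 (P eps L m) = of_int (schur r L m)" .
qed

text \<open>Any candidate family is unitriangular over the Schur functions, just as \<open>P\<close>
  is; so it is unitriangular over \<open>P\<close>.\<close>

lemma HL_conds_lincomb_P:
  assumes "HL_conds r n R Q"
  obtains U where "\<And>L. L \<in> Pnr n r \<Longrightarrow> Q L = lincomb (Pnr n r) (U L) (P eps)"
    "\<And>L M. L \<in> Pnr n r \<Longrightarrow> M \<in> Pnr n r \<Longrightarrow> U L M \<noteq> 0 \<Longrightarrow> rk M \<le> rk L"
    "\<And>L. L \<in> Pnr n r \<Longrightarrow> U L L = 1"
proof -
  have "\<exists>u. Q L = lincomb (Pnr n r) u (P eps) \<and> (\<forall>M\<in>Pnr n r. u M \<noteq> 0 \<longrightarrow> rk M \<le> rk L) \<and> u L = 1"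
    if L: "L \<in> Pnr n r" for L
  proof -
    let ?lo = "{M\<in>Pnr n r. rk M \<le> rk L}"
    define t where "t K = (SOME u. u K = 1 \<and> P eps K = lincomb {M\<in>Pnr n r. rk M \<le> rk K} u (schur r))" for K
    have t: "P eps K = lincomb {M\<in>Pnr n r. rk M \<le> rk K} (t K) (schur r) \<and> t K K = 1" if "K \<in> Pnr n r" for K
    proof -
      have "\<exists>u. u K = 1 \<and> P eps K = lincomb {M\<in>Pnr n r. rk M \<le> rk K} u (schur r)"
        using P_schur[OF that, of eps] by blast
      from someI_ex[OF this] show ?thesis
        unfolding t_def[of K, symmetric] by blast
    qed
    obtain u where u: "u L = 1" "Q L = lincomb ?lo u (schur r)"
      using assms L unfolding HL_conds_def lower_R[OF L, symmetric] by blast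
    obtain u' where u': "lincomb ?lo u (schur r) = lincomb ?lo u' (P eps)" "u' L * t L L = u L"
      by (rule triangular_span[OF finite_Pnr inj subring_set_UNIV, of "P eps" t "schur r" u L])
        (use t L in auto)
    have "Q L = lincomb (Pnr n r) (\<lambda>M. if M \<in> ?lo then u' M else 0) (P eps)"
      unfolding u(2) u'(1) by (rule lincomb_mono_neutral[OF finite_Pnr]) blast
    then show ?thesis
      using u(1) u'(2) t[OF L] L by (intro exI[of _ "\<lambda>M. if M \<in> ?lo then u' M else 0"]) auto
  qed
  then have "\<exists>U. \<forall>L\<in>Pnr n r. Q L = lincomb (Pnr n r) (U L) (P eps)
      \<and> (\<forall>M\<in>Pnr n r. U L M \<noteq> 0 \<longrightarrow> rk M \<le> rk L) \<and> U L L = 1"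
    by (intro bchoice ballI) blast
  then show thesis
    using that by blast
qed

text \<open>Resolves the definite description. A competing pair is \<open>U\<close> applied to
  \<open>P True\<close> and \<open>W\<close> applied to \<open>P False\<close>; as the form is
  diagonal on these bases, its orthogonality becomes the hypothesis of
  \<open>orthogonal_unitriangular_trivial\<close>.\<close>

lemma HL_pair_eq: "HL_pair r n R = (P True, P False)"
  unfolding HL_pair_def
proof (rule the_equality)
  show "(\<forall>L. L \<notin> Pnr n r \<longrightarrow> fst (P True, P False) L = (\<lambda>_. 0) \<and> snd (P True, P False) L = (\<lambda>_. 0))
      \<and> HL_conds r n R (fst (P True, P False)) \<and> HL_conds r n R (snd (P True, P False))
      \<and> (\<forall>L\<in>Pnr n r. \<forall>M\<in>Pnr n r. L \<noteq> M \<longrightarrow> form r n (fst (P True, P False) L) (snd (P True, P False) M) = 0)"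
    using HL_conds_P form_PP by (simp add: P_def)
next
  fix PP
  assume "(\<forall>L. L \<notin> Pnr n r \<longrightarrow> fst PP L = (\<lambda>_. 0) \<and> snd PP L = (\<lambda>_. 0))
      \<and> HL_conds r n R (fst PP) \<and> HL_conds r n R (snd PP)
      \<and> (\<forall>L\<in>Pnr n r. \<forall>M\<in>Pnr n r. L \<noteq> M \<longrightarrow> form r n (fst PP L) (snd PP M) = 0)"
  then have zero: "\<And>L. L \<notin> Pnr n r \<Longrightarrow> fst PP L = (\<lambda>_. 0) \<and> snd PP L = (\<lambda>_. 0)"
    and conds: "HL_conds r n R (fst PP)" "HL_conds r n R (snd PP)"
    and orth: "\<And>L M. L \<in> Pnr n r \<Longrightarrow> M \<in> Pnr n r \<Longrightarrow> L \<noteq> M \<Longrightarrow> form r n (fst PP L) (snd PP M) = 0"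
    by blast+
  obtain U where U: "\<And>L. L \<in> Pnr n r \<Longrightarrow> fst PP L = lincomb (Pnr n r) (U L) (P True)"
    "\<And>L M. L \<in> Pnr n r \<Longrightarrow> M \<in> Pnr n r \<Longrightarrow> U L M \<noteq> 0 \<Longrightarrow> rk M \<le> rk L"
    "\<And>L. L \<in> Pnr n r \<Longrightarrow> U L L = 1"
    using HL_conds_lincomb_P[OF conds(1), of True] by blast
  obtain W where W: "\<And>L. L \<in> Pnr n r \<Longrightarrow> snd PP L = lincomb (Pnr n r) (W L) (P False)"
    "\<And>L M. L \<in> Pnr n r \<Longrightarrow> M \<in> Pnr n r \<Longrightarrow> W L M \<noteq> 0 \<Longrightarrow> rk M \<le> rk L"
    "\<And>L. L \<in> Pnr n r \<Longrightarrow> W L L = 1"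
    using HL_conds_lincomb_P[OF conds(2), of False] by blast
  have triv: "U L M = (if L = M then 1 else 0) \<and> W L M = (if L = M then 1 else 0)"
    if "L \<in> Pnr n r" "M \<in> Pnr n r" for L M
  proof (rule orthogonal_unitriangular_trivial[where d = "\<lambda>N. inverse (D N)", OF finite_Pnr inj U(2) W(2) _ _ that])
    show "U K K = 1 \<and> W K K = 1 \<and> inverse (D K) \<noteq> 0" if "K \<in> Pnr n r" for K
      using U(3) W(3) diag that by simp
    show "(\<Sum>a\<in>Pnr n r. U K a * W N a * inverse (D a)) = 0" if "K \<in> Pnr n r" "N \<in> Pnr n r" "K \<noteq> N" for K N
      using orth[OF that] form_P[of "U K" "W N"] U(1)[OF that(1)] W(1)[OF that(2)] by simp
  qed
  have delta: "lincomb (Pnr n r) a (P eps) = P eps L"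
    if "L \<in> Pnr n r" "\<And>M. M \<in> Pnr n r \<Longrightarrow> a M = (if L = M then 1 else 0)" for a eps L
  proof -
    have "lincomb (Pnr n r) a (P eps) = lincomb (Pnr n r) (\<lambda>M. if M = L then 1 else 0) (P eps)"
      using that(2) by (intro lincomb_cong) auto
    then show ?thesis
      using lincomb_delta[OF finite_Pnr that(1), of 1 "P eps"] by (simp add: ssmult_def)
  qed
  have "fst PP L = P True L \<and> snd PP L = P False L" for L
  proof (cases "L \<in> Pnr n r")
    case True
    then show ?thesis
      using U(1) W(1) delta[OF True, of "U L" True] delta[OF True, of "W L" False] triv by simp
  next
    case False
    then show ?thesis
      using zero by (simp add: P_def)
  qed
  then show "PP = (P True, P False)"
    by (simp add: prod_eq_iff fun_eq_iff)
qed

lemma HLP_eq: "HLP r n R eps L = P eps L"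
  by (simp add: HLP_def HL_pair_eq)

text \<open>The pairing of the two functions at \<open>L\<close> is \<open>inverse (D L)\<close>, so
  the normalizing factor \<open>bfun\<close> is the pivot \<open>D L\<close> itself.\<close>

lemma HLQ_eq: "L \<in> Pnr n r \<Longrightarrow> HLQ r n R eps L = ssmult (D L) (P eps L)"
  by (simp add: HLQ_def bfun_def HLP_eq form_PP)

lemma Xi_scaled_P:
  assumes "L \<in> Pnr n r"
  shows "ssmult x (P eps L) \<in> Xi r n UNIV"
  unfolding P_eq[OF assms] lincomb_scale by (rule Xi_lincomb) (rule Xi_monsym)

theorem HLP_characterization:
  assumes L: "L \<in> Pnr n r"
  shows "(F \<in> Xi r n UNIV
             \<and> (\<exists>c. c L \<noteq> 0 \<and> F = lincomb {M\<in>Pnr n r. (L, M) \<in> R} c (qmulti r eps))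
             \<and> (\<exists>u. u L = 1 \<and> F = lincomb {M\<in>Pnr n r. (M, L) \<in> R} u (schur r)))
           \<longleftrightarrow> F = HLP r n R eps L"
  unfolding lower_R[OF L] upper_R[OF L] HLP_eq
proof (intro iffI; (elim conjE exE)?)
  fix c u
  assume "u L = 1" "F = lincomb {M\<in>Pnr n r. rk L \<le> rk M} c (qmulti r eps)"
    "F = lincomb {M\<in>Pnr n r. rk M \<le> rk L} u (schur r)"
  then have "F = ssmult (u L) (P eps L)"
    using characterization(1)[OF L] by blast
  then show "F = P eps L"
    using \<open>u L = 1\<close> by (simp add: ssmult_def)
next
  assume F: "F = P eps L"
  have 1: "ssmult 1 (P eps L) = F"
    by (simp add: F ssmult_def)
  have D: "D L \<noteq> 0" using diag[OF L] by blast
  obtain c where c: "c L = 1 / D L" "F = lincomb {M\<in>Pnr n r. rk L \<le> rk M} c (qmulti r eps)"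
    using characterization(2)[OF L, of 1 eps] unfolding 1 by blast
  have "c L \<noteq> 0"
    using c(1) D by simp
  moreover have "F \<in> Xi r n UNIV"
    using Xi_scaled_P[OF L, of 1 eps] unfolding 1 .
  moreover have "\<exists>u. u L = 1 \<and> F = lincomb {M\<in>Pnr n r. rk M \<le> rk L} u (schur r)"
    using characterization(3)[OF L, of 1 eps] unfolding 1 .
  ultimately show "F \<in> Xi r n UNIV \<and> (\<exists>c. c L \<noteq> 0 \<and> F = lincomb {M\<in>Pnr n r. rk L \<le> rk M} c (qmulti r eps))
     \<and> (\<exists>u. u L = 1 \<and> F = lincomb {M\<in>Pnr n r. rk M \<le> rk L} u (schur r))"
    using c(2) by blast
qed

theorem HLQ_characterization:
  assumes L: "L \<in> Pnr n r"
  shows "(F \<in> Xi r n UNIV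
             \<and> (\<exists>c. c L = 1 \<and> F = lincomb {M\<in>Pnr n r. (L, M) \<in> R} c (qmulti r eps))
             \<and> (\<exists>u. u L \<noteq> 0 \<and> F = lincomb {M\<in>Pnr n r. (M, L) \<in> R} u (schur r)))
           \<longleftrightarrow> F = HLQ r n R eps L"
  unfolding lower_R[OF L] upper_R[OF L] HLQ_eq[OF L]
proof (intro iffI; (elim conjE exE)?)
  fix c u
  assume "c L = 1" "F = lincomb {M\<in>Pnr n r. rk L \<le> rk M} c (qmulti r eps)"
    "F = lincomb {M\<in>Pnr n r. rk M \<le> rk L} u (schur r)"
  then have "F = ssmult (u L) (P eps L) \<and> u L = c L * D L"
    using characterization(1)[OF L] by blast
  then show "F = ssmult (D L) (P eps L)"
    using \<open>c L = 1\<close> by simp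
next
  assume F: "F = ssmult (D L) (P eps L)"
  have D: "D L \<noteq> 0" using diag[OF L] by blast
  have q: "\<exists>c. c L = 1 \<and> F = lincomb {M\<in>Pnr n r. rk L \<le> rk M} c (qmulti r eps)"
    using characterization(2)[OF L, of "D L" eps] D unfolding F by simp
  have Xi: "F \<in> Xi r n UNIV"
    unfolding F by (rule Xi_scaled_P[OF L])
  obtain u where u: "u L = D L" "F = lincomb {M\<in>Pnr n r. rk M \<le> rk L} u (schur r)"
    using characterization(3)[OF L, of "D L" eps] unfolding F by blast
  have "\<exists>u. u L \<noteq> 0 \<and> F = lincomb {M\<in>Pnr n r. rk M \<le> rk L} u (schur r)"
    by (rule exI[of _ u]) (use u D in simp)
  with Xi q show "F \<in> Xi r n UNIV \<and> (\<exists>c. c L = 1 \<and> F = lincomb {M\<in>Pnr n r. rk L \<le> rk M} c (qmulti r eps))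
     \<and> (\<exists>u. u L \<noteq> 0 \<and> F = lincomb {M\<in>Pnr n r. rk M \<le> rk L} u (schur r))"
    by blast
qed

end

text \<open>The rank counts the elements below \<open>L\<close>, including \<open>L\<close> itself.
  Transitivity makes it monotone, and totality makes it reflect the order.\<close>

lemma linear_order_rank:
  assumes fin: "finite S" and R: "linear_order_on S R"
  obtains rk :: "'b \<Rightarrow> nat" where "inj_on rk S" "\<And>L M. L \<in> S \<Longrightarrow> M \<in> S \<Longrightarrow> (M, L) \<in> R \<longleftrightarrow> rk M \<le> rk L"
proof -
  define rk where "rk L = card {M\<in>S. (M, L) \<in> R}" for L
  have refl: "(L, L) \<in> R" if "L \<in> S" for L
    using R that by (auto simp: order_on_defs refl_on_def)
  have trans: "(L, K) \<in> R" if "(L, M) \<in> R" "(M, K) \<in> R" for L M K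
    using R that unfolding order_on_defs trans_def by blast
  have antisym: "L = M" if "(L, M) \<in> R" "(M, L) \<in> R" for L M
    using R that unfolding order_on_defs antisym_def by blast
  have total: "(L, M) \<in> R \<or> (M, L) \<in> R" if "L \<in> S" "M \<in> S" for L M
    using R that refl unfolding order_on_defs total_on_def by metis
  have iff: "(M, L) \<in> R \<longleftrightarrow> rk M \<le> rk L" if L: "L \<in> S" and M: "M \<in> S" for L M
  proof
    assume "(M, L) \<in> R"
    then have "{N\<in>S. (N, M) \<in> R} \<subseteq> {N\<in>S. (N, L) \<in> R}"
      using trans by blast
    then show "rk M \<le> rk L"
      unfolding rk_def using fin by (intro card_mono) auto
  next
    assume le: "rk M \<le> rk L"
    show "(M, L) \<in> R"
    proof (rule ccontr)
      assume not: "(M, L) \<notin> R"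
      then have "(L, M) \<in> R"
        using total L M by blast
      then have "{N\<in>S. (N, L) \<in> R} \<subseteq> {N\<in>S. (N, M) \<in> R}"
        using trans by blast
      moreover have "M \<in> {N\<in>S. (N, M) \<in> R}" "M \<notin> {N\<in>S. (N, L) \<in> R}"
        using refl M not by auto
      ultimately have "{N\<in>S. (N, L) \<in> R} \<subset> {N\<in>S. (N, M) \<in> R}"
        by blast
      then have "rk L < rk M"
        unfolding rk_def using fin by (intro psubset_card_mono) auto
      then show False using le by simp
    qed
  qed
  have "inj_on rk S"
    unfolding inj_on_def using iff antisym by (metis order_refl)
  then show thesis
    using iff by (rule that)
qed

theorem theorem2p14:
  fixes r n :: nat and R :: "multipart rel" and eps :: bool and L :: multipart
  assumes "r \<ge> 2"
    and "linear_order_on (Pnr n r) R"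
    and "\<forall>M\<in>Pnr n r. \<forall>N\<in>Pnr n r. dominates r M N \<longrightarrow> (M, N) \<in> R"
    and "L \<in> Pnr n r"
  shows "(\<forall>F. (F \<in> Xi r n (UNIV :: ratfun set)
             \<and> (\<exists>c. c L \<noteq> 0 \<and> F = lincomb {M\<in>Pnr n r. (L, M) \<in> R} c (qmulti r eps))
             \<and> (\<exists>u. u L = 1 \<and> F = lincomb {M\<in>Pnr n r. (M, L) \<in> R} u (schur r)))
           \<longleftrightarrow> F = HLP r n R eps L)
       \<and> (\<forall>F. (F \<in> Xi r n (UNIV :: ratfun set)
             \<and> (\<exists>c. c L = 1 \<and> F = lincomb {M\<in>Pnr n r. (L, M) \<in> R} c (qmulti r eps))
             \<and> (\<exists>u. u L \<noteq> 0 \<and> F = lincomb {M\<in>Pnr n r. (M, L) \<in> R} u (schur r)))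
           \<longleftrightarrow> F = HLQ r n R eps L)"
proof -
  let ?S = "Pnr n r"
  let ?K = "\<lambda>L M. of_nat (kostka n r L M) :: rat"
  obtain rk :: "multipart \<Rightarrow> nat" where inj: "inj_on rk ?S"
    and iff: "\<And>L M. L \<in> ?S \<Longrightarrow> M \<in> ?S \<Longrightarrow> (M, L) \<in> R \<longleftrightarrow> rk M \<le> rk L"
    using linear_order_rank[OF finite_Pnr assms(2)] by blast
  \<comment> \<open>Here the total order meets dominance: a nonzero Kostka number means that the
    content is dominated by the shape, so the Kostka matrix is lower triangular for the
    rank.\<close>
  have tri: "rk M \<le> rk L" if "L \<in> ?S" "M \<in> ?S" "kostka n r L M \<noteq> 0" for L M
  proof -
    have "dominates r M L"
      using kostka_dominates[OF _ that] assms(1) by simp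
    then show ?thesis
      using assms(3) that(1,2) iff by blast
  qed
  have "\<exists>X Y D. (\<forall>L\<in>?S. \<forall>M\<in>?S. X L M \<in> Asub \<and> Y L M \<in> Asub \<and> eval0 (X L M) = ?K L M \<and> eval0 (Y L M) = ?K L M
            \<and> (X L M \<noteq> 0 \<longrightarrow> rk M \<le> rk L) \<and> (Y L M \<noteq> 0 \<longrightarrow> rk M \<le> rk L)
            \<and> qmulti r True L (rep M) = (\<Sum>N\<in>?S. Y N L * D N * X N M))
          \<and> (\<forall>L\<in>?S. X L L = 1 \<and> Y L L = 1 \<and> D L \<noteq> 0)"
  proof (rule triangular_factorization[OF local_hom_eval0 finite_Pnr inj])
    show "qmulti r True L (rep M) \<in> Asub" if "L \<in> ?S" "M \<in> ?S" for L M
      by (rule eval0_qmulti(1)[OF that])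
    show "eval0 (qmulti r True L (rep M)) = (\<Sum>N\<in>?S. ?K N L * ?K N M)" if "L \<in> ?S" "M \<in> ?S" for L M
      by (rule eval0_qmulti(2)[OF that])
    show "rk M \<le> rk L" if "L \<in> ?S" "M \<in> ?S" "?K L M \<noteq> 0" for L M
      using tri[OF that(1,2)] that(3) by simp
    show "?K L L = 1" if "L \<in> ?S" for L
      using kostka_self[OF that] by simp
  qed
  then obtain X Y D where
    XY: "\<forall>L\<in>?S. \<forall>M\<in>?S. X L M \<in> Asub \<and> Y L M \<in> Asub \<and> eval0 (X L M) = ?K L M \<and> eval0 (Y L M) = ?K L M
            \<and> (X L M \<noteq> 0 \<longrightarrow> rk M \<le> rk L) \<and> (Y L M \<noteq> 0 \<longrightarrow> rk M \<le> rk L)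
            \<and> qmulti r True L (rep M) = (\<Sum>N\<in>?S. Y N L * D N * X N M)"
    and diag: "\<forall>L\<in>?S. X L L = 1 \<and> Y L L = 1 \<and> D L \<noteq> 0"
    by (elim exE conjE) (rule that)
  have "hall_littlewood r n R rk X Y D"
    by (unfold_locales; (fact assms(1) inj)?) (use iff tri XY diag in \<open>simp_all\<close>)
  then interpret hall_littlewood r n R rk X Y D .
  show ?thesis
    by (intro conjI allI) (rule HLP_characterization[OF assms(4)], rule HLQ_characterization[OF assms(4)])
qed

end
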